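(* Let $\mu$ be a compactly supported Borel probability measure on $\mathbb R$ with $m_1=0$, $m_2=1$. Then there exist positive constants $c_1(\mu),c_2(\mu),c(\mu)$ depending only on $\mu$ such that, for every integer $n\ge c_1(\mu)$, the density $p_n$ of the distribution function $F_n$ of $Y_n=(X_1+\dots+X_n)/\sqrt n$ (with $X_1,X_2,\dots$ free, each with distribution $\mu$) is a continuous function with $p_n(x)\le 2$ for all $x\in\mathbb R$, and, with $h=c_2(\mu)/n^{3/2}$, for every $x\in[-\frac2{e_n}+h,\frac2{e_n}-h]$, $$p_n(x+a_n)=\Big(1+\frac12d_n-a_n^2-\frac1n-a_nx-\Big(b_n-a_n^2-\frac1n\Big)x^2\Big)p_w(e_nx)+\frac{c(\mu)\,\theta}{n^{3/2}\sqrt{4-(e_nx)^2}},$$ where $\theta=\theta(n,x)$ is real with $|\theta|\le1$. Moreover, $$\int_{\mathbb R\setminus[-\frac2{e_n}+h,\frac2{e_n}-h]}p_n(x+a_n)\,dx\le\frac{c(\mu)}{n^{3/2}}.$$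
   Context: For a probability measure $\mu$ on $\mathbb R$: $m_k=\int u^k\,\mu(du)$. If $X_1,\dots,X_n$ are free with common distribution $\mu$, the distribution of $X_1+\dots+X_n$ is the $n$-fold free additive convolution $\mu^{n\boxplus}$, and $F_n(x)=\mu^{n\boxplus}((-\infty,\sqrt n\,x))$. It is known that, since $\mu$ is not a Dirac measure, $F_n$ is absolutely continuous with respect to Lebesgue measure for all sufficiently large $n$, $n\ge c_1(\mu)$; $p_n$ denotes its density. Notation: $p_w(x)=\frac1{2\pi}\sqrt{(4-x^2)_+}$; $a_n=\frac{m_3}{\sqrt n}$, $b_n=\frac{m_4-m_3^2-1}{n}$, $d_n=\frac{m_4-m_3^2}{n}$, and $e_n=(1-b_n)/\sqrt{1-d_n}$ (defined for $n>m_4$, in particular for all large $n$). *)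

theory Defs
  imports "HOL-Probability.Probability" "HOL-Library.Poly_Mapping"
begin

definition moment :: "real measure \<Rightarrow> nat \<Rightarrow> real" where
  "moment \<mu> k = (LINT u|\<mu>. u ^ k)"

definition compactly_supported :: "real measure \<Rightarrow> bool" where
  "compactly_supported \<mu> \<longleftrightarrow> (\<exists>K. compact K \<and> emeasure \<mu> (- K) = 0)"

text \<open>
  The distribution of an element \<open>a\<close> with respect to a functional \<open>\<phi>\<close> is the compactly supported
  Borel probability measure whose moments are \<open>\<phi> (a ^ k)\<close>; compact support makes it unique.
\<close>

definition has_distribution :: "('a::ring_1 \<Rightarrow> complex) \<Rightarrow> 'a \<Rightarrow> real measure \<Rightarrow> bool" where
  "has_distribution \<phi> a \<mu> \<longleftrightarrow> real_distribution \<mu> \<and> compactly_supported \<mu> \<and>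
     (\<forall>k. \<phi> (a ^ k) = complex_of_real (moment \<mu> k))"

text \<open>
  A noncommutative probability space is a unital complex algebra with a unital linear functional.
  No involution or positivity is required: the moments of a sum of free elements are determined
  by the individual moments alone, and self-adjoint elements of a \<open>C\<^sup>*\<close>-probability space with
  a state are covered as a special case.
\<close>

locale nc_prob_space = vector_space scale
  for scale :: "complex \<Rightarrow> 'a::ring_1 \<Rightarrow> 'a" +
  fixes \<phi> :: "'a \<Rightarrow> complex"
  assumes scale_mult_left: "scale c x * y = scale c (x * y)"
    and scale_mult_right: "x * scale c y = scale c (x * y)"
    and linear_functional: "Vector_Spaces.linear scale (*) \<phi>"
    and unital: "\<phi> 1 = 1"
begin

definition generated_algebra :: "'a \<Rightarrow> 'a set" where
  "generated_algebra a = span (range (\<lambda>k. a ^ k))"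

definition free_family :: "('i \<Rightarrow> 'a) \<Rightarrow> 'i set \<Rightarrow> bool" where
  "free_family X I \<longleftrightarrow>
     (\<forall>is as. is \<noteq> [] \<and> set is \<subseteq> I \<and> distinct_adj is \<and>
        list_all2 (\<lambda>i a. a \<in> generated_algebra (X i) \<and> \<phi> a = 0) is as
        \<longrightarrow> \<phi> (prod_list as) = 0)"

end

text \<open>
  The joint distribution of countably many elements of any noncommutative probability space lives
  on the free unital complex algebra in countably many indeterminates, i.e. the monoid algebra of
  the free monoid of words. Fixing this algebra as the carrier therefore loses no generality (see
  \<open>free_convolution_powerI\<close> below) and makes the convolution power a notion independent of the
  space carrying the free elements.
\<close>

datatype 'i word = Word "'i list"

instantiation word :: (type) monoid_add
begin

definition zero_word :: "'i word" where "zero_word = Word []"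

fun plus_word :: "'i word \<Rightarrow> 'i word \<Rightarrow> 'i word" where
  "plus_word (Word u) (Word v) = Word (u @ v)"

instance
proof
  fix a b c :: "'i word"
  show "a + b + c = a + (b + c)" by (cases a; cases b; cases c) simp
  show "0 + a = a" and "a + 0 = a" by (cases a; simp add: zero_word_def)+
qed

end

type_synonym free_algebra = "nat word \<Rightarrow>\<^sub>0 complex"

definition free_algebra_scale :: "complex \<Rightarrow> free_algebra \<Rightarrow> free_algebra" where
  "free_algebra_scale c p = Poly_Mapping.single 0 c * p"

text \<open>
  Stated as a relation; since a compactly supported measure is determined by its moments, \<open>\<mu>\<close> and
  \<open>n\<close> determine \<open>\<nu>\<close>, the \<open>n\<close>-fold free additive convolution of \<open>\<mu>\<close>.
\<close>

definition is_free_convolution_power :: "real measure \<Rightarrow> nat \<Rightarrow> real measure \<Rightarrow> bool" where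
  "is_free_convolution_power \<mu> n \<nu> \<longleftrightarrow>
     (\<exists>(\<phi> :: free_algebra \<Rightarrow> complex) (X :: nat \<Rightarrow> free_algebra).
        nc_prob_space free_algebra_scale \<phi> \<and>
        nc_prob_space.free_family free_algebra_scale \<phi> X {..<n} \<and>
        (\<forall>i<n. has_distribution \<phi> (X i) \<mu>) \<and>
        has_distribution \<phi> (\<Sum>i<n. X i) \<nu>)"

lemma single_zero_commute:
  fixes p :: free_algebra
  shows "Poly_Mapping.single 0 c * p = p * Poly_Mapping.single 0 c"
proof (induction p rule: update_induct)
  case const
  show ?case by simp
next
  case (update f a b)
  have "Poly_Mapping.update a b f = f + Poly_Mapping.single a b"
    using update by (intro poly_mapping_eqI)
      (auto simp: lookup_update lookup_add lookup_single when_def in_keys_iff)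
  then show ?case
    by (simp add: algebra_simps update.IH mult_single)
qed

context nc_prob_space
begin

fun word_value :: "(nat \<Rightarrow> 'a) \<Rightarrow> nat word \<Rightarrow> 'a" where
  "word_value X (Word w) = prod_list (map X w)"

lemma word_value_zero: "word_value X 0 = 1"
  by (simp add: zero_word_def)

lemma word_value_add: "word_value X (u + v) = word_value X u * word_value X v"
  by (cases u; cases v) simp

definition evaluate :: "(nat \<Rightarrow> 'a) \<Rightarrow> free_algebra \<Rightarrow> 'a" where
  "evaluate X p = (\<Sum>w\<in>Poly_Mapping.keys p. scale (Poly_Mapping.lookup p w) (word_value X w))"

lemma evaluate_superset:
  assumes "finite S" "Poly_Mapping.keys p \<subseteq> S"
  shows "evaluate X p = (\<Sum>w\<in>S. scale (Poly_Mapping.lookup p w) (word_value X w))"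
  unfolding evaluate_def
  by (rule sum.mono_neutral_left) (use assms in \<open>auto simp: in_keys_iff\<close>)

lemma evaluate_add: "evaluate X (p + q) = evaluate X p + evaluate X q"
proof -
  have "Poly_Mapping.keys (p + q) \<subseteq> Poly_Mapping.keys p \<union> Poly_Mapping.keys q"
    by (rule Poly_Mapping.keys_add)
  then show ?thesis
    by (simp add: evaluate_superset[of "Poly_Mapping.keys p \<union> Poly_Mapping.keys q"] lookup_add scale_left_distrib sum.distrib)
qed

lemma evaluate_zero: "evaluate X 0 = 0"
  by (simp add: evaluate_def)

lemma evaluate_single: "evaluate X (Poly_Mapping.single w c) = scale c (word_value X w)"
  by (simp add: evaluate_def)

lemma evaluate_one: "evaluate X 1 = 1"
  by (simp add: evaluate_single word_value_zero flip: single_one)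

lemma poly_mapping_single_induct:
  fixes p :: free_algebra
  assumes "P 0" "\<And>p w c. P p \<Longrightarrow> P (p + Poly_Mapping.single w c)"
  shows "P p"
proof (induction p rule: update_induct)
  case const
  show ?case by (fact assms(1))
next
  case (update f a b)
  have "Poly_Mapping.update a b f = f + Poly_Mapping.single a b"
    using update by (intro poly_mapping_eqI)
      (auto simp: lookup_update lookup_add lookup_single when_def in_keys_iff)
  then show ?case
    using assms(2)[OF update.IH] by simp
qed

lemma evaluate_mult_single:
  "evaluate X (p * Poly_Mapping.single w c) = evaluate X p * evaluate X (Poly_Mapping.single w c)"
  by (induction p rule: poly_mapping_single_induct)
    (simp_all add: evaluate_zero evaluate_add evaluate_single distrib_right mult_single
      word_value_add scale_mult_left scale_mult_right scale_right_distrib mult.commute)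

lemma evaluate_mult: "evaluate X (p * q) = evaluate X p * evaluate X q"
  by (induction q rule: poly_mapping_single_induct)
    (simp_all add: evaluate_zero evaluate_add distrib_left evaluate_mult_single)

lemma evaluate_scale: "evaluate X (free_algebra_scale c p) = scale c (evaluate X p)"
  by (simp add: free_algebra_scale_def evaluate_mult evaluate_single word_value_zero scale_mult_left)

lemma evaluate_power: "evaluate X (p ^ k) = evaluate X p ^ k"
  by (induction k) (simp_all add: evaluate_one evaluate_mult)

lemma evaluate_sum: "evaluate X (\<Sum>i\<in>I. f i) = (\<Sum>i\<in>I. evaluate X (f i))"
  by (induction I rule: infinite_finite_induct) (simp_all add: evaluate_zero evaluate_add)

lemma evaluate_prod_list: "evaluate X (prod_list ps) = prod_list (map (evaluate X) ps)"
  by (induction ps) (simp_all add: evaluate_one evaluate_mult)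

lemma vector_space_free_algebra: "vector_space free_algebra_scale"
  by unfold_locales
    (simp_all add: free_algebra_scale_def algebra_simps single_add mult_single flip: mult.assoc)

lemma nc_prob_space_evaluate: "nc_prob_space free_algebra_scale (\<lambda>p. \<phi> (evaluate X p))"
proof -
  interpret F: vector_space free_algebra_scale by (rule vector_space_free_algebra)
  interpret L: Vector_Spaces.linear scale "(*)" \<phi> by (rule linear_functional)
  have C: "vector_space ((*) :: complex \<Rightarrow> complex \<Rightarrow> complex)"
    by unfold_locales (simp_all add: algebra_simps)
  show ?thesis
  proof (unfold_locales, goal_cases)
    case (1 c x y)
    then show ?case by (simp add: free_algebra_scale_def mult.assoc)
  next
    case (2 x c y)
    then show ?case
      by (metis free_algebra_scale_def mult.assoc single_zero_commute)
  qed (auto simp: evaluate_add evaluate_scale evaluate_one unital L.add L.scale algebra_simps)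
qed

lemma free_convolution_powerI:
  assumes free: "free_family X {..<n}"
    and X: "\<And>i. i < n \<Longrightarrow> has_distribution \<phi> (X i) \<mu>"
    and sum: "has_distribution \<phi> (\<Sum>i<n. X i) \<nu>"
  shows "is_free_convolution_power \<mu> n \<nu>"
proof -
  let ?\<phi> = "\<lambda>p. \<phi> (evaluate X p)"
  let ?x = "\<lambda>i. Poly_Mapping.single (Word [i]) 1 :: free_algebra"
  interpret F: nc_prob_space free_algebra_scale ?\<phi> by (rule nc_prob_space_evaluate)
  have x: "evaluate X (?x i) = X i" for i
    by (simp add: evaluate_single)
  have gen: "evaluate X p \<in> generated_algebra (X i)" if "p \<in> F.generated_algebra (?x i)" for p i
    using that unfolding F.generated_algebra_def
  proof (induction rule: F.span_induct_alt)
    case base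
    show ?case by (simp add: generated_algebra_def evaluate_zero span_zero)
  next
    case (step c q r)
    then have "evaluate X q \<in> generated_algebra (X i)"
      by (auto simp: generated_algebra_def evaluate_power x intro: span_base)
    with step show ?case
      by (simp add: generated_algebra_def evaluate_add evaluate_scale span_add span_scale)
  qed
  have "F.free_family ?x {..<n}"
    unfolding F.free_family_def
  proof (intro allI impI, elim conjE)
    fix js ps
    assume js: "js \<noteq> []" "set js \<subseteq> {..<n}" "distinct_adj js"
      and ps: "list_all2 (\<lambda>i a. a \<in> F.generated_algebra (?x i) \<and> \<phi> (evaluate X a) = 0) js ps"
    have "list_all2 (\<lambda>i a. a \<in> generated_algebra (X i) \<and> \<phi> a = 0) js (map (evaluate X) ps)"
      using ps by (auto simp: list_all2_conv_all_nth gen)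
    with free js show "\<phi> (evaluate X (prod_list ps)) = 0"
      unfolding free_family_def evaluate_prod_list by blast
  qed
  moreover have "has_distribution ?\<phi> (?x i) \<mu>" if "i < n" for i
    using X[OF that] by (simp add: has_distribution_def evaluate_power x)
  moreover have "has_distribution ?\<phi> (\<Sum>i<n. ?x i) \<nu>"
    using sum by (simp add: has_distribution_def evaluate_power evaluate_sum x)
  ultimately show ?thesis
    unfolding is_free_convolution_power_def using F.nc_prob_space_axioms by blast
qed

end

definition wigner_density :: "real \<Rightarrow> real" where
  "wigner_density x = 1 / (2 * pi) * sqrt (max 0 (4 - x\<^sup>2))"

definition a_coeff :: "real measure \<Rightarrow> nat \<Rightarrow> real" where
  "a_coeff \<mu> n = moment \<mu> 3 / sqrt n"

definition b_coeff :: "real measure \<Rightarrow> nat \<Rightarrow> real" where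
  "b_coeff \<mu> n = (moment \<mu> 4 - (moment \<mu> 3)\<^sup>2 - 1) / n"

definition d_coeff :: "real measure \<Rightarrow> nat \<Rightarrow> real" where
  "d_coeff \<mu> n = (moment \<mu> 4 - (moment \<mu> 3)\<^sup>2) / n"

definition e_coeff :: "real measure \<Rightarrow> nat \<Rightarrow> real" where
  "e_coeff \<mu> n = (1 - b_coeff \<mu> n) / sqrt (1 - d_coeff \<mu> n)"

end

theory Submission
  imports Defs "HOL-Complex_Analysis.Complex_Analysis"
begin

text \<open>
  Let \<open>R(g) = g + m\<^sub>3 g\<^sup>2 + (m\<^sub>4 - 2) g\<^sup>3 + \<dots>\<close> be the R-transform of \<open>\<mu>\<close> and \<open>t = 1 / sqrt n\<close>. Freeness and Lagrange
  inversion express the \<open>k\<close>-th moment of \<open>Y\<^sub>n\<close> as \<open>1 / (k + 1)\<close> times the residue at \<open>0\<close> of \<open>K\<^bsup>k + 1\<^esup>\<close>, where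
  \<open>K(g) = 1 / g + R(t g) / t\<close> is a small perturbation of the Joukowski map. Near the unit circle there is a closed
  curve \<open>g = r(cos \<theta>) exp(i \<theta>)\<close> on which \<open>K\<close> takes real values \<open>X(cos \<theta>)\<close>; here \<open>r\<close> is the solution, analytic in
  \<open>c = cos \<theta>\<close>, of the equation \<open>r\<^sup>2 (1 + O(t)) = 1\<close> obtained by expanding \<open>Im (K(r exp(i \<theta>))) = 0\<close> in Chebyshev
  polynomials of the second kind. Deforming the residue integral to this curve shows that the density of \<open>Y\<^sub>n\<close> at
  \<open>X(c)\<close> is \<open>r(c) sqrt (1 - c\<^sup>2) / pi\<close>. Expanding \<open>r\<close> and \<open>X\<close> up to \<open>O(t\<^sup>3)\<close>, uniformly in \<open>c\<close>, gives the theorem.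
\<close>

text \<open>The density has square-root edges, which no uniform expansion in \<open>x\<close> can
  cross. In the variable \<open>c\<close> the radius and the abscissa are analytic on a disc larger
  than \<open>[-1, 1]\<close>, the edges sit at \<open>c = 1\<close> and \<open>c = -1\<close>, and
  the only singular factor \<open>sqrt (1 - c^2)\<close> is explicit. The shift \<open>a_n\<close>
  and the scale \<open>e_n\<close> are such that \<open>y = e_n (X - a_n) / 2\<close> equals
  \<open>1\<close> and \<open>-1\<close> at the two ends up to \<open>O(t^3)\<close>. Therefore
  \<open>1 - y^2 = (1 - c^2) T + O(t^3)\<close> with a polynomial \<open>T\<close>, and the factor
  in front of the semicircle density is \<open>r / sqrt T\<close> up to \<open>O(t^3)\<close>. The
  square root is not Lipschitz at \<open>0\<close>, so trading \<open>(1 - c^2) T\<close> for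
  \<open>1 - y^2\<close> costs a division by \<open>sqrt (1 - y^2)\<close>: this is the denominator
  of the error term. The displacement of the ends by \<open>O(t^3)\<close> is the origin of
  \<open>h\<close>. The functional \<open>\<phi>\<close> carries no positivity, so nothing is
  inverted analytically: the candidate density is nonnegative by its formula, and the law is
  identified with it through its moments, the case \<open>k = 0\<close> providing total mass
  one.\<close>

unbundle no vec_syntax
unbundle fps_syntax

section \<open>Moments of sums of free elements\<close>

context nc_prob_space
begin

lemma functional_add: "\<phi> (x + y) = \<phi> x + \<phi> y"
  and functional_scale: "\<phi> (scale c x) = c * \<phi> x"
  and functional_zero: "\<phi> 0 = 0"
  and functional_sum: "\<phi> (sum f A) = (\<Sum>x\<in>A. \<phi> (f x))"
  using module_hom.add[OF Vector_Spaces.linear.axioms(3)[OF linear_functional]]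
    module_hom.scale[OF Vector_Spaces.linear.axioms(3)[OF linear_functional]]
    module_hom.zero[OF Vector_Spaces.linear.axioms(3)[OF linear_functional]]
    module_hom.sum[OF Vector_Spaces.linear.axioms(3)[OF linear_functional]]
  by simp_all

definition scalar_fps :: "complex fps \<Rightarrow> 'a fps" where
  "scalar_fps f = Abs_fps (\<lambda>k. scale (f $ k) 1)"

definition functional_fps :: "'a fps \<Rightarrow> complex fps" where
  "functional_fps V = Abs_fps (\<lambda>k. \<phi> (V $ k))"

lemma scalar_fps_mult_nth: "(scalar_fps f * V) $ k = (\<Sum>i=0..k. scale (f $ i) (V $ (k - i)))"
  by (simp add: scalar_fps_def fps_mult_nth scale_mult_left)

lemma scalar_fps_commute: "V * scalar_fps f = scalar_fps f * V"
proof (rule fps_ext)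
  fix k
  have "(V * scalar_fps f) $ k = (\<Sum>i=0..k. scale (f $ (k - i)) (V $ i))"
    by (simp add: scalar_fps_def fps_mult_nth scale_mult_right)
  also have "\<dots> = (\<Sum>i=0..k. scale (f $ i) (V $ (k - i)))"
    by (rule sum.reindex_bij_witness[of _ "\<lambda>i. k - i" "\<lambda>i. k - i"]) auto
  finally show "(V * scalar_fps f) $ k = (scalar_fps f * V) $ k"
    by (simp add: scalar_fps_mult_nth)
qed

lemma scalar_fps_add: "scalar_fps (f + g) = scalar_fps f + scalar_fps g"
  by (simp add: scalar_fps_def fps_eq_iff scale_left_distrib)

lemma scalar_fps_diff: "scalar_fps (f - g) = scalar_fps f - scalar_fps g"
  by (simp add: scalar_fps_def fps_eq_iff scale_left_diff_distrib)

lemma scalar_fps_mult: "scalar_fps (f * g) = scalar_fps f * scalar_fps g"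
  by (rule fps_ext)
    (simp add: scalar_fps_mult_nth, simp add: scalar_fps_def fps_mult_nth scale_sum_left)

lemma scalar_fps_1: "scalar_fps 1 = 1"
  by (simp add: scalar_fps_def fps_eq_iff)

lemma scalar_fps_of_nat: "scalar_fps (of_nat n) = of_nat n"
  by (induction n) (simp_all add: scalar_fps_add scalar_fps_1, simp add: scalar_fps_def fps_eq_iff)

lemma scalar_fps_X: "scalar_fps fps_X = fps_X"
  by (simp add: scalar_fps_def fps_eq_iff)

lemma functional_fps_add: "functional_fps (V + W) = functional_fps V + functional_fps W"
  by (simp add: functional_fps_def fps_eq_iff functional_add)

lemma functional_fps_scalar_mult: "functional_fps (scalar_fps f * V) = f * functional_fps V"
proof (rule fps_ext)
  fix k
  have "\<phi> ((scalar_fps f * V) $ k) = (\<Sum>i=0..k. f $ i * \<phi> (V $ (k - i)))"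
    by (simp add: scalar_fps_mult_nth functional_sum functional_scale)
  then show "functional_fps (scalar_fps f * V) $ k = (f * functional_fps V) $ k"
    by (simp add: functional_fps_def fps_mult_nth)
qed

lemma functional_fps_const: "functional_fps (fps_const x) = fps_const (\<phi> x)"
  by (simp add: functional_fps_def fps_eq_iff functional_zero)

text \<open>The first letter \<open>i\<close> is recorded because a centred factor can be prepended
  to an alternating word only if it comes from a different algebra than that letter.\<close>

definition centred_words :: "(nat \<Rightarrow> 'a) \<Rightarrow> nat set \<Rightarrow> nat \<Rightarrow> 'a set" where
  "centred_words X I i = span {prod_list as | is as. is \<noteq> [] \<and> hd is = i \<and> set is \<subseteq> I \<and>
     distinct_adj is \<and> list_all2 (\<lambda>i a. a \<in> generated_algebra (X i) \<and> \<phi> a = 0) is as}"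

lemma functional_centred_words:
  assumes "free_family X I" "x \<in> centred_words X I i"
  shows "\<phi> x = 0"
  using assms(2) unfolding centred_words_def
proof (induction rule: span_induct_alt)
  case base
  show ?case by (rule functional_zero)
next
  case (step c x y)
  then show ?case
    using assms(1) by (auto simp: functional_add functional_scale free_family_def)
qed

lemma centred_words_single:
  assumes "i \<in> I" "x \<in> generated_algebra (X i)" "\<phi> x = 0"
  shows "x \<in> centred_words X I i"
  unfolding centred_words_def
  by (rule span_base, rule CollectI, rule exI[of _ "[i]"], rule exI[of _ "[x]"]) (use assms in auto)

lemma centred_words_mult:
  assumes "i \<in> I" "x \<in> generated_algebra (X i)" "\<phi> x = 0" "j \<noteq> i" "y \<in> centred_words X I j"
  shows "x * y \<in> centred_words X I i"
  using assms(5) unfolding centred_words_def[of X I j]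
proof (induction rule: span_induct_alt)
  case base
  show ?case by (simp add: centred_words_def span_zero)
next
  case (step c z y)
  then obtain "is" as where *: "z = prod_list as" "is \<noteq> []" "hd is = j" "set is \<subseteq> I" "distinct_adj is"
    "list_all2 (\<lambda>i a. a \<in> generated_algebra (X i) \<and> \<phi> a = 0) is as"
    by blast
  have "x * z \<in> centred_words X I i"
    unfolding centred_words_def
    by (rule span_base, rule CollectI, rule exI[of _ "i # is"], rule exI[of _ "x # as"])
      (use assms * in \<open>auto simp: distinct_adj_Cons neq_Nil_conv\<close>)
  with step show ?case
    by (auto simp: distrib_left scale_mult_right centred_words_def intro: span_add span_scale)
qed

lemma generated_algebra_sum:
  "(\<And>i. i \<in> A \<Longrightarrow> f i \<in> generated_algebra x) \<Longrightarrow> sum f A \<in> generated_algebra x"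
  unfolding generated_algebra_def by (rule span_sum)

lemma generated_algebra_scale_power: "scale c (x ^ k) \<in> generated_algebra x"
  unfolding generated_algebra_def by (intro span_scale span_base) auto

text \<open>
  With \<open>a\<^sub>i = (1 - X\<^sub>i t)\<^sup>-\<^sup>1 / m(t) - 1\<close>, which is centred, and \<open>c\<^sub>i = a\<^sub>i (1 + a\<^sub>i)\<^sup>-\<^sup>1\<close>, the series
  \<open>(1 - \<Sum>c\<^sub>i)\<^sup>-\<^sup>1\<close> is \<open>1\<close> plus the sum of all alternating words in the \<open>a\<^sub>i\<close>; freeness kills the words.
\<close>

lemma free_sum_resolvent:
  fixes X :: "nat \<Rightarrow> 'a" and n :: nat and m :: "complex fps"
  assumes free: "free_family X {..<n}"
    and mom: "\<And>i k. i < n \<Longrightarrow> \<phi> (X i ^ k) = m $ k"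
    and m0: "m $ 0 = 1"
  defines "q \<equiv> of_nat n - (of_nat n - 1) * inverse m"
  shows "\<exists>V. (scalar_fps q - fps_X * fps_const (\<Sum>i<n. X i)) * V = 1 \<and> functional_fps V = m"
proof -
  define M where "M = scalar_fps m"
  define N where "N = scalar_fps (inverse m)"
  have MN: "M * N = 1" "N * M = 1"
    using m0 by (simp_all add: M_def N_def inverse_mult_eq_1 inverse_mult_eq_1' scalar_fps_1 flip: scalar_fps_mult)
  define T where "T i = 1 - fps_X * fps_const (X i)" for i
  define R where "R i = Abs_fps (\<lambda>k. X i ^ k)" for i
  have TR: "T i * R i = 1" for i
  proof (rule fps_ext)
    fix k show "(T i * R i) $ k = 1 $ k"
      by (cases k) (simp_all add: T_def R_def algebra_simps mult.assoc)
  qed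
  have RT: "R i * T i = 1" for i
  proof (rule fps_ext)
    fix k show "(R i * T i) $ k = 1 $ k"
      by (cases k) (simp_all add: T_def R_def algebra_simps fps_mult_fps_X_commute power_commutes
          flip: mult.assoc)
  qed
  define a where "a i = N * R i - 1" for i
  define c where "c i = 1 - M * T i" for i
  \<comment> \<open>\<open>1 + a i = N * R i\<close> and \<open>1 - c i = M * T i\<close> are
    inverse to each other, since scalar series are central and \<open>R i\<close> inverts
    \<open>T i\<close>.\<close>
  have ac: "a i * (1 - c i) = c i" for i
  proof -
    have "N * R i * (M * T i) = N * (R i * M) * T i" by (simp add: mult.assoc)
    also have "R i * M = M * R i"
      by (simp add: M_def scalar_fps_commute)
    also have "N * (M * R i) * T i = (N * M) * (R i * T i)"
      by (simp add: mult.assoc)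
    finally have "N * R i * (M * T i) = 1"
      by (simp add: MN RT)
    then show ?thesis
      by (simp add: a_def c_def left_diff_distrib)
  qed
  have a_nth: "a i $ k \<in> generated_algebra (X i)" "\<phi> (a i $ k) = 0" if "i < n" for i k
  proof -
    have *: "(N * R i) $ k = (\<Sum>j=0..k. scale (inverse m $ j) (X i ^ (k - j)))"
      by (simp add: N_def scalar_fps_mult_nth R_def)
    have one: "(1 :: 'a) \<in> generated_algebra (X i)"
      using generated_algebra_scale_power[of 1 "X i" 0] by simp
    have "(N * R i) $ k \<in> generated_algebra (X i)"
      unfolding * by (intro generated_algebra_sum generated_algebra_scale_power)
    then show "a i $ k \<in> generated_algebra (X i)"
      using one by (auto simp: a_def generated_algebra_def span_zero intro!: span_diff)
    have "\<phi> ((N * R i) $ k) = (inverse m * m) $ k"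
      unfolding * using mom[OF that] by (simp add: functional_sum functional_scale fps_mult_nth)
    then have "\<phi> ((N * R i) $ k) = 1 $ k"
      using m0 by (simp add: inverse_mult_eq_1)
    moreover have "\<phi> ((N * R i) $ k) = \<phi> (a i $ k) + \<phi> (1 $ k)"
      by (simp add: a_def flip: functional_add)
    ultimately show "\<phi> (a i $ k) = 0"
      by (auto simp: unital functional_zero split: if_splits)
  qed
  define C where "C = 1 - (\<Sum>i<n. c i)"
  have c0: "c i $ 0 = 0" for i
    by (simp add: c_def M_def scalar_fps_def T_def m0)
  have C0: "C $ 0 = 1"
    by (simp add: C_def fps_sum_nth c0)
  define S where "S = fps_right_inverse C 1"
  have CS: "C * S = 1"
    unfolding S_def by (rule fps_right_inverse) (simp add: C0)
  define s where "s i = c i * S" for i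
  have S_eq: "S = 1 + (\<Sum>i<n. s i)"
    using CS by (simp add: C_def s_def left_diff_distrib sum_distrib_right algebra_simps)
  \<comment> \<open>Sorts the words in \<open>S\<close> by their first letter: after
    \<open>a i\<close> only a word starting with another index may follow.\<close>
  have s_eq: "s i = a i + (\<Sum>j\<in>{..<n}-{i}. a i * s j)" if "i < n" for i
  proof -
    have "s i = a i * (1 - c i) * S"
      by (simp add: ac s_def)
    also have "\<dots> = a i * (S - s i)"
      by (simp add: s_def mult.assoc algebra_simps)
    also have "S - s i = 1 + (\<Sum>j\<in>{..<n}-{i}. s j)"
      using that by (subst S_eq) (simp add: sum.remove[of "{..<n}" i s])
    finally show ?thesis
      by (simp add: distrib_left sum_distrib_left)
  qed
  have a0: "a i $ 0 = 0" if "i < n" for i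
    using m0 by (simp add: a_def N_def scalar_fps_def R_def)
  \<comment> \<open>The induction is on the degree: \<open>a i\<close> has no constant term, so
    coefficient \<open>k\<close> of \<open>a i * s j\<close> involves only coefficients of
    \<open>s j\<close> below \<open>k\<close>.\<close>
  have s_words: "i < n \<Longrightarrow> s i $ k \<in> centred_words X {..<n} i" for i k
  proof (induction k arbitrary: i rule: less_induct)
    case (less k)
    have "(a i * s j) $ k \<in> centred_words X {..<n} i" if j: "j \<in> {..<n} - {i}" for j
      unfolding fps_mult_nth centred_words_def
    proof (rule span_sum, fold centred_words_def)
      fix l assume l: "l \<in> {0..k}"
      show "a i $ l * s j $ (k - l) \<in> centred_words X {..<n} i"
      proof (cases "l = 0")
        case True
        with a0 less.prems show ?thesis by (simp add: centred_words_def span_zero)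
      next
        case False
        with l j less a_nth show ?thesis
          by (intro centred_words_mult[of i _ _ _ j] less.IH) auto
      qed
    qed
    moreover have "a i $ k \<in> centred_words X {..<n} i"
      using less.prems a_nth by (intro centred_words_single) auto
    moreover have "s i $ k = a i $ k + (\<Sum>j\<in>{..<n}-{i}. (a i * s j) $ k)"
      by (subst s_eq[OF less.prems]) (simp add: fps_sum_nth)
    ultimately show ?case
      by (auto simp: centred_words_def intro!: span_add span_sum)
  qed
  have fS: "functional_fps S = 1"
  proof (rule fps_ext)
    fix k
    have "S $ k = 1 $ k + (\<Sum>i<n. s i $ k)"
      by (subst S_eq) (simp add: fps_sum_nth)
    moreover have "\<phi> (s i $ k) = 0" if "i < n" for i
      using functional_centred_words[OF free s_words[OF that]] .
    ultimately show "functional_fps S $ k = 1 $ k"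
      by (simp add: functional_fps_def functional_add functional_sum unital functional_zero)
  qed
  \<comment> \<open>Each summand \<open>N * M * T i\<close> collapses to
    \<open>T i = 1 - z X i\<close>, so the elements enter only through their sum and a resolvent of
    the sum appears.\<close>
  have NC: "N * C = scalar_fps q - fps_X * fps_const (\<Sum>i<n. X i)"
  proof -
    have "C = 1 - of_nat n + M * (\<Sum>i<n. T i)"
      by (simp add: C_def c_def sum_subtractf sum_distrib_left)
    then have "N * C = (1 - of_nat n) * N + (\<Sum>i<n. T i)"
      by (simp add: distrib_left MN right_diff_distrib left_diff_distrib mult_of_nat_commute flip: mult.assoc)
    also have sum_T: "(\<Sum>i<n. T i) = of_nat n - fps_X * fps_const (\<Sum>i<n. X i)"
    proof -
      have "(\<Sum>i<k. fps_const (X i)) = fps_const (\<Sum>i<k. X i)" for k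
        by (induction k) simp_all
      then show ?thesis
        by (simp add: T_def sum_subtractf flip: sum_distrib_left)
    qed
    finally have NC: "N * C = (1 - of_nat n) * N + (of_nat n - fps_X * fps_const (\<Sum>i<n. X i))" .
    have "scalar_fps q = of_nat n + (1 - of_nat n) * N"
      unfolding q_def N_def scalar_fps_diff scalar_fps_mult scalar_fps_of_nat scalar_fps_1
      by (simp add: left_diff_distrib)
    then show ?thesis
      unfolding NC by simp
  qed
  show ?thesis
  proof (intro exI conjI)
    have "N * C * (S * M) = N * (C * S) * M" by (simp add: mult.assoc)
    then show "(scalar_fps q - fps_X * fps_const (\<Sum>i<n. X i)) * (S * M) = 1"
      by (simp add: NC[symmetric] CS MN)
    show "functional_fps (S * M) = m"
      by (simp add: M_def scalar_fps_commute functional_fps_scalar_mult fS)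
  qed
qed

text \<open>\<open>V\<close> is a right inverse of \<open>q - z S\<close>, so \<open>q V\<close> is
  the geometric series of \<open>S\<close> in \<open>Y = z / q\<close>, and \<open>\<phi>\<close>
  turns it into the moment series of \<open>S\<close> evaluated at \<open>Y\<close>. Convergence is
  formal: \<open>Y\<close> has no constant term, hence a remainder divisible by
  \<open>Y ^ Suc j\<close> does not reach coefficient \<open>j\<close>.\<close>

lemma free_sum_moments:
  fixes X :: "nat \<Rightarrow> 'a" and n :: nat and m :: "complex fps"
  assumes free: "free_family X {..<n}"
    and mom: "\<And>i k. i < n \<Longrightarrow> \<phi> (X i ^ k) = m $ k"
    and m0: "m $ 0 = 1"
  defines "q \<equiv> of_nat n - (of_nat n - 1) * inverse m"
  shows "Abs_fps (\<lambda>k. \<phi> ((\<Sum>i<n. X i) ^ k)) oo (fps_X * inverse q) = q * m"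
proof -
  define S where "S = (\<Sum>i<n. X i)"
  obtain V where V: "(scalar_fps q - fps_X * fps_const S) * V = 1" "functional_fps V = m"
    using free_sum_resolvent[OF free mom m0] unfolding q_def S_def by blast
  have q0: "q $ 0 = 1"
    using m0 by (simp add: q_def fps_mult_nth)
  define Y where "Y = fps_X * inverse q"
  define U where "U k = functional_fps (fps_const (S ^ k) * V)" for k
  have q_inv: "inverse q * q = 1"
    using q0 by (simp add: inverse_mult_eq_1)
  have U_rec: "U k = inverse q * fps_const (\<phi> (S ^ k)) + Y * U (Suc k)" for k
  proof -
    have V_eq: "scalar_fps q * V = 1 + fps_X * fps_const S * V"
      using V(1) by (simp add: algebra_simps)
    have "q * U k = functional_fps (fps_const (S ^ k) * (scalar_fps q * V))"
      by (simp add: U_def flip: functional_fps_scalar_mult scalar_fps_commute mult.assoc)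
        (metis mult.assoc scalar_fps_commute)
    also have "fps_const (S ^ k) * (scalar_fps q * V) =
        fps_const (S ^ k) + scalar_fps fps_X * (fps_const (S ^ Suc k) * V)"
      unfolding V_eq distrib_left scalar_fps_X
      by (simp add: power_commutes fps_mult_fps_X_commute flip: mult.assoc fps_const_mult)
        (metis fps_mult_fps_X_commute mult.assoc fps_const_mult power_commutes)
    also have "functional_fps \<dots> = fps_const (\<phi> (S ^ k)) + fps_X * U (Suc k)"
      by (simp add: functional_fps_add functional_fps_scalar_mult functional_fps_const U_def)
    finally have "inverse q * (q * U k) = inverse q * (fps_const (\<phi> (S ^ k)) + fps_X * U (Suc k))"
      by simp
    also have "inverse q * (q * U k) = U k"
      unfolding mult.assoc[symmetric] q_inv by (rule mult_1_left)
    finally show ?thesis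
      unfolding Y_def distrib_left by (simp only: mult.assoc mult.left_commute mult.commute)
  qed
  have U_iter: "q * U 0 = (\<Sum>k<N. fps_const (\<phi> (S ^ k)) * Y ^ k) + Y ^ N * (q * U N)" for N
  proof (induction N)
    case (Suc N)
    have "q * U N = (inverse q * q) * fps_const (\<phi> (S ^ N)) + Y * (q * U (Suc N))"
      unfolding U_rec[of N] distrib_left by (simp only: mult.assoc mult.left_commute mult.commute)
    then have "q * U N = fps_const (\<phi> (S ^ N)) + Y * (q * U (Suc N))"
      unfolding q_inv by simp
    then show ?case
      using Suc by (simp add: algebra_simps)
  qed simp
  have Y0: "Y $ 0 = 0"
    by (simp add: Y_def)
  show ?thesis
    unfolding S_def[symmetric] Y_def[symmetric]
  proof (rule fps_ext)
    fix j
    have "(q * m) $ j = (\<Sum>k<Suc j. (fps_const (\<phi> (S ^ k)) * Y ^ k) $ j) + (Y ^ Suc j * (q * U (Suc j))) $ j"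
      using U_iter[of "Suc j"] V(2) unfolding U_def
      by (simp add: fps_sum_nth del: sum.lessThan_Suc power_Suc)
    also have "(Y ^ Suc j * (q * U (Suc j))) $ j = 0"
      unfolding fps_mult_nth[of "Y ^ Suc j"] using startsby_zero_power_prefix[OF Y0, of "Suc j"]
      by (intro sum.neutral) (auto simp del: power_Suc)
    also have "(\<Sum>k<Suc j. (fps_const (\<phi> (S ^ k)) * Y ^ k) $ j) = (Abs_fps (\<lambda>k. \<phi> (S ^ k)) oo Y) $ j"
      by (simp add: fps_compose_nth lessThan_Suc_atMost atLeast0AtMost del: sum.lessThan_Suc)
    finally show "(Abs_fps (\<lambda>k. \<phi> (S ^ k)) oo Y) $ j = (q * m) $ j"
      by simp
  qed
qed

end

section \<open>The R-transform as a formal power series\<close>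

text \<open>With \<open>w = 1 / z\<close> and \<open>G(w) = z m(z)\<close>, the defining relation
  \<open>R(G(w)) = w - 1 / G(w)\<close> reads \<open>R(z m(z)) = (m(z) - 1) / (z m(z))\<close> when
  \<open>m\<close> has constant term \<open>1\<close>.\<close>

definition r_transform :: "'a::field fps \<Rightarrow> 'a fps" where
  "r_transform m = (fps_shift 1 m * inverse m) oo fps_inv (fps_X * m)"

lemma r_transform_compose:
  fixes m :: "'a::field fps"
  assumes "m $ 0 = 1"
  shows "r_transform m oo (fps_X * m) = fps_shift 1 m * inverse m"
proof -
  have g: "(fps_X * m) $ 0 = 0" "(fps_X * m) $ 1 \<noteq> 0"
    using assms by (simp_all add: fps_mult_nth)
  have "fps_inv (fps_X * m) $ 0 = 0"
    by (simp add: fps_inv_def)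
  then have "r_transform m oo (fps_X * m) =
      (fps_shift 1 m * inverse m) oo (fps_inv (fps_X * m) oo (fps_X * m))"
    unfolding r_transform_def using g(1) by (intro fps_compose_assoc[symmetric])
  then show ?thesis
    using fps_inv[OF g] by simp
qed

text \<open>Additivity of the R-transform in a form free of poles: \<open>z M(z)\<close> inverts
  \<open>1 / K(g) = g / (1 + n g R(g))\<close>, where \<open>K(g) = 1 / g + n R(g)\<close>. The
  substitution \<open>g = z m(z)\<close> is invertible, so the identity may be checked after it;
  there \<open>1 + n g R(g)\<close> becomes \<open>q m\<close>.\<close>

lemma r_transform_inverse:
  fixes m M :: "'a::field fps" and n :: nat
  assumes m0: "m $ 0 = 1"
  defines "q \<equiv> of_nat n - (of_nat n - 1) * inverse m"
  assumes M: "M oo (fps_X * inverse q) = q * m"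
  shows "(fps_X * M) oo (fps_X * inverse (1 + of_nat n * fps_X * r_transform m)) = fps_X"
proof -
  let ?g = "fps_X * m" and ?\<rho> = "r_transform m"
  let ?H = "1 + of_nat n * fps_X * ?\<rho>"
  have g0: "?g $ 0 = 0" and g1: "?g $ 1 \<noteq> 0"
    using m0 by (simp_all add: fps_mult_nth)
  have q0: "q $ 0 = 1"
    using m0 by (simp add: q_def fps_mult_nth)
  have m_inv: "inverse m * m = 1" and q_inv: "inverse q * q = 1"
    using m0 q0 by (simp_all add: inverse_mult_eq_1)
  have of_nat_comp: "(of_nat n :: 'a fps) oo ?g = of_nat n"
    by (simp flip: fps_of_nat)
  have shift: "fps_X * fps_shift 1 m = m - 1"
    by (rule fps_ext) (simp add: m0)
  have one_comp: "(1 :: 'a fps) oo ?g = 1"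
    using fps_const_compose[of 1 ?g] by simp
  have "?H oo ?g = 1 + of_nat n * (fps_X * m) * (fps_shift 1 m * inverse m)"
    using g0 m0 by (simp add: fps_compose_add_distrib fps_compose_mult_distrib of_nat_comp
        r_transform_compose one_comp)
  also have "\<dots> = 1 + of_nat n * (fps_X * fps_shift 1 m) * (inverse m * m)"
    by (simp only: mult_ac)
  also have "\<dots> = of_nat n * m - (of_nat n - 1)"
    unfolding m_inv shift by (simp add: algebra_simps)
  also have "\<dots> = of_nat n * m - (of_nat n - 1) * (inverse m * m)"
    by (simp add: m_inv)
  also have "\<dots> = q * m"
    by (simp add: q_def algebra_simps)
  finally have H: "?H oo ?g = q * m" .
  have "(fps_X * inverse ?H) oo ?g = ?g * inverse (?H oo ?g)"
    using g0 by (simp add: fps_compose_mult_distrib fps_inverse_compose)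
  also have "\<dots> = fps_X * inverse q * (inverse m * m)"
    unfolding H fps_inverse_mult by (simp only: mult_ac)
  finally have W: "(fps_X * inverse ?H) oo ?g = fps_X * inverse q"
    by (simp add: m_inv)
  let ?F = "(fps_X * M) oo (fps_X * inverse ?H)"
  have "?F oo ?g = (fps_X * M) oo (fps_X * inverse q)"
    unfolding W[symmetric] using g0 by (intro fps_compose_assoc[symmetric]) simp_all
  also have "\<dots> = fps_X * inverse q * (q * m)"
    by (simp add: fps_compose_mult_distrib M)
  also have "\<dots> = fps_X * m * (inverse q * q)"
    by (simp only: mult_ac)
  finally have F: "?F oo ?g = ?g"
    by (simp add: q_inv)
  have inv0: "fps_inv ?g $ 0 = 0"
    by (simp add: fps_inv_def)
  have inv: "?g oo fps_inv ?g = fps_X"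
    using fps_inv_right[OF g0 g1] .
  have "?F = ?F oo (?g oo fps_inv ?g)"
    by (simp only: inv fps_compose_fps_X)
  also have "\<dots> = (?F oo ?g) oo fps_inv ?g"
    by (rule fps_compose_assoc[OF inv0 g0])
  also have "\<dots> = fps_X"
    by (simp only: F inv)
  finally show ?thesis .
qed

text \<open>A residue computation on coefficients. Since \<open>W = z / H\<close>, the number
  \<open>(H ^ Suc p * fps_deriv W) $ p\<close> is the residue of \<open>W' / W ^ Suc p\<close>,
  which is an exact derivative unless \<open>p = 0\<close>. Expanding \<open>F'\<close> composed
  with \<open>W\<close> in powers of \<open>W\<close> therefore isolates one coefficient of
  \<open>F'\<close>.\<close>

lemma lagrange_inversion:
  fixes F H :: "'a::field_char_0 fps"
  assumes H0: "H $ 0 = 1"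
    and F: "F oo (fps_X * inverse H) = fps_X"
  shows "of_nat (Suc k) * F $ Suc k = (H ^ Suc k) $ k"
proof -
  define W where "W = fps_X * inverse H"
  have W0: "W $ 0 = 0"
    by (simp add: W_def)
  have WH: "W * H = fps_X"
    using H0 by (simp add: W_def inverse_mult_eq_1 mult.assoc)
  define D where "D = fps_deriv F"
  have DW: "(D oo W) * fps_deriv W = 1"
    using fps_compose_deriv[OF W0, of F] F unfolding D_def W_def by simp
  have W'H: "fps_deriv W * H = 1 - W * fps_deriv H"
    using arg_cong[OF WH, of fps_deriv] by (simp add: algebra_simps)
  have res: "(H ^ Suc p * fps_deriv W) $ p = (if p = 0 then 1 else 0)" for p
  proof (cases p)
    case 0
    with W'H H0 W0 show ?thesis
      by (simp add: mult.commute)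
  next
    case (Suc p')
    have "H ^ Suc p * fps_deriv W = H ^ p * (1 - W * fps_deriv H)"
      by (simp add: W'H[symmetric] mult_ac)
    also have "\<dots> = H ^ p - (W * H) * (H ^ p' * fps_deriv H)"
      by (simp add: Suc algebra_simps)
    finally have "H ^ Suc p * fps_deriv W = H ^ p - fps_X * (H ^ p' * fps_deriv H)"
      by (simp only: WH)
    \<comment> \<open>After multiplication by \<open>p\<close> the right side is
      \<open>p H^p - z (H^p)'\<close>, whose coefficient at \<open>z^p\<close> cancels.\<close>
    then have "of_nat p * (H ^ Suc p * fps_deriv W) = of_nat p * H ^ p - fps_X * (of_nat p * fps_deriv H * H ^ p')"
      by (simp only: right_diff_distrib mult_ac)
    also have "of_nat p * fps_deriv H * H ^ p' = fps_deriv (H ^ p)"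
      by (simp add: fps_deriv_power' Suc del: power_Suc of_nat_Suc)
    finally have "(fps_const (of_nat p) * (H ^ Suc p * fps_deriv W)) $ p =
        (fps_const (of_nat p) * H ^ p) $ p - (fps_X * fps_deriv (H ^ p)) $ p"
      by (simp only: fps_of_nat fps_sub_nth)
    then have "of_nat p * (H ^ Suc p * fps_deriv W) $ p = 0"
      by (simp add: Suc del: fps_of_nat power_Suc of_nat_Suc)
    with Suc show ?thesis
      by (simp del: of_nat_Suc power_Suc)
  qed
  define T where "T = fps_shift (Suc k) D"
  \<comment> \<open>The terms beyond degree \<open>k\<close> are split off as a multiple of
    \<open>z ^ Suc k\<close>; composed with \<open>W\<close> and multiplied by
    \<open>H ^ Suc k\<close> they keep this factor and do not reach coefficient
    \<open>k\<close>.\<close>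
  have D_eq: "D = (\<Sum>j\<le>k. fps_const (D $ j) * fps_X ^ j) + fps_X ^ Suc k * T"
  proof (rule fps_ext)
    fix i
    show "D $ i = ((\<Sum>j\<le>k. fps_const (D $ j) * fps_X ^ j) + fps_X ^ Suc k * T) $ i"
      unfolding fps_add_nth fps_sum_nth fps_X_power_mult_nth fps_mult_left_const_nth fps_X_power_nth T_def
      by (cases "i \<le> k") (auto simp: if_distrib sum.delta cong: if_cong)
  qed
  have D_comp: "D oo W = (\<Sum>j\<le>k. fps_const (D $ j) * W ^ j) + W ^ Suc k * (T oo W)"
  proof -
    have "D oo W = ((\<Sum>j\<le>k. fps_const (D $ j) * fps_X ^ j) + fps_X ^ Suc k * T) oo W"
      by (subst D_eq) (rule refl)
    also have "\<dots> = (\<Sum>j\<le>k. fps_const (D $ j) * W ^ j) + W ^ Suc k * (T oo W)"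
      using W0 by (simp add: fps_compose_add_distrib fps_compose_sum_distrib fps_compose_mult_distrib
          flip: fps_compose_power del: power_Suc)
    finally show ?thesis .
  qed
  have "H ^ Suc k = H ^ Suc k * ((D oo W) * fps_deriv W)"
    by (simp only: DW mult_1_right)
  also have "\<dots> = (\<Sum>j\<le>k. fps_const (D $ j) * ((W ^ j * H ^ Suc k) * fps_deriv W)) +
      (W * H) ^ Suc k * ((T oo W) * fps_deriv W)"
    unfolding D_comp by (simp add: algebra_simps sum_distrib_left sum_distrib_right power_mult_distrib)
  also have "(\<Sum>j\<le>k. fps_const (D $ j) * ((W ^ j * H ^ Suc k) * fps_deriv W)) =
      (\<Sum>j\<le>k. fps_const (D $ j) * (fps_X ^ j * (H ^ Suc (k - j) * fps_deriv W)))"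
  proof (rule sum.cong)
    fix j assume "j \<in> {..k}"
    then have "H ^ Suc k = H ^ j * H ^ Suc (k - j)"
      by (simp add: Suc_diff_le flip: power_add power_Suc)
    then have "W ^ j * H ^ Suc k = (W * H) ^ j * H ^ Suc (k - j)"
      by (simp only: power_mult_distrib mult.assoc)
    then show "fps_const (D $ j) * ((W ^ j * H ^ Suc k) * fps_deriv W) =
      fps_const (D $ j) * (fps_X ^ j * (H ^ Suc (k - j) * fps_deriv W))"
      by (simp only: WH mult.assoc)
  qed simp
  finally have "(H ^ Suc k) $ k = (\<Sum>j\<le>k. D $ j * (H ^ Suc (k - j) * fps_deriv W) $ (k - j))"
    unfolding WH by (simp add: fps_sum_nth fps_X_power_mult_nth del: power_Suc)
  also have "\<dots> = (\<Sum>j\<le>k. if j = k then D $ j else 0)"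
    unfolding res by (intro sum.cong) auto
  also have "\<dots> = D $ k"
    by simp
  finally show ?thesis
    by (simp add: D_def)
qed

text \<open>These are the first four free cumulants of a centred law of unit variance, read off from
  \<open>R(z m(z)) m(z) = (m(z) - 1) / z\<close>.\<close>

lemma r_transform_nth:
  fixes m :: "'a::field fps"
  assumes "m $ 0 = 1" "m $ 1 = 0" "m $ 2 = 1"
  shows "r_transform m $ 0 = 0" "r_transform m $ 1 = 1" "r_transform m $ 2 = m $ 3"
    "r_transform m $ 3 = m $ 4 - 2"
proof -
  let ?g = "fps_X * m" and ?\<rho> = "r_transform m"
  have eq: "(?\<rho> oo ?g) * m = fps_shift 1 m"
    using assms(1) by (simp add: r_transform_compose inverse_mult_eq_1 mult.assoc)
  have m: "m $ Suc 0 = 0" "m $ Suc (Suc 0) = 1"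
    using assms by (simp_all add: eval_nat_numeral)
  have g: "?g $ 0 = 0" "?g $ Suc 0 = 1" "?g $ Suc (Suc 0) = 0" "?g $ Suc (Suc (Suc 0)) = 1"
    using assms m by simp_all
  have g2: "(?g ^ 2) $ 0 = 0" "(?g ^ 2) $ Suc 0 = 0" "(?g ^ 2) $ Suc (Suc 0) = 1" "(?g ^ 2) $ Suc (Suc (Suc 0)) = 0"
    unfolding power2_eq_square fps_mult_nth[of ?g ?g]
    by (simp_all add: g assms(1) del: fps_X_mult_nth)
  have g3: "(?g ^ 3) $ 0 = 0" "(?g ^ 3) $ Suc 0 = 0" "(?g ^ 3) $ Suc (Suc 0) = 0" "(?g ^ 3) $ Suc (Suc (Suc 0)) = 1"
    unfolding power3_eq_cube power2_eq_square[symmetric] fps_mult_nth[of "?g^2" ?g]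
    by (simp_all add: g g2 assms(1) del: fps_X_mult_nth)
  have c: "(?\<rho> oo ?g) $ 0 = ?\<rho> $ 0" "(?\<rho> oo ?g) $ Suc 0 = ?\<rho> $ 1" "(?\<rho> oo ?g) $ Suc (Suc 0) = ?\<rho> $ 2"
    "(?\<rho> oo ?g) $ Suc (Suc (Suc 0)) = ?\<rho> $ 3 + ?\<rho> $ 1"
    using g g2 g3 unfolding fps_compose_nth
    by (simp_all add: eval_nat_numeral)
  have e0: "?\<rho> $ 0 = 0"
    using arg_cong[OF eq, of "\<lambda>f. f $ 0"] assms m by (simp add: c)
  have e1: "?\<rho> $ 1 = 1"
    using arg_cong[OF eq, of "\<lambda>f. f $ Suc 0"] assms m e0 by (simp add: fps_mult_nth c)
  have e2: "?\<rho> $ 2 = m $ 3"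
    using arg_cong[OF eq, of "\<lambda>f. f $ Suc (Suc 0)"] assms m e0 e1
    by (simp add: fps_mult_nth c eval_nat_numeral)
  have e3: "?\<rho> $ 3 + 2 = m $ 4"
    using arg_cong[OF eq, of "\<lambda>f. f $ Suc (Suc (Suc 0))"] assms m e0 e1 e2
    by (simp add: fps_mult_nth c) (simp add: eval_nat_numeral add_ac)
  from e0 e1 e2 e3 show "r_transform m $ 0 = 0" "r_transform m $ 1 = 1" "r_transform m $ 2 = m $ 3"
    "r_transform m $ 3 = m $ 4 - 2"
    by (simp_all add: algebra_simps)
qed

section \<open>Passage from real to complex coefficients\<close>

definition fps_complex :: "real fps \<Rightarrow> complex fps" where
  "fps_complex f = Abs_fps (\<lambda>k. complex_of_real (f $ k))"

lemma fps_complex_nth [simp]: "fps_complex f $ k = complex_of_real (f $ k)"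
  by (simp add: fps_complex_def)

lemma fps_complex_eq_iff: "fps_complex f = fps_complex g \<longleftrightarrow> f = g"
  by (simp add: fps_eq_iff)

lemma fps_complex_diff: "fps_complex (f - g) = fps_complex f - fps_complex g"
  by (rule fps_ext) simp

lemma fps_complex_mult: "fps_complex (f * g) = fps_complex f * fps_complex g"
  by (rule fps_ext) (simp add: fps_mult_nth)

lemma fps_complex_one [simp]: "fps_complex 1 = 1"
  by (rule fps_ext) simp

lemma fps_complex_X [simp]: "fps_complex fps_X = fps_X"
  by (rule fps_ext) simp

lemma fps_complex_of_nat [simp]: "fps_complex (of_nat n) = of_nat n"
  by (rule fps_ext) (simp flip: fps_of_nat)

lemma fps_complex_power: "fps_complex (f ^ n) = fps_complex f ^ n"
  by (induction n) (simp_all add: fps_complex_mult)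

lemma fps_complex_inverse:
  assumes "f $ 0 \<noteq> 0"
  shows "fps_complex (inverse f) = inverse (fps_complex f)"
proof -
  have "fps_complex (inverse f) * fps_complex f = 1"
    using assms by (simp add: inverse_mult_eq_1 flip: fps_complex_mult)
  then show ?thesis
    using assms by (metis fps_inverse_unique mult.commute)
qed

lemma fps_complex_compose: "fps_complex (f oo g) = fps_complex f oo fps_complex g"
  by (rule fps_ext) (simp add: fps_compose_nth flip: fps_complex_power)

lemma fps_complex_shift: "fps_complex (fps_shift k f) = fps_shift k (fps_complex f)"
  by (rule fps_ext) simp

lemma fps_inv_unique:
  fixes a :: "'a::field fps"
  assumes "a $ 0 = 0" "a $ 1 \<noteq> 0" "b $ 0 = 0" "a oo b = fps_X"
  shows "b = fps_inv a"
proof -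
  have "fps_inv a oo (a oo b) = (fps_inv a oo a) oo b"
    using assms by (intro fps_compose_assoc)
  then show ?thesis
    using assms fps_inv[OF assms(1,2)] by simp
qed

lemma fps_complex_inv:
  assumes "f $ 0 = 0" "f $ 1 \<noteq> 0"
  shows "fps_complex (fps_inv f) = fps_inv (fps_complex f)"
proof (rule fps_inv_unique)
  show "fps_complex f oo fps_complex (fps_inv f) = fps_X"
    using fps_inv_right[OF assms] by (simp flip: fps_complex_compose)
qed (use assms in \<open>simp_all add: fps_inv_def\<close>)

lemma fps_complex_r_transform:
  assumes "m $ 0 = 1"
  shows "fps_complex (r_transform m) = r_transform (fps_complex m)"
  using assms unfolding r_transform_def
  by (simp add: fps_complex_compose fps_complex_mult fps_complex_inverse fps_complex_shift fps_complex_inv)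

section \<open>Convergence of the R-transform\<close>

lemma fps_conv_radius_pos_imp_geometric_bound:
  fixes f :: "'a::{banach,real_normed_div_algebra} fps"
  assumes "fps_conv_radius f > 0"
  shows "\<exists>A B. 0 < A \<and> 0 < B \<and> (\<forall>k. norm (f $ k) \<le> A * B ^ k)"
proof -
  obtain r where r: "0 < r" "ereal r < fps_conv_radius f"
    using ereal_dense2[OF assms] by auto
  then have "summable (\<lambda>k. f $ k * of_real r ^ k)"
    by (intro summable_fps) auto
  then have "Bseq (\<lambda>k. f $ k * of_real r ^ k)"
    by (intro convergent_imp_Bseq) (auto simp: convergent_def dest: summable_LIMSEQ_zero)
  then obtain A where A: "0 < A" "\<And>k. norm (f $ k * of_real r ^ k) \<le> A"
    by (auto elim: BseqE)
  have "norm (f $ k) \<le> A * (1 / r) ^ k" for k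
    using A(2)[of k] r(1) by (simp add: norm_mult norm_power field_simps)
  with A(1) r(1) show ?thesis
    by (intro exI[of _ A] exI[of _ "1 / r"]) auto
qed

lemma fps_conv_radius_pos_geometric:
  fixes f :: "'a::{banach,real_normed_div_algebra} fps"
  assumes "\<And>k. norm (f $ k) \<le> A * B ^ k" "B > 0"
  shows "fps_conv_radius f > 0"
proof -
  define r where "r = 1 / (2 * B)"
  have r: "r > 0" "B * r = 1 / 2"
    using assms(2) by (simp_all add: r_def)
  have "summable (\<lambda>k. f $ k * of_real r ^ k)"
  proof (rule summable_comparison_test')
    show "summable (\<lambda>k. A * (1 / 2) ^ k)"
      by (intro summable_mult summable_geometric) simp
    fix k
    have "norm (f $ k * of_real r ^ k) \<le> A * B ^ k * r ^ k"
      using assms(1) r(1) by (simp add: norm_mult norm_power mult_right_mono)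
    also have "\<dots> = A * (1 / 2) ^ k"
      by (simp add: r(2) mult.assoc flip: power_mult_distrib)
    finally show "norm (f $ k * of_real r ^ k) \<le> A * (1 / 2) ^ k" .
  qed
  then have "fps_conv_radius f \<ge> norm (of_real r :: 'a)"
    unfolding fps_conv_radius_def by (rule conv_radius_geI)
  moreover have "ereal (norm (of_real r :: 'a)) > 0"
    using r(1) by simp
  ultimately show ?thesis
    by (rule less_le_trans[rotated])
qed

text \<open>A nonzero derivative at \<open>0\<close> yields a holomorphic local inverse; its Taylor
  series inverts \<open>F\<close> under composition, and formal inverses are unique.\<close>

lemma has_fps_expansion_fps_inv:
  fixes f :: "complex \<Rightarrow> complex"
  assumes f: "f has_fps_expansion F" and F0: "F $ 0 = 0" and F1: "F $ 1 \<noteq> 0"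
  shows "\<exists>g. g has_fps_expansion fps_inv F"
proof -
  have f0: "f 0 = 0"
    using has_fps_expansion_imp_0_eq_fps_nth_0[OF f] F0 by simp
  obtain S where S: "open S" "0 \<in> S" "f holomorphic_on S"
    using has_fps_expansion_imp_analytic_0[OF f] by (auto simp: analytic_at)
  have "deriv f 0 \<noteq> 0"
    using fps_nth_fps_expansion[OF f, of 1] F1 by simp
  then obtain r where r: "r > 0" "ball 0 r \<subseteq> S" "open (f ` ball 0 r)" "inj_on f (ball 0 r)"
    using has_complex_derivative_locally_invertible[OF S(3,2,1)] by blast
  then obtain g where g: "g holomorphic_on f ` ball 0 r" "\<And>z. z \<in> ball 0 r \<Longrightarrow> g (f z) = z"
    using holomorphic_has_inverse[of f "ball 0 r"] S holomorphic_on_subset by (metis open_ball)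
  have "0 \<in> f ` ball 0 r"
    using f0 r(1) by (metis centre_in_ball imageI)
  then have "g analytic_on {0}"
    using g(1) r(3) by (auto simp: analytic_at)
  then have G: "g has_fps_expansion fps_expansion g 0"
    by (rule analytic_at_imp_has_fps_expansion_0)
  have g0: "g 0 = 0"
    using g(2)[of 0] f0 r(1) by simp
  then have G0: "fps_expansion g 0 $ 0 = 0"
    by (simp add: fps_expansion_def)
  have "(f \<circ> g) has_fps_expansion (F oo fps_expansion g 0)"
    by (rule has_fps_expansion_compose[OF f G G0])
  moreover have "\<forall>\<^sub>F z in nhds 0. (f \<circ> g) z = z"
    using eventually_nhds_in_open[OF r(3) \<open>0 \<in> f ` ball 0 r\<close>] by eventually_elim (use g(2) in auto)
  ultimately have "(\<lambda>z. z) has_fps_expansion (F oo fps_expansion g 0)"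
    by (subst (asm) has_fps_expansion_cong[OF _ refl])
  then have "F oo fps_expansion g 0 = fps_X"
    using has_fps_expansion_fps_X fps_expansion_unique_complex by blast
  with F0 F1 G0 have "fps_expansion g 0 = fps_inv F"
    by (intro fps_inv_unique)
  with G show ?thesis by auto
qed

text \<open>With geometrically bounded moments every series in the definition of
  \<open>r_transform\<close> converges near \<open>0\<close>, and so does the composite. A positive
  radius of convergence is then turned back into a geometric bound.\<close>

lemma r_transform_geometric_bound:
  fixes m :: "real fps"
  assumes m0: "m $ 0 = 1" and bound: "\<And>k. \<bar>m $ k\<bar> \<le> A * B ^ k" "B > 0"
  shows "\<exists>A B. 0 < A \<and> 0 < B \<and> (\<forall>k. \<bar>r_transform m $ k\<bar> \<le> A * B ^ k)"
proof -
  let ?m = "fps_complex m"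
  have m: "eval_fps ?m has_fps_expansion ?m"
    by (rule eval_fps_has_fps_expansion, rule fps_conv_radius_pos_geometric[of _ A B])
      (use bound in auto)
  have xm: "(\<lambda>x. x * eval_fps ?m x) has_fps_expansion fps_X * ?m"
    by (intro fps_expansion_intros m)
  obtain g where g: "g has_fps_expansion fps_inv (fps_X * ?m)"
    using has_fps_expansion_fps_inv[OF xm] m0 by (auto simp: fps_mult_nth)
  have "fps_conv_radius (fps_shift 1 ?m) > 0"
  proof (rule fps_conv_radius_pos_geometric[of _ "A * B" B])
    fix k show "norm (fps_shift 1 ?m $ k) \<le> A * B * B ^ k"
      using bound(1)[of "Suc k"] by (simp add: mult_ac)
  qed (rule bound(2))
  then have "(\<lambda>x. eval_fps (fps_shift 1 ?m) x * inverse (eval_fps ?m x)) has_fps_expansion fps_shift 1 ?m * inverse ?m"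
    using m0 by (intro fps_expansion_intros m eval_fps_has_fps_expansion) auto
  from has_fps_expansion_compose[OF this g]
  have "fps_conv_radius (r_transform ?m) > 0"
    by (auto simp: fps_inv_def r_transform_def has_fps_expansion_def)
  from fps_conv_radius_pos_imp_geometric_bound[OF this] show ?thesis
    using m0 by (simp flip: fps_complex_r_transform)
qed

section \<open>Series of Chebyshev polynomials\<close>

fun chebyshev_U :: "nat \<Rightarrow> 'a::comm_ring_1 \<Rightarrow> 'a" where
  "chebyshev_U 0 c = 1"
| "chebyshev_U (Suc 0) c = 2 * c"
| "chebyshev_U (Suc (Suc k)) c = 2 * c * chebyshev_U (Suc k) c - chebyshev_U k c"

lemma chebyshev_U_of_real:
  "chebyshev_U k (of_real c) = (of_real (chebyshev_U k c) :: 'a::{real_algebra_1,comm_ring_1})"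
  by (induction k rule: induct_nat_012) simp_all

lemma chebyshev_U_holomorphic: "chebyshev_U k holomorphic_on S"
proof (induction k rule: induct_nat_012)
  case (ge2 k)
  then show ?case by (simp cong: holomorphic_cong) (intro holomorphic_intros)
qed (simp_all cong: holomorphic_cong)

text \<open>The recurrence is dominated because \<open>3 x + 1 \<le> x^2\<close> at
  \<open>x = 4\<close>. A complex disc around \<open>[-1, 1]\<close> is covered, which later leaves
  room for Cauchy's inequality at the endpoints.\<close>

lemma norm_chebyshev_U_le:
  fixes c :: "'a::real_normed_field"
  assumes "norm c \<le> 3/2"
  shows "norm (chebyshev_U k c) \<le> 4 ^ k"
proof (induction k rule: induct_nat_012)
  case (ge2 k)
  have "norm (chebyshev_U (Suc (Suc k)) c) \<le> 2 * norm c * norm (chebyshev_U (Suc k) c) + norm (chebyshev_U k c)"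
    using norm_triangle_ineq4[of "2 * c * chebyshev_U (Suc k) c" "chebyshev_U k c"]
    by (simp add: norm_mult)
  also have "\<dots> \<le> 3 * 4 ^ Suc k + 4 ^ k"
    using assms ge2 by (intro add_mono mult_mono) auto
  also have "\<dots> \<le> 4 ^ Suc (Suc k)"
    by simp
  finally show ?case by simp
qed (use assms in \<open>simp_all add: norm_mult\<close>)

text \<open>Both sides obey the recurrence with multiplier \<open>2 * cos \<theta>\<close>. Every
  power is thereby real up to a real multiple of the one number \<open>cis (- \<theta>)\<close>, so
  a single real equation suffices to make a real power series plus a pole real on the curve.\<close>

lemma cis_power_chebyshev_U:
  "cis \<theta> ^ Suc k = of_real (chebyshev_U (Suc k) (cos \<theta>)) - cis (- \<theta>) * of_real (chebyshev_U k (cos \<theta>))"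
proof -
  define e e' where "e = cis \<theta>" and "e' = cis (- \<theta>)"
  have ee': "e * e' = 1"
    by (simp add: e_def e'_def cis_mult)
  have c: "of_real (2 * cos \<theta>) = e + e'"
    by (simp add: e_def e'_def complex_eq_iff)
  have "e ^ Suc k = of_real (chebyshev_U (Suc k) (cos \<theta>)) - e' * of_real (chebyshev_U k (cos \<theta>))"
  proof (induction k rule: induct_nat_012)
    case 0
    show ?case using c by simp
  next
    case 1
    have "of_real (chebyshev_U (Suc (Suc 0)) (cos \<theta>)) = (e + e') * (e + e') - 1"
      unfolding c[symmetric] by simp
    moreover have "of_real (chebyshev_U (Suc 0) (cos \<theta>)) = e + e'"
      unfolding c[symmetric] by simp
    ultimately show ?case
      using ee' by (simp add: algebra_simps)
  next
    case (ge2 k)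
    have rec: "of_real (chebyshev_U (Suc (Suc j)) (cos \<theta>)) =
        (e + e') * of_real (chebyshev_U (Suc j) (cos \<theta>)) - of_real (chebyshev_U j (cos \<theta>))" for j
      unfolding c[symmetric] by simp
    have "e ^ Suc (Suc (Suc k)) = (e + e') * e ^ Suc (Suc k) - (e * e') * e ^ Suc k"
      by (simp add: algebra_simps)
    then show ?case
      unfolding ge2 ee' rec by (simp add: algebra_simps)
  qed
  then show ?thesis
    by (simp only: e_def e'_def)
qed

definition chebyshev_series :: "(nat \<Rightarrow> real) \<Rightarrow> 'a \<Rightarrow> 'a \<Rightarrow> 'a::{real_normed_field,banach}" where
  "chebyshev_series \<beta> \<tau> c = suminf (\<lambda>k. of_real (\<beta> k) * \<tau> ^ k * chebyshev_U k c)"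

locale geometric_coeffs =
  fixes \<beta> :: "nat \<Rightarrow> real" and A B :: real
  assumes coeff_le: "\<bar>\<beta> k\<bar> \<le> A * B ^ k" and B_pos: "B > 0"
begin

lemma A_nonneg: "A \<ge> 0"
  using coeff_le[of 0] by simp

lemma norm_term_le:
  fixes \<tau> c :: "'a::{real_normed_field,banach}"
  assumes "norm c \<le> 3/2"
  shows "norm (of_real (\<beta> k) * \<tau> ^ k * chebyshev_U k c) \<le> A * (4 * B * norm \<tau>) ^ k"
proof -
  have "norm (of_real (\<beta> k) * \<tau> ^ k * chebyshev_U k c) \<le> (A * B ^ k) * norm \<tau> ^ k * 4 ^ k"
    unfolding norm_mult norm_power norm_of_real
    using coeff_le[of k] norm_chebyshev_U_le[OF assms, of k] A_nonneg B_pos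
    by (intro mult_mono) auto
  then show ?thesis
    by (simp add: power_mult_distrib mult_ac)
qed

lemma term_summable:
  fixes \<tau> c :: "'a::{real_normed_field,banach}"
  assumes "norm c \<le> 3/2" "16 * B * norm \<tau> \<le> 1"
  shows "summable (\<lambda>k. of_real (\<beta> k) * \<tau> ^ k * chebyshev_U k c)"
proof (rule summable_comparison_test')
  show "summable (\<lambda>k. A * (4 * B * norm \<tau>) ^ k)"
    using assms(2) B_pos by (intro summable_mult summable_geometric) simp
qed (rule norm_term_le[OF assms(1)])

text \<open>Geometric tail with ratio \<open>4 * B * norm \<tau> \<le> 1/4\<close>; the factor
  \<open>1 / (1 - ratio)\<close> is rounded up to \<open>2\<close>.\<close>

lemma truncation:
  fixes \<tau> c :: "'a::{real_normed_field,banach}"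
  assumes "norm c \<le> 3/2" "16 * B * norm \<tau> \<le> 1"
  shows "norm (chebyshev_series \<beta> \<tau> c - (\<Sum>k<N. of_real (\<beta> k) * \<tau> ^ k * chebyshev_U k c))
    \<le> 2 * A * (4 * B * norm \<tau>) ^ N"
proof -
  let ?f = "\<lambda>k. of_real (\<beta> k) * \<tau> ^ k * chebyshev_U k c"
  let ?x = "4 * B * norm \<tau>"
  have x: "0 \<le> ?x" "?x \<le> 1/4"
    using assms(2) B_pos by auto
  have "chebyshev_series \<beta> \<tau> c - (\<Sum>k<N. ?f k) = suminf (\<lambda>k. ?f (k + N))"
    unfolding chebyshev_series_def using suminf_minus_initial_segment[OF term_summable[OF assms], of N] by simp
  also have "norm \<dots> \<le> suminf (\<lambda>k. A * ?x ^ N * ?x ^ k)"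
  proof (rule norm_suminf_le)
    fix k show "norm (?f (k + N)) \<le> A * ?x ^ N * ?x ^ k"
      using norm_term_le[OF assms(1), of "k + N" \<tau>] by (simp only: power_add mult_ac)
    show "summable (\<lambda>k. A * ?x ^ N * ?x ^ k)"
      using x by (intro summable_mult summable_geometric) auto
  qed
  also have "\<dots> = A * ?x ^ N * (1 / (1 - ?x))"
    using x by (subst suminf_mult) (auto intro!: summable_geometric simp: suminf_geometric)
  also have "\<dots> \<le> A * ?x ^ N * 2"
  proof (rule mult_left_mono)
    show "1 / (1 - ?x) \<le> 2"
      using x by (simp add: field_simps)
    show "0 \<le> A * ?x ^ N"
      using x A_nonneg by simp
  qed
  finally show ?thesis by (simp add: mult_ac)
qed

text \<open>On the unit disc \<open>x ^ k\<close> is Lipschitz with constant \<open>k\<close>, so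
  both arguments are first scaled into it by \<open>16 * B\<close>. Undoing the scaling leaves
  \<open>(1/4) ^ k\<close>, which absorbs \<open>k \<le> 2 ^ k\<close> and still sums, to
  \<open>2\<close>.\<close>

lemma lipschitz:
  fixes \<tau> \<tau>' c :: "'a::{real_normed_field,banach}"
  assumes "norm c \<le> 3/2" "16 * B * norm \<tau> \<le> 1" "16 * B * norm \<tau>' \<le> 1"
  shows "norm (chebyshev_series \<beta> \<tau> c - chebyshev_series \<beta> \<tau>' c) \<le> 32 * A * B * norm (\<tau> - \<tau>')"
proof -
  let ?f = "\<lambda>\<tau> k. of_real (\<beta> k) * \<tau> ^ k * chebyshev_U k c"
  have "chebyshev_series \<beta> \<tau> c - chebyshev_series \<beta> \<tau>' c = suminf (\<lambda>k. ?f \<tau> k - ?f \<tau>' k)"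
    unfolding chebyshev_series_def by (intro suminf_diff term_summable assms)
  also have "norm \<dots> \<le> suminf (\<lambda>k. (16 * A * B * norm (\<tau> - \<tau>')) * (1/2) ^ k)"
  proof (rule norm_suminf_le)
    fix k
    let ?s = "of_real (16 * B) :: 'a"
    have s: "norm ?s = 16 * B" using B_pos by simp
    have "norm ((?s * \<tau>) ^ k - (?s * \<tau>') ^ k) \<le> k * norm (?s * \<tau> - ?s * \<tau>')"
      using assms s by (intro norm_power_diff) (simp_all only: norm_mult)
    also have "\<dots> = k * (16 * B * norm (\<tau> - \<tau>'))"
      unfolding right_diff_distrib[symmetric] norm_mult s ..
    finally have pow: "norm (?s ^ k * (\<tau> ^ k - \<tau>' ^ k)) \<le> k * (16 * B * norm (\<tau> - \<tau>'))"
      by (simp only: power_mult_distrib right_diff_distrib)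
    have "norm (?f \<tau> k - ?f \<tau>' k) = \<bar>\<beta> k\<bar> * norm (\<tau> ^ k - \<tau>' ^ k) * norm (chebyshev_U k c)"
    proof -
      have "?f \<tau> k - ?f \<tau>' k = of_real (\<beta> k) * (\<tau> ^ k - \<tau>' ^ k) * chebyshev_U k c"
        by (simp add: algebra_simps)
      then show ?thesis by (simp add: norm_mult)
    qed
    also have "\<dots> \<le> (A * B ^ k) * norm (\<tau> ^ k - \<tau>' ^ k) * 4 ^ k"
      using coeff_le[of k] norm_chebyshev_U_le[OF assms(1), of k] A_nonneg B_pos
      by (intro mult_mono) auto
    also have "\<dots> = A * ((1/4) ^ k * (16 * B) ^ k) * norm (\<tau> ^ k - \<tau>' ^ k)"
    proof -
      have "(1/4) ^ k * (16 * B) ^ k = (1/4 * (16 * B)) ^ k"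
        by (rule power_mult_distrib[symmetric])
      also have "1/4 * (16 * B) = 4 * B"
        by simp
      finally have *: "(1/4) ^ k * (16 * B) ^ k = 4 ^ k * B ^ k"
        by (simp only: power_mult_distrib)
      show ?thesis
        unfolding * by (simp only: mult_ac)
    qed
    also have "\<dots> = A * (1/4) ^ k * norm (?s ^ k * (\<tau> ^ k - \<tau>' ^ k))"
      unfolding norm_mult norm_power s by (simp only: mult.assoc)
    also have "\<dots> \<le> A * (1/4) ^ k * (k * (16 * B * norm (\<tau> - \<tau>')))"
      using A_nonneg pow by (intro mult_left_mono) auto
    also have "\<dots> \<le> A * (1/4) ^ k * (2 ^ k * (16 * B * norm (\<tau> - \<tau>')))"
    proof (rule mult_left_mono[OF mult_right_mono])
      show "real k \<le> 2 ^ k"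
        using of_nat_less_two_power[of k, where 'a = real] by simp
    qed (use A_nonneg B_pos in auto)
    also have "\<dots> = A * ((1/4) ^ k * 2 ^ k) * (16 * B * norm (\<tau> - \<tau>'))"
      by (simp only: mult_ac)
    also have "(1/4) ^ k * 2 ^ k = (1/4 * 2 :: real) ^ k"
      by (rule power_mult_distrib[symmetric])
    also have "A * (1/4 * 2) ^ k * (16 * B * norm (\<tau> - \<tau>')) = (16 * A * B * norm (\<tau> - \<tau>')) * (1/2) ^ k"
      by (simp add: mult_ac)
    finally show "norm (?f \<tau> k - ?f \<tau>' k) \<le> (16 * A * B * norm (\<tau> - \<tau>')) * (1/2) ^ k" .
  qed (intro summable_mult summable_geometric, simp)
  also have "\<dots> = 32 * A * B * norm (\<tau> - \<tau>')"
    by (subst suminf_mult) (auto intro!: summable_geometric simp: suminf_geometric)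
  finally show ?thesis .
qed

lemma of_real_chebyshev_series:
  assumes "\<bar>c\<bar> \<le> 3/2" "16 * B * \<bar>\<tau>\<bar> \<le> 1"
  shows "of_real (chebyshev_series \<beta> \<tau> c) = chebyshev_series \<beta> (of_real \<tau>) (of_real c :: 'a::{real_normed_field,banach})"
proof -
  have "summable (\<lambda>k. \<beta> k * \<tau> ^ k * chebyshev_U k c)"
    using term_summable[of c \<tau>] assms by simp
  from suminf_of_real[OF this] show ?thesis
    by (simp add: chebyshev_series_def chebyshev_U_of_real)
qed

lemma holomorphic_chebyshev_series:
  assumes "open S" "S \<subseteq> cball 0 (3/2)" "t holomorphic_on S" "\<And>z. z \<in> S \<Longrightarrow> 16 * B * cmod (t z) \<le> 1"
  shows "(\<lambda>z. chebyshev_series \<beta> (t z) z) holomorphic_on S"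
proof (rule holomorphic_uniform_sequence[OF assms(1)])
  let ?f = "\<lambda>k z. of_real (\<beta> k) * t z ^ k * chebyshev_U k z"
  show "(\<lambda>z. \<Sum>k<n. ?f k z) holomorphic_on S" for n
    by (intro holomorphic_intros assms chebyshev_U_holomorphic)
  have lim: "uniform_limit S (\<lambda>n z. \<Sum>k<n. ?f k z) (\<lambda>z. chebyshev_series \<beta> (t z) z) sequentially"
    unfolding chebyshev_series_def
  proof (rule Weierstrass_m_test)
    show "summable (\<lambda>k. A * (1/4) ^ k)"
      by (intro summable_mult summable_geometric) simp
    fix k z assume z: "z \<in> S"
    have "norm (?f k z) \<le> A * (4 * B * norm (t z)) ^ k"
      using assms(2) z by (intro norm_term_le) auto
    also have "\<dots> \<le> A * (1/4) ^ k"
      using assms(4)[OF z] A_nonneg B_pos by (intro mult_left_mono power_mono) auto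
    finally show "norm (?f k z) \<le> A * (1/4) ^ k" .
  qed
  fix z assume "z \<in> S"
  then obtain d where "0 < d" "cball z d \<subseteq> S"
    using assms(1) open_contains_cball by blast
  with lim show "\<exists>d>0. cball z d \<subseteq> S \<and>
      uniform_limit (cball z d) (\<lambda>n z. \<Sum>k<n. ?f k z) (\<lambda>z. chebyshev_series \<beta> (t z) z) sequentially"
    by (meson uniform_limit_on_subset)
qed

end

text \<open>An implicit function theorem on a domain \<open>S\<close> fixed in advance: the iterates
  of the constant \<open>a\<close> are holomorphic on all of \<open>S\<close> and converge uniformly
  at rate \<open>\<delta> / 2 ^ n\<close>, so the limit is holomorphic there as well.\<close>

lemma holomorphic_fixed_point:
  fixes T :: "complex \<Rightarrow> complex \<Rightarrow> complex"
  assumes S: "open S"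
    and maps: "\<And>c z. c \<in> S \<Longrightarrow> z \<in> cball a \<delta> \<Longrightarrow> T c z \<in> cball a \<delta>"
    and contr: "\<And>c z w. c \<in> S \<Longrightarrow> z \<in> cball a \<delta> \<Longrightarrow> w \<in> cball a \<delta> \<Longrightarrow> dist (T c z) (T c w) \<le> dist z w / 2"
    and holo: "\<And>f. f holomorphic_on S \<Longrightarrow> f ` S \<subseteq> cball a \<delta> \<Longrightarrow> (\<lambda>c. T c (f c)) holomorphic_on S"
    and \<delta>: "\<delta> \<ge> 0"
  shows "\<exists>r. r holomorphic_on S \<and> (\<forall>c\<in>S. r c \<in> cball a \<delta> \<and> T c (r c) = r c)"
proof -
  have "\<exists>!z. z \<in> cball a \<delta> \<and> T c z = z" if "c \<in> S" for c
  proof (rule Banach_fix)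
    show "T c ` cball a \<delta> \<subseteq> cball a \<delta>"
      using maps[OF that] by blast
    show "dist (T c z) (T c w) \<le> 1 / 2 * dist z w" if "z \<in> cball a \<delta>" "w \<in> cball a \<delta>" for z w
      using contr[OF \<open>c \<in> S\<close> that] by simp
  qed (use \<delta> in \<open>auto simp: complete_eq_closed\<close>)
  then have "\<forall>c\<in>S. \<exists>z. z \<in> cball a \<delta> \<and> T c z = z"
    by blast
  from bchoice[OF this] obtain r where "\<forall>c\<in>S. r c \<in> cball a \<delta> \<and> T c (r c) = r c" ..
  then have r: "\<And>c. c \<in> S \<Longrightarrow> r c \<in> cball a \<delta>" "\<And>c. c \<in> S \<Longrightarrow> T c (r c) = r c"
    by auto
  define f where "f = rec_nat (\<lambda>_. a) (\<lambda>_ g c. T c (g c))"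
  have f_Suc: "f (Suc n) = (\<lambda>c. T c (f n c))" and f_0: "f 0 = (\<lambda>_. a)" for n
    by (simp_all add: f_def)
  have f: "f n ` S \<subseteq> cball a \<delta> \<and> f n holomorphic_on S" for n
  proof (induction n)
    case 0
    with \<delta> show ?case by (auto simp: f_0)
  next
    case (Suc n)
    with maps holo[of "f n"] show ?case by (auto simp: f_Suc image_subset_iff)
  qed
  have close: "c \<in> S \<Longrightarrow> dist (f n c) (r c) \<le> \<delta> * (1/2) ^ n" for c n
  proof (induction n)
    case 0
    with r(1) show ?case by (simp add: f_0)
  next
    case (Suc n)
    then have "dist (f (Suc n) c) (r c) \<le> dist (f n c) (r c) / 2"
      using contr[of c "f n c" "r c"] r f by (auto simp: f_Suc image_subset_iff)
    with Suc show ?case by simp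
  qed
  have "uniform_limit S f r sequentially"
  proof (rule uniform_limitI)
    fix e :: real assume "e > 0"
    have "(\<lambda>n. \<delta> * (1/2) ^ n) \<longlonglongrightarrow> \<delta> * 0"
      by (intro tendsto_intros LIMSEQ_power_zero) simp
    then have "\<forall>\<^sub>F n in sequentially. \<delta> * (1/2) ^ n < e"
      using \<open>e > 0\<close> by (simp add: order_tendsto_iff)
    then show "\<forall>\<^sub>F n in sequentially. \<forall>c\<in>S. dist (f n c) (r c) < e"
    proof eventually_elim
      case (elim n)
      then show ?case
        by (auto intro: le_less_trans[OF close])
    qed
  qed
  note lim = this
  have "r holomorphic_on S"
  proof (rule holomorphic_uniform_sequence[OF S])
    show "f n holomorphic_on S" for n
      using f by blast
    fix x assume "x \<in> S"
    then obtain d where "0 < d" "cball x d \<subseteq> S"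
      using S open_contains_cball by blast
    then show "\<exists>d>0. cball x d \<subseteq> S \<and> uniform_limit (cball x d) f r sequentially"
      using uniform_limit_on_subset[OF lim] by auto
  qed
  with r show ?thesis
    by (intro exI[of _ r] conjI ballI)
qed

section \<open>The spectral curve\<close>

text \<open>
  With \<open>\<rho>\<close> the coefficients of the R-transform and \<open>t\<close> the scaling \<open>1 / sqrt n\<close>, the curve
  \<open>c = cos \<theta> \<mapsto> r c * cis \<theta>\<close> is the set where \<open>1 / g + R (t * g) / t\<close> is real, and \<open>X c\<close> is the value there.
\<close>

locale free_clt_coeffs =
  fixes \<rho> :: "nat \<Rightarrow> real" and A B :: real
  assumes \<rho>_le: "\<bar>\<rho> k\<bar> \<le> A * B ^ k" and B_pos: "B > 0"
    and \<rho>_0: "\<rho> 0 = 0" and \<rho>_1: "\<rho> 1 = 1"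
begin

sublocale num: geometric_coeffs \<rho> A B
  by unfold_locales (rule \<rho>_le, rule B_pos)

sublocale quot: geometric_coeffs "\<lambda>k. \<rho> (Suc k)" "A * B" B
  by unfold_locales (use \<rho>_le[of "Suc k" for k] B_pos in \<open>simp_all add: mult_ac\<close>)

text \<open>\<open>eqn t r c = 1\<close> is \<open>Im (K(r cis \<theta>)) = 0\<close> divided by
  \<open>sin \<theta> / r\<close>, using \<open>sin (k \<theta>) = sin \<theta> U_(k-1)(c)\<close>.
  After this division the equation involves \<open>c\<close> alone and stays nondegenerate at
  \<open>c = 1\<close> and \<open>c = -1\<close>.\<close>

definition eqn :: "real \<Rightarrow> 'a \<Rightarrow> 'a \<Rightarrow> 'a::{real_normed_field,banach}" where
  "eqn t r c = r\<^sup>2 * chebyshev_series (\<lambda>k. \<rho> (Suc k)) (of_real t * r) c"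

text \<open>Newton step with the derivative frozen at \<open>2\<close>, its value for
  \<open>t = 0\<close> and \<open>r = 1\<close>.\<close>

definition newton :: "real \<Rightarrow> 'a \<Rightarrow> 'a \<Rightarrow> 'a::{real_normed_field,banach}" where
  "newton t c r = r - (eqn t r c - 1) / 2"

text \<open>This is the real part of \<open>K\<close> on the curve. Writing
  \<open>cos (k \<theta>) = U_k - c U_(k-1)\<close> in it, the second part of the sum cancels
  \<open>cos \<theta> / r\<close> by \<open>eqn\<close>, and only the terms with \<open>U_k\<close>
  remain.\<close>

definition abscissa :: "real \<Rightarrow> 'a \<Rightarrow> 'a \<Rightarrow> 'a::{real_normed_field,banach}" where
  "abscissa t r c = chebyshev_series \<rho> (of_real t * r) c / of_real t"

text \<open>The first bound gives \<open>16 * B * t * (5/4) \<le> 1\<close>, the smallness required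
  by the Chebyshev series for \<open>norm r \<le> 5/4\<close>. The second makes
  \<open>10 * (A * B * B) * t \<le> 1/40\<close>, \<open>32 * (A * B * B) * t \<le> 2/25\<close> and
  \<open>74 * (A * B * B) * t \<le> 1/5\<close>, the three perturbation bounds needed below.\<close>

definition t0 :: real where
  "t0 = min (1 / (20 * B)) (1 / (400 * (A * B * B + 1)))"

lemma AB_nonneg: "A * B * B \<ge> 0"
  using num.A_nonneg B_pos by simp

lemma t0_pos: "t0 > 0"
  using AB_nonneg B_pos by (auto simp: t0_def)

lemma t0_le:
  assumes "0 < t" "t \<le> t0"
  shows "20 * B * t \<le> 1" "400 * (A * B * B) * t \<le> 1"
proof -
  show "20 * B * t \<le> 1"
    using assms B_pos by (simp add: t0_def field_simps)
  have "t * (400 * (A * B * B + 1)) \<le> 1"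
    using assms AB_nonneg by (simp add: t0_def field_simps)
  then show "400 * (A * B * B) * t \<le> 1"
    using assms by (simp add: algebra_simps)
qed

lemma cball_norm:
  fixes r :: "'a::real_normed_field"
  assumes "r \<in> cball 1 (1/4)"
  shows "norm r \<le> 5/4" "norm r \<ge> 3/4"
  using assms norm_triangle_ineq2[of r 1] norm_triangle_ineq2[of 1 r]
  by (auto simp: dist_norm norm_minus_commute)

lemma t_r_le:
  fixes r :: "'a::real_normed_field"
  assumes "0 < t" "t \<le> t0" "r \<in> cball 1 (1/4)"
  shows "16 * B * norm (of_real t * r) \<le> 1"
proof -
  have "16 * B * norm (of_real t * r) = 16 * B * t * norm r"
    using assms(1) by (simp add: norm_mult)
  also have "\<dots> \<le> 16 * B * t * (5/4)"
    using assms B_pos cball_norm[OF assms(3)] by (intro mult_left_mono) auto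
  finally show ?thesis
    using t0_le[OF assms(1,2)] by simp
qed

text \<open>For \<open>t = 0\<close> the difference of two values is
  \<open>(r - r') (1 - (r + r') / 2)\<close>, with factor at most \<open>1/4\<close> on this ball.
  The deviation \<open>q\<close> of the series from \<open>1\<close> adds \<open>1/32\<close>
  through its size and \<open>1/16\<close> through its variation, in total
  \<open>11/32 < 1/2\<close>.\<close>

lemma newton_contraction:
  fixes r r' c :: "'a::{real_normed_field,banach}"
  assumes t: "0 < t" "t \<le> t0" and c: "norm c \<le> 3/2"
    and r: "r \<in> cball 1 (1/4)" "r' \<in> cball 1 (1/4)"
  shows "dist (newton t c r) (newton t c r') \<le> dist r r' / 2"
proof -
  let ?Q = "\<lambda>r. chebyshev_series (\<lambda>k. \<rho> (Suc k)) (of_real t * r) c"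
  define q q' where "q = ?Q r - 1" and "q' = ?Q r' - 1"
  have q: "norm (?Q r - 1) \<le> 1/40" if "r \<in> cball 1 (1/4)" for r
  proof -
    have "norm (?Q r - 1) \<le> 2 * (A * B) * (4 * B * norm (of_real t * r))"
      using quot.truncation[OF c t_r_le[OF t that], of 1] \<rho>_1 by simp
    also have "\<dots> = 8 * (A * B * B) * t * norm r"
      using t by (simp add: norm_mult)
    also have "\<dots> \<le> 8 * (A * B * B) * t * (5/4)"
      using t AB_nonneg cball_norm[OF that] by (intro mult_left_mono) auto
    finally show ?thesis
      using t0_le[OF t] by simp
  qed
  have qq': "norm (q - q') \<le> 2/25 * norm (r - r')"
  proof -
    have "norm (q - q') \<le> 32 * (A * B) * B * norm (of_real t * r - of_real t * r')"
      unfolding q_def q'_def using quot.lipschitz[OF c t_r_le[OF t r(1)] t_r_le[OF t r(2)]] by simp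
    also have "\<dots> = 32 * (A * B * B) * t * norm (r - r')"
      using t by (simp add: norm_mult flip: right_diff_distrib)
    also have "\<dots> \<le> 2/25 * norm (r - r')"
      using t0_le[OF t] by (intro mult_right_mono) auto
    finally show ?thesis .
  qed
  have e: "eqn t r c = r\<^sup>2 * (1 + q)" "eqn t r' c = r'\<^sup>2 * (1 + q')"
    by (simp_all add: eqn_def q_def q'_def)
  have "newton t c r - newton t c r' =
      (r - r') * (1 - (r + r') / 2 - (r + r') / 2 * q) - r'\<^sup>2 / 2 * (q - q')"
    unfolding newton_def e by (simp add: power2_eq_square divide_simps) (simp add: algebra_simps)
  also have "norm \<dots> \<le> norm (r - r') * norm (1 - (r + r') / 2 - (r + r') / 2 * q) + norm (r'\<^sup>2 / 2) * norm (q - q')"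
    by (metis norm_mult norm_triangle_ineq4)
  also have "\<dots> \<le> norm (r - r') * (1/4 + 5/4 * (1/40)) + 25/32 * (2/25 * norm (r - r'))"
  proof (intro add_mono mult_mono)
    have "norm (1 - (r + r') / 2) \<le> 1/4"
    proof -
      have "1 - (r + r') / 2 = ((1 - r) + (1 - r')) / 2"
        by (simp add: field_simps)
      then have "norm (1 - (r + r') / 2) = norm ((1 - r) + (1 - r')) / 2"
        by (simp only: norm_divide norm_numeral)
      then show ?thesis
        using r norm_triangle_ineq[of "1 - r" "1 - r'"] by (simp add: dist_norm del: add_diff_eq)
    qed
    moreover have "norm ((r + r') / 2 * q) \<le> 5/4 * (1/40)"
      unfolding norm_mult
    proof (intro mult_mono)
      show "norm ((r + r') / 2) \<le> 5/4"
        using cball_norm[OF r(1)] cball_norm[OF r(2)] norm_triangle_ineq[of r r'] by (simp add: norm_divide)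
    qed (use q[OF r(1)] in \<open>simp_all add: q_def\<close>)
    ultimately show "norm (1 - (r + r') / 2 - (r + r') / 2 * q) \<le> 1/4 + 5/4 * (1/40)"
      by (meson add_mono norm_triangle_ineq4 order_trans)
    have "norm (r'\<^sup>2 / 2) \<le> (5/4)\<^sup>2 / 2"
      using cball_norm[OF r(2)] by (auto simp: norm_divide norm_power intro!: power_mono)
    then show "norm (r'\<^sup>2 / 2) \<le> 25/32"
      by (simp add: power2_eq_square)
  qed (use qq' in auto)
  also have "\<dots> \<le> norm (r - r') / 2"
    by simp
  finally show ?thesis
    by (simp add: dist_norm)
qed

lemma newton_one:
  fixes c :: "'a::{real_normed_field,banach}"
  assumes t: "0 < t" "t \<le> t0" and c: "norm c \<le> 3/2"
  shows "dist (newton t c 1) 1 \<le> 4 * (A * B * B) * t"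
proof -
  have "norm (chebyshev_series (\<lambda>k. \<rho> (Suc k)) (of_real t) c - 1) \<le> 2 * (A * B) * (4 * B * norm (of_real t :: 'a))"
    using quot.truncation[OF c t_r_le[OF t], of 1 1] \<rho>_1 by simp
  moreover have "dist (newton t c 1) 1 = norm (chebyshev_series (\<lambda>k. \<rho> (Suc k)) (of_real t) c - 1) / 2"
    by (simp add: newton_def eqn_def dist_norm norm_divide norm_minus_commute)
  ultimately show ?thesis
    using t by simp
qed

lemma newton_maps:
  fixes r c :: "'a::{real_normed_field,banach}"
  assumes t: "0 < t" "t \<le> t0" and c: "norm c \<le> 3/2" and r: "r \<in> cball 1 (1/4)"
  shows "newton t c r \<in> cball 1 (1/4)"
proof -
  have "dist (newton t c r) 1 \<le> dist (newton t c r) (newton t c 1) + dist (newton t c 1) 1"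
    by (rule dist_triangle)
  also have "\<dots> \<le> (1/4) / 2 + 1/100"
    using newton_contraction[OF t c r, of 1] newton_one[OF t c] r t0_le[OF t]
    by (intro add_mono) (auto simp: dist_commute)
  finally show ?thesis
    by (simp add: dist_commute)
qed

text \<open>A posteriori bound: for a contraction with factor \<open>1/2\<close> the distance to the
  fixed point is at most twice one step, and a step is half the residual. It yields uniqueness of
  the root as well as the accuracy of approximate roots.\<close>

lemma eqn_error:
  fixes r s c :: "'a::{real_normed_field,banach}"
  assumes t: "0 < t" "t \<le> t0" and c: "norm c \<le> 3/2"
    and r: "r \<in> cball 1 (1/4)" "eqn t r c = 1" and s: "s \<in> cball 1 (1/4)"
  shows "dist r s \<le> norm (eqn t s c - 1)"
proof -
  have "newton t c r = r"
    using r by (simp add: newton_def)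
  then have "dist r s \<le> dist (newton t c r) (newton t c s) + dist (newton t c s) s"
    using dist_triangle[of r s "newton t c s"] by simp
  also have "dist (newton t c r) (newton t c s) \<le> dist r s / 2"
    by (rule newton_contraction[OF t c r(1) s])
  also have "dist (newton t c s) s = norm (eqn t s c - 1) / 2"
    by (simp add: newton_def dist_norm norm_divide norm_minus_commute)
  finally show ?thesis by simp
qed

lemma eqn_of_real:
  assumes "0 < t" "t \<le> t0" "\<bar>c\<bar> \<le> 3/2" "r \<in> cball 1 (1/4)"
  shows "eqn t (of_real r) (of_real c) = (of_real (eqn t r c) :: 'a::{real_normed_field,banach})"
  using quot.of_real_chebyshev_series[of c "t * r", where 'a = 'a] t_r_le[OF assms(1,2,4)] assms(3)
  by (simp add: eqn_def)

lemma abscissa_of_real: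
  assumes "0 < t" "t \<le> t0" "\<bar>c\<bar> \<le> 3/2" "r \<in> cball 1 (1/4)"
  shows "abscissa t (of_real r) (of_real c) = (of_real (abscissa t r c) :: 'a::{real_normed_field,banach})"
  using num.of_real_chebyshev_series[of c "t * r", where 'a = 'a] t_r_le[OF assms(1,2,4)] assms(3)
  by (simp add: abscissa_def)

lemma ex_radius:
  assumes t: "0 < t" "t \<le> t0"
  shows "\<exists>r. r holomorphic_on ball 0 (3/2) \<and>
    (\<forall>c\<in>ball 0 (3/2). r c \<in> cball 1 (1/4) \<and> eqn t (r c) c = (1::complex))"
proof -
  have "\<exists>r. r holomorphic_on ball 0 (3/2) \<and> (\<forall>c\<in>ball 0 (3/2). r c \<in> cball 1 (1/4) \<and> newton t c (r c) = (r c :: complex))"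
  proof (rule holomorphic_fixed_point)
    fix f :: "complex \<Rightarrow> complex"
    assume f: "f holomorphic_on ball 0 (3/2)" "f ` ball 0 (3/2) \<subseteq> cball 1 (1/4)"
    show "(\<lambda>c. newton t c (f c)) holomorphic_on ball 0 (3/2)"
      unfolding newton_def eqn_def
    proof (intro holomorphic_intros f(1) quot.holomorphic_chebyshev_series)
      show "16 * B * norm (of_real t * f z) \<le> 1" if "z \<in> ball 0 (3/2)" for z
        using f(2) that by (intro t_r_le t) (meson image_subset_iff)
    qed auto
  next
    fix c z w :: complex
    assume c: "c \<in> ball 0 (3/2)" and z: "z \<in> cball 1 (1/4)"
    have c': "norm c \<le> 3/2"
      using c by simp
    show "newton t c z \<in> cball 1 (1/4)"
      by (rule newton_maps[OF t c' z])
    assume w: "w \<in> cball 1 (1/4)"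
    show "dist (newton t c z) (newton t c w) \<le> dist z w / 2"
      by (rule newton_contraction[OF t c' z w])
  qed auto
  moreover have "newton t c z = z \<longleftrightarrow> eqn t z c = 1" for c z :: complex
    by (simp add: newton_def)
  ultimately show ?thesis
    by simp
qed

text \<open>The parameter is complex and ranges over a disc containing \<open>[-1, 1]\<close> in its
  interior, so that derivatives up to the edges can be estimated by Cauchy's inequality.\<close>

definition radius :: "real \<Rightarrow> complex \<Rightarrow> complex" where
  "radius t = (SOME r. r holomorphic_on ball 0 (3/2) \<and>
    (\<forall>c\<in>ball 0 (3/2). r c \<in> cball 1 (1/4) \<and> eqn t (r c) c = 1))"

context
  fixes t :: real
  assumes t: "0 < t" "t \<le> t0"
begin

lemma radius_props: "radius t holomorphic_on ball 0 (3/2) \<and>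
    (\<forall>c\<in>ball 0 (3/2). radius t c \<in> cball 1 (1/4) \<and> eqn t (radius t c) c = 1)"
  unfolding radius_def by (rule someI_ex[OF ex_radius[OF t]])

lemma radius_holomorphic: "radius t holomorphic_on ball 0 (3/2)"
  by (rule conjunct1[OF radius_props])

lemma radius_cball: "c \<in> ball 0 (3/2) \<Longrightarrow> radius t c \<in> cball 1 (1/4)"
  by (rule conjunct1[OF bspec[OF conjunct2[OF radius_props]]])

lemma eqn_radius: "c \<in> ball 0 (3/2) \<Longrightarrow> eqn t (radius t c) c = 1"
  by (rule conjunct2[OF bspec[OF conjunct2[OF radius_props]]])

lemma radius_close: "c \<in> ball 0 (3/2) \<Longrightarrow> dist (radius t c) 1 \<le> 8 * (A * B * B) * t"
proof -
  assume c: "c \<in> ball 0 (3/2)"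
  then have c': "norm c \<le> 3/2"
    by simp
  have "dist (radius t c) 1 \<le> norm (eqn t 1 c - 1)"
    using radius_cball[OF c] eqn_radius[OF c] by (intro eqn_error[OF t c']) simp_all
  also have "\<dots> = 2 * dist (newton t c 1) 1"
    unfolding newton_def dist_norm by (simp add: norm_divide)
  finally show ?thesis
    using newton_one[OF t c'] by simp
qed

end

end

section \<open>The map \<open>K\<close> and its real values on the curve\<close>

context free_clt_coeffs
begin

definition level :: "real \<Rightarrow> complex \<Rightarrow> complex" where
  "level t g = 1 / g + eval_fps (fps_complex (Abs_fps \<rho>)) (of_real t * g) / of_real t"

lemma fps_conv_radius_\<rho>: "fps_conv_radius (fps_complex (Abs_fps \<rho>)) \<ge> ereal (1 / (2 * B))"
proof -
  have "summable (\<lambda>k. fps_complex (Abs_fps \<rho>) $ k * of_real (1 / (2 * B)) ^ k)"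
  proof (rule summable_comparison_test')
    show "summable (\<lambda>k. A * (1 / 2) ^ k)"
      by (intro summable_mult summable_geometric) simp
    fix k
    have "norm (fps_complex (Abs_fps \<rho>) $ k * of_real (1 / (2 * B)) ^ k) = \<bar>\<rho> k\<bar> * (1 / (2 * B)) ^ k"
      using B_pos by (simp add: norm_mult norm_power norm_divide)
    also have "\<dots> \<le> A * B ^ k * (1 / (2 * B)) ^ k"
      using \<rho>_le B_pos by (intro mult_right_mono) auto
    also have "\<dots> = A * (B * (1 / (2 * B))) ^ k"
      by (simp only: power_mult_distrib mult.assoc)
    also have "B * (1 / (2 * B)) = 1 / 2"
      using B_pos by simp
    finally show "norm (fps_complex (Abs_fps \<rho>) $ k * of_real (1 / (2 * B)) ^ k) \<le> A * (1 / 2) ^ k" .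
  qed
  then have "fps_conv_radius (fps_complex (Abs_fps \<rho>)) \<ge> norm (of_real (1 / (2 * B)) :: complex)"
    unfolding fps_conv_radius_def by (rule conv_radius_geI)
  then show ?thesis
    using B_pos by (simp add: norm_divide norm_mult)
qed

context
  fixes t :: real
  assumes t: "0 < t" "t \<le> t0"
begin

text \<open>Radius \<open>2\<close> accommodates both contours, the unit circle and the curve with
  \<open>r \<le> 5/4\<close>; \<open>20 * B * t \<le> 1\<close> keeps \<open>t * g\<close> within
  the radius \<open>1 / (2 * B)\<close> of guaranteed convergence.\<close>

lemma eval_\<rho>_holomorphic: "(\<lambda>g. eval_fps (fps_complex (Abs_fps \<rho>)) (of_real t * g)) holomorphic_on ball 0 2"
proof -
  have 1: "(*) (complex_of_real t) holomorphic_on ball 0 2"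
    by (intro holomorphic_intros)
  have 2: "eval_fps (fps_complex (Abs_fps \<rho>)) holomorphic_on eball 0 (fps_conv_radius (fps_complex (Abs_fps \<rho>)))"
    by (rule holomorphic_on_eval_fps) simp
  have 3: "(*) (complex_of_real t) ` ball 0 2 \<subseteq> eball 0 (fps_conv_radius (fps_complex (Abs_fps \<rho>)))"
  proof safe
    fix g :: complex assume "g \<in> ball 0 2"
    then have "t * norm g < t * 2"
      using t by simp
    also have "t * 2 \<le> 1 / (2 * B)"
      using t0_le(1)[OF t] B_pos by (simp add: field_simps)
    finally have "ereal (norm (of_real t * g)) < ereal (1 / (2 * B))"
      using t by (simp add: norm_mult)
    also note fps_conv_radius_\<rho>
    finally show "of_real t * g \<in> eball 0 (fps_conv_radius (fps_complex (Abs_fps \<rho>)))"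
      by (simp add: in_eball_iff)
  qed
  show ?thesis
    using holomorphic_on_compose_gen[OF 1 2 3] by (simp add: o_def)
qed

lemma level_holomorphic: "level t holomorphic_on ball 0 2 - {0}"
  unfolding level_def
  using t by (intro holomorphic_intros holomorphic_on_subset[OF eval_\<rho>_holomorphic]) auto

definition real_radius :: "real \<Rightarrow> real" where
  "real_radius c = Re (radius t (of_real c))"

definition real_abscissa :: "real \<Rightarrow> real" where
  "real_abscissa c = abscissa t (real_radius c) c"

lemma of_real_mem_cball_1: "complex_of_real s \<in> cball 1 e \<longleftrightarrow> s \<in> cball 1 e"
proof -
  have "1 - complex_of_real s = of_real (1 - s)"
    by simp
  then show ?thesis
    unfolding mem_cball dist_norm by (simp only: norm_of_real real_norm_def)
qed

text \<open>The same contraction has a fixed point over the reals; embedded in the complex numbers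
  it has residual \<open>0\<close>, so \<open>eqn_error\<close> identifies it with
  \<open>radius\<close>.\<close>

lemma radius_of_real:
  assumes "\<bar>c\<bar> < 3/2"
  shows "radius t (of_real c) = of_real (real_radius c)"
proof -
  have c: "norm c \<le> 3/2" "complex_of_real c \<in> ball 0 (3/2)" "norm (complex_of_real c) \<le> 3/2"
    using assms by auto
  have "\<exists>!s. s \<in> cball 1 (1/4) \<and> newton t c s = s"
  proof (rule Banach_fix)
    show "newton t c ` cball 1 (1/4) \<subseteq> cball 1 (1/4)"
      using newton_maps[OF t c(1)] by blast
    show "dist (newton t c r) (newton t c s) \<le> 1/2 * dist r s" if "r \<in> cball 1 (1/4)" "s \<in> cball 1 (1/4)" for r s
      using newton_contraction[OF t c(1) that] by simp
  qed (auto simp: complete_eq_closed)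
  then obtain s where s: "s \<in> cball 1 (1/4)" "eqn t s c = 1"
    by (auto simp: newton_def)
  have s': "complex_of_real s \<in> cball 1 (1/4)"
    using s(1) by (simp only: of_real_mem_cball_1)
  have "eqn t (complex_of_real s) (of_real c) = 1"
    using eqn_of_real[OF t _ s(1), of c, where 'a = complex] s(2) assms by simp
  then have "dist (radius t (of_real c)) (complex_of_real s) \<le> 0"
    using eqn_error[OF t c(3) radius_cball[OF t c(2)] eqn_radius[OF t c(2)] s'] by simp
  then have "radius t (of_real c) = of_real s"
    by simp
  then show ?thesis
    by (simp add: real_radius_def)
qed

lemma real_radius_cball: "\<bar>c\<bar> < 3/2 \<Longrightarrow> real_radius c \<in> cball 1 (1/4)"
proof -
  assume c: "\<bar>c\<bar> < 3/2"
  then have "complex_of_real c \<in> ball 0 (3/2)"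
    by simp
  from radius_cball[OF t this] show ?thesis
    by (simp only: radius_of_real[OF c] of_real_mem_cball_1)
qed

lemma eqn_real_radius:
  assumes "\<bar>c\<bar> < 3/2"
  shows "eqn t (real_radius c) c = 1"
proof -
  have "complex_of_real (eqn t (real_radius c) c) = 1"
    using eqn_radius[OF t, of "of_real c"] eqn_of_real[OF t _ real_radius_cball[OF assms], of c, where 'a = complex]
      radius_of_real[OF assms] assms by simp
  then show ?thesis
    using of_real_eq_1_iff by blast
qed

lemma radius_DERIV:
  assumes "\<bar>c\<bar> < 3/2"
  shows "(real_radius has_real_derivative Re (deriv (radius t) (of_real c))) (at c)"
proof -
  have "(radius t has_field_derivative deriv (radius t) (of_real c)) (at (of_real c))"
    using radius_holomorphic[OF t] assms by (intro holomorphic_derivI[of _ "ball 0 (3/2)"]) auto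
  then have "((\<lambda>x. radius t (of_real x)) has_vector_derivative deriv (radius t) (of_real c)) (at c)"
    by (rule has_vector_derivative_real_field)
  then have "((\<lambda>x. Re (radius t (of_real x))) has_vector_derivative Re (deriv (radius t) (of_real c))) (at c)"
    by (rule bounded_linear.has_vector_derivative[OF bounded_linear_Re])
  then show ?thesis
    by (simp add: real_radius_def[abs_def] has_real_derivative_iff_has_vector_derivative)
qed

lemma abscissa_holomorphic: "(\<lambda>c. abscissa t (radius t c) c) holomorphic_on ball 0 (3/2)"
  unfolding abscissa_def
proof (intro holomorphic_intros num.holomorphic_chebyshev_series radius_holomorphic t)
  show "16 * B * norm (of_real t * radius t c) \<le> 1" if "c \<in> ball 0 (3/2)" for c
    by (rule t_r_le[OF t radius_cball[OF t that]])
qed (use t in auto)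

lemma abscissa_radius_of_real:
  assumes "\<bar>c\<bar> < 3/2"
  shows "abscissa t (radius t (of_real c)) (of_real c) = of_real (real_abscissa c)"
  using abscissa_of_real[OF t _ real_radius_cball[OF assms], of c, where 'a = complex] assms
  by (simp add: radius_of_real real_abscissa_def)

text \<open>\<open>74 = 50 + 24\<close>: cutting the series after its linear term costs
  \<open>32 * (5/4)^2 = 50\<close>, and replacing \<open>radius\<close> by \<open>1\<close> in
  \<open>2 * c * radius\<close> costs \<open>8 * 3 = 24\<close>.\<close>

lemma abscissa_close:
  fixes c :: complex
  assumes c: "c \<in> ball 0 (3/2)"
  shows "norm (abscissa t (radius t c) c - 2 * c) \<le> 74 * (A * B * B) * t"
proof -
  let ?r = "radius t c"
  have c': "norm c \<le> 3/2"
    using c by simp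
  have "norm (chebyshev_series \<rho> (of_real t * ?r) c - of_real t * ?r * (2 * c))
      \<le> 2 * A * (4 * B * norm (of_real t * ?r)) ^ 2"
    using num.truncation[OF c' t_r_le[OF t radius_cball[OF t c]], of 2] \<rho>_0 \<rho>_1
    by (simp add: numeral_2_eq_2)
  also have "\<dots> = 32 * (A * B * B) * t\<^sup>2 * (norm ?r)\<^sup>2"
    using t by (simp add: norm_mult power2_eq_square)
  also have "\<dots> \<le> 32 * (A * B * B) * t\<^sup>2 * (5/4)\<^sup>2"
    using cball_norm[OF radius_cball[OF t c]] AB_nonneg by (intro mult_left_mono power_mono) auto
  finally have 1: "norm (chebyshev_series \<rho> (of_real t * ?r) c - of_real t * ?r * (2 * c)) \<le> t * (50 * (A * B * B) * t)"
    by (simp add: power2_eq_square mult_ac)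
  have "of_real t * (abscissa t ?r c - ?r * (2 * c)) = chebyshev_series \<rho> (of_real t * ?r) c - of_real t * ?r * (2 * c)"
    using t by (simp add: abscissa_def right_diff_distrib)
  then have "t * norm (abscissa t ?r c - ?r * (2 * c)) = norm (chebyshev_series \<rho> (of_real t * ?r) c - of_real t * ?r * (2 * c))"
    using t by (metis abs_of_pos norm_mult norm_of_real)
  with 1 have "t * norm (abscissa t ?r c - ?r * (2 * c)) \<le> t * (50 * (A * B * B) * t)"
    by simp
  then have "norm (abscissa t ?r c - ?r * (2 * c)) \<le> 50 * (A * B * B) * t"
    by (rule mult_left_le_imp_le) (rule t)
  moreover have "norm (?r * (2 * c) - 2 * c) \<le> 24 * (A * B * B) * t"
  proof -
    have "?r * (2 * c) - 2 * c = (?r - 1) * (2 * c)"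
      by (simp add: algebra_simps)
    then have "norm (?r * (2 * c) - 2 * c) = norm (?r - 1) * (2 * norm c)"
      by (simp add: norm_mult)
    also have "\<dots> \<le> (8 * (A * B * B) * t) * 3"
      using radius_close[OF t c] c' AB_nonneg t by (intro mult_mono) (auto simp: dist_norm)
    finally show ?thesis by simp
  qed
  ultimately show ?thesis
    using norm_triangle_ineq[of "abscissa t ?r c - ?r * (2 * c)" "?r * (2 * c) - 2 * c"] by simp
qed

definition abscissa' :: "real \<Rightarrow> real" where
  "abscissa' c = Re (deriv (\<lambda>c. abscissa t (radius t c) c) (of_real c))"

lemma abscissa_DERIV:
  assumes "\<bar>c\<bar> < 3/2"
  shows "(real_abscissa has_real_derivative abscissa' c) (at c)"
proof -
  let ?X = "\<lambda>c. abscissa t (radius t c) c"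
  have "(?X has_field_derivative deriv ?X (of_real c)) (at (of_real c))"
    using abscissa_holomorphic assms by (intro holomorphic_derivI[of _ "ball 0 (3/2)"]) auto
  then have "((\<lambda>x. ?X (of_real x)) has_vector_derivative deriv ?X (of_real c)) (at c)"
    by (rule has_vector_derivative_real_field)
  then have "((\<lambda>x. Re (?X (of_real x))) has_vector_derivative abscissa' c) (at c)"
    unfolding abscissa'_def by (rule bounded_linear.has_vector_derivative[OF bounded_linear_Re])
  then have "((\<lambda>x. Re (?X (of_real x))) has_real_derivative abscissa' c) (at c)"
    by (simp add: has_real_derivative_iff_has_vector_derivative)
  then show ?thesis
  proof (rule DERIV_cong_ev[OF refl _ refl, THEN iffD1, rotated])
    have "\<forall>\<^sub>F x in nhds c. x \<in> {-3/2<..<3/2}"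
      using assms by (intro eventually_nhds_in_open) auto
    then show "\<forall>\<^sub>F x in nhds c. Re (?X (of_real x)) = real_abscissa x"
      by eventually_elim (subst abscissa_radius_of_real, auto)
  qed
qed

lemma continuous_derivs:
  "continuous_on {-1..1} (\<lambda>c. Re (deriv (radius t) (of_real c)))"
  "continuous_on {-1..1} abscissa'"
proof -
  have *: "continuous_on {-1..1} (\<lambda>c::real. Re (deriv f (of_real c)))" if "f holomorphic_on ball 0 (3/2)" for f
  proof -
    have "continuous_on (ball 0 (3/2)) (deriv f)"
      using that by (intro holomorphic_on_imp_continuous_on holomorphic_deriv) auto
    then have "continuous_on {-1..1} (\<lambda>c::real. deriv f (of_real c))"
      by (rule continuous_on_compose2) (auto intro!: continuous_intros)
    then show ?thesis
      by (intro continuous_intros)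
  qed
  show "continuous_on {-1..1} (\<lambda>c. Re (deriv (radius t) (of_real c)))"
    by (rule *[OF radius_holomorphic[OF t]])
  show "continuous_on {-1..1} abscissa'"
    unfolding abscissa'_def by (rule *[OF abscissa_holomorphic])
qed

text \<open>The derivative of \<open>2 * c\<close> is \<open>2\<close>, and Cauchy's inequality on a
  circle of radius \<open>1/4\<close> bounds that of the remainder by
  \<open>(1/5) / (1/4) = 4/5\<close>. This gives the strict monotonicity that allows
  \<open>c\<close> to serve as a coordinate on the support.\<close>

lemma abscissa'_ge_1:
  assumes "\<bar>c\<bar> \<le> 1"
  shows "abscissa' c \<ge> 1"
proof -
  let ?X = "\<lambda>c. abscissa t (radius t c) c"
  let ?f = "\<lambda>c. ?X c - 2 * c" and ?c = "complex_of_real c"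
  have sub: "cball ?c (1/4) \<subseteq> ball 0 (3/2)"
  proof
    fix z assume "z \<in> cball ?c (1/4)"
    then show "z \<in> ball 0 (3/2)"
      using assms norm_triangle_ineq2[of z ?c] by (simp add: dist_norm norm_minus_commute)
  qed
  have f: "?f holomorphic_on ball 0 (3/2)"
    by (intro holomorphic_intros abscissa_holomorphic)
  have "norm ((deriv ^^ 1) ?f ?c) \<le> fact 1 * (1/5) / (1/4) ^ 1"
  proof (rule Cauchy_inequality)
    show "?f holomorphic_on ball ?c (1/4)" "continuous_on (cball ?c (1/4)) ?f"
      using f sub ball_subset_cball holomorphic_on_imp_continuous_on holomorphic_on_subset by blast+
    fix z assume "norm (?c - z) = 1/4"
    then have "z \<in> cball ?c (1/4)"
      by (simp add: dist_norm)
    then have "norm (?f z) \<le> 74 * (A * B * B) * t"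
      using abscissa_close sub by blast
    also have "\<dots> \<le> 1/5"
      using t0_le[OF t] by linarith
    finally show "norm (?f z) \<le> 1/5" .
  qed simp
  moreover have "deriv ?f ?c = deriv ?X ?c - 2"
  proof -
    have "(?X has_field_derivative deriv ?X ?c) (at ?c)"
      using abscissa_holomorphic assms by (intro holomorphic_derivI[of _ "ball 0 (3/2)"]) auto
    then show ?thesis
      by (intro DERIV_imp_deriv) (auto intro!: derivative_eq_intros)
  qed
  ultimately have "norm (deriv ?X ?c - 2) \<le> 4/5"
    by simp
  then have "\<bar>Re (deriv ?X ?c - 2)\<bar> \<le> 4/5"
    using abs_Re_le_cmod order_trans by blast
  then have "- Re (deriv ?X ?c - 2) \<le> 4/5"
    by (rule abs_le_D2)
  then show ?thesis
    by (simp add: abscissa'_def)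
qed

text \<open>By \<open>cis_power_chebyshev_U\<close> the series contributes \<open>SN / t\<close>
  minus \<open>cis (- \<theta>) * r * SQ\<close>. The defining equation says
  \<open>r^2 * SQ = 1\<close>, so the subtracted term is precisely the pole
  \<open>1 / g\<close>.\<close>

lemma level_curve:
  "level t (of_real (real_radius (cos \<theta>)) * cis \<theta>) = of_real (real_abscissa (cos \<theta>))"
proof -
  let ?c = "cos \<theta>"
  let ?r = "real_radius ?c" and ?e = "cis \<theta>" and ?e' = "cis (- \<theta>)"
  have c: "\<bar>?c\<bar> < 3/2" "norm ?c \<le> 3/2"
    using abs_cos_le_one[of \<theta>] by (auto simp del: abs_cos_le_one)
  have r: "?r \<in> cball 1 (1/4)"
    by (rule real_radius_cball[OF c(1)])
  then have r_pos: "?r > 0"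
    using cball_norm(2)[OF r] by (auto simp: dist_norm abs_if split: if_splits)
  let ?\<tau> = "t * ?r"
  have \<tau>: "16 * B * norm ?\<tau> \<le> 1"
    using t_r_le[OF t r] by simp
  have ee': "?e * ?e' = 1"
    by (simp add: cis_mult)
  let ?N = "\<lambda>k. \<rho> k * ?\<tau> ^ k * chebyshev_U k ?c" and ?Q = "\<lambda>k. \<rho> (Suc k) * ?\<tau> ^ k * chebyshev_U k ?c"
  have N: "summable ?N" and Q: "summable ?Q"
    using num.term_summable[OF c(2) \<tau>] quot.term_summable[OF c(2) \<tau>] by simp_all
  define SN SQ where "SN = suminf ?N" and "SQ = suminf ?Q"
  have NS: "(\<lambda>k. complex_of_real (?N (Suc k))) sums of_real SN"
  proof -
    have "?N sums SN"
      using N unfolding SN_def by (rule summable_sums)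
    then have "(\<lambda>k. ?N (Suc k)) sums SN"
      using \<rho>_0 by (subst sums_Suc_iff) simp
    then show ?thesis
      by (simp only: sums_of_real_iff)
  qed
  have QS: "(\<lambda>k. complex_of_real (?Q k)) sums of_real SQ"
    unfolding sums_of_real_iff SQ_def using Q by (rule summable_sums)
  have "(\<lambda>k. complex_of_real (?N (Suc k)) - (?e' * of_real ?\<tau>) * complex_of_real (?Q k)) sums (of_real SN - (?e' * of_real ?\<tau>) * of_real SQ)"
    by (intro sums_diff sums_mult NS QS)
  also have "(\<lambda>k. complex_of_real (?N (Suc k)) - (?e' * of_real ?\<tau>) * complex_of_real (?Q k)) =
      (\<lambda>k. of_real (\<rho> (Suc k)) * (of_real t * (of_real ?r * ?e)) ^ Suc k)"
  proof
    fix k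
    have "(of_real t * (of_real ?r * ?e)) ^ Suc k = of_real (?\<tau> ^ Suc k) * ?e ^ Suc k"
      by (simp only: power_mult_distrib of_real_mult of_real_power mult.assoc)
    also have "\<dots> = of_real (?\<tau> ^ Suc k) * (of_real (chebyshev_U (Suc k) ?c) - ?e' * of_real (chebyshev_U k ?c))"
      unfolding cis_power_chebyshev_U ..
    finally show "complex_of_real (?N (Suc k)) - (?e' * of_real ?\<tau>) * complex_of_real (?Q k) =
        of_real (\<rho> (Suc k)) * (of_real t * (of_real ?r * ?e)) ^ Suc k"
      by (simp only: of_real_mult right_diff_distrib power_Suc mult_ac)
  qed
  finally have "(\<lambda>k. of_real (\<rho> k) * (of_real t * (of_real ?r * ?e)) ^ k) sums (of_real SN - (?e' * of_real ?\<tau>) * of_real SQ)"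
    using \<rho>_0 by (subst (asm) sums_Suc_iff) simp
  then have ev: "eval_fps (fps_complex (Abs_fps \<rho>)) (of_real t * (of_real ?r * ?e)) = of_real SN - (?e' * of_real ?\<tau>) * of_real SQ"
    unfolding eval_fps_def by (simp add: sums_iff)
  have SQ: "?r\<^sup>2 * SQ = 1"
    using eqn_real_radius[OF c(1)] by (simp add: eqn_def chebyshev_series_def SQ_def)
  have SN: "SN / t = real_abscissa ?c"
    by (simp add: real_abscissa_def abscissa_def chebyshev_series_def SN_def)
  have inv: "1 / (of_real ?r * ?e) = ?e' * of_real (?r * SQ)"
  proof -
    have "(?e' * of_real (?r * SQ)) * (of_real ?r * ?e) = (?e * ?e') * of_real (?r\<^sup>2 * SQ)"
      by (simp add: power2_eq_square)
    also have "\<dots> = 1"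
      unfolding ee' SQ by simp
    finally have "(of_real ?r * ?e) * (?e' * of_real (?r * SQ)) = 1"
      by (simp only: mult.commute)
    from inverse_unique[OF this] show ?thesis
      by (simp only: inverse_eq_divide)
  qed
  have "(of_real SN - (?e' * of_real ?\<tau>) * of_real SQ) / of_real t = of_real (SN / t) - ?e' * of_real (?r * SQ)"
  proof -
    have "(?e' * complex_of_real ?\<tau>) * of_real SQ = (?e' * of_real (?r * SQ)) * of_real t"
      by (simp only: of_real_mult mult_ac)
    then show ?thesis
      using t by (simp only: diff_divide_distrib of_real_divide) simp
  qed
  then have "level t (of_real ?r * ?e) = ?e' * of_real (?r * SQ) + (of_real (real_abscissa ?c) - ?e' * of_real (?r * SQ))"
    by (simp only: level_def ev inv SN)
  also have "\<dots> = of_real (real_abscissa ?c)"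
    by (simp only: add_diff_eq add_diff_cancel_left')
  finally show ?thesis .
qed

end

end

section \<open>Densities parametrized by the spectral curve\<close>

text \<open>
  The curve \<open>c = cos \<theta> \<mapsto> r c * cis \<theta>\<close> is mapped by \<open>K\<close> onto the real interval \<open>[X (-1), X 1]\<close>, traversed
  twice. A density \<open>p\<close> with \<open>p (X c) = Im (r c * cis \<theta>) / pi\<close> has its moments given by integrals of \<open>K ^ Suc k\<close>
  around the curve, after integrating by parts.
\<close>

lemma curve_moment:
  fixes r X r' X' p :: "real \<Rightarrow> real" and K :: "complex \<Rightarrow> complex"
  assumes r: "\<And>c. \<bar>c\<bar> \<le> 1 \<Longrightarrow> (r has_real_derivative r' c) (at c)" "continuous_on {-1..1} r'"
    and X: "\<And>c. \<bar>c\<bar> \<le> 1 \<Longrightarrow> (X has_real_derivative X' c) (at c)" "continuous_on {-1..1} X'"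
    and X_mono: "X (-1) \<le> X 1"
    and X_range: "\<And>c. \<bar>c\<bar> \<le> 1 \<Longrightarrow> X c \<in> {X (-1)..X 1}"
    and r_pos: "\<And>c. \<bar>c\<bar> \<le> 1 \<Longrightarrow> 0 < r c \<and> r c < R"
    and K: "K holomorphic_on ball 0 R - {0}"
    and KX: "\<And>\<theta>. K (of_real (r (cos \<theta>)) * cis \<theta>) = of_real (X (cos \<theta>))"
    and p: "continuous_on UNIV p" "\<And>c. \<bar>c\<bar> \<le> 1 \<Longrightarrow> p (X c) = r c * sqrt (1 - c\<^sup>2) / pi"
    and \<eta>: "0 < \<eta>" "\<eta> < R"
  shows "Im (contour_integral (circlepath 0 \<eta>) (\<lambda>g. K g ^ Suc k)) =
    2 * pi * Suc k * integral {X (-1)..X 1} (\<lambda>x. x ^ k * p x)"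
proof -
  define c where "c s = cos (2 * pi * s)" for s
  define \<gamma> where "\<gamma> s = of_real (r (c s)) * cis (2 * pi * s)" for s
  define y where "y s = r (c s) * sin (2 * pi * s)" for s
  define c' where "c' s = - (2 * pi * sin (2 * pi * s))" for s
  have c_le: "\<bar>c s\<bar> \<le> 1" for s
    by (simp add: c_def)
  have dc: "(c has_real_derivative c' s) (at s)" for s
    unfolding c_def[abs_def] c'_def by (auto intro!: derivative_eq_intros)
  have drc: "((\<lambda>s. r (c s)) has_real_derivative r' (c s) * c' s) (at s)" for s
    by (rule DERIV_chain2[OF r(1)[OF c_le] dc])
  have dXc: "((\<lambda>s. X (c s)) has_real_derivative X' (c s) * c' s) (at s)" for s
    by (rule DERIV_chain2[OF X(1)[OF c_le] dc])
  define y' where "y' s = r' (c s) * c' s * sin (2 * pi * s) + r (c s) * (2 * pi * cos (2 * pi * s))" for s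
  define z' where "z' s = r' (c s) * c' s * cos (2 * pi * s) - r (c s) * (2 * pi * sin (2 * pi * s))" for s
  have dy: "(y has_real_derivative y' s) (at s)" for s
    unfolding y_def[abs_def] y'_def using drc[of s] by (auto intro!: derivative_eq_intros)
  have dz: "((\<lambda>s. r (c s) * cos (2 * pi * s)) has_real_derivative z' s) (at s)" for s
    unfolding z'_def using drc[of s] by (auto intro!: derivative_eq_intros)
  have \<gamma>_eq: "\<gamma> = (\<lambda>s. Complex (r (c s) * cos (2 * pi * s)) (y s))"
    by (simp add: \<gamma>_def y_def complex_eq_iff fun_eq_iff)
  have d\<gamma>: "(\<gamma> has_vector_derivative Complex (z' s) (y' s)) (at s)" for s
    unfolding \<gamma>_eq using dy[of s] dz[of s]
    by (intro has_vector_derivative_complex_iff[THEN iffD2])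
       (simp add: has_real_derivative_iff_has_vector_derivative)
  have cont_c: "continuous_on S c" "continuous_on S c'" for S
    unfolding c_def[abs_def] c'_def[abs_def] by (intro continuous_intros)+
  have cont_comp: "continuous_on S (\<lambda>s. f (c s))" if "continuous_on {-1..1} f" for S and f :: "real \<Rightarrow> real"
    by (rule continuous_on_compose2[OF that cont_c(1)]) (use c_le in \<open>auto simp: abs_le_iff minus_le_iff\<close>)
  have cont_r: "continuous_on {-1..1} r" and cont_X: "continuous_on {-1..1} X"
    using r(1) X(1) by (auto intro!: DERIV_atLeastAtMost_imp_continuous_on simp: abs_le_iff)
  have cont: "continuous_on S y'" "continuous_on S z'" "continuous_on S y" "continuous_on S (\<lambda>s. X (c s))"
     "continuous_on S (\<lambda>s. X' (c s))" for S
    unfolding y'_def[abs_def] z'_def[abs_def] y_def[abs_def]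
    by (intro continuous_intros cont_comp r X cont_r cont_X cont_c)+
  have \<gamma>_valid: "valid_path \<gamma>"
  proof -
    have "continuous_on {0..1} (\<lambda>s. Complex (z' s) (y' s))"
      unfolding Complex_eq by (intro continuous_intros cont)
    then have "\<gamma> C1_differentiable_on {0..1}"
      unfolding C1_differentiable_on_def using d\<gamma> by (intro exI[of _ "\<lambda>s. Complex (z' s) (y' s)"]) simp
    then show ?thesis
      unfolding valid_path_def by (rule C1_differentiable_imp_piecewise)
  qed
  have \<gamma>_nz: "\<gamma> s \<in> ball 0 R - {0}" for s
    using r_pos[OF c_le[of s]] by (simp add: \<gamma>_def norm_mult)
  \<comment> \<open>At equal parameters both loops have the same argument, so the segments joining
    them are radial and avoid \<open>0\<close>.\<close>
  have "homotopic_loops (ball 0 R - {0}) \<gamma> (circlepath 0 \<eta>)"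
  proof (rule homotopic_loops_linear)
    show "path \<gamma>"
      using \<gamma>_valid by (rule valid_path_imp_path)
    show "pathfinish \<gamma> = pathstart \<gamma>"
      by (simp add: pathfinish_def pathstart_def \<gamma>_def c_def)
  next
    fix s :: real assume "s \<in> {0..1}"
    have circ: "circlepath 0 \<eta> s = of_real \<eta> * cis (2 * pi * s)"
      by (simp add: circlepath cis_conv_exp mult_ac)
    show "closed_segment (\<gamma> s) (circlepath 0 \<eta> s) \<subseteq> ball 0 R - {0}"
    proof
      fix w assume "w \<in> closed_segment (\<gamma> s) (circlepath 0 \<eta> s)"
      then obtain u where u: "0 \<le> u" "u \<le> 1" "w = (1 - u) *\<^sub>R \<gamma> s + u *\<^sub>R circlepath 0 \<eta> s"
        by (auto simp: closed_segment_def)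
      define m where "m = (1 - u) * r (c s) + u * \<eta>"
      have w: "w = of_real m * cis (2 * pi * s)"
        unfolding u(3) circ \<gamma>_def m_def scaleR_conv_of_real by (simp add: algebra_simps)
      have "0 < m \<and> m < R"
        using convex_bound_lt[of "r (c s)" R \<eta> "1 - u" u] convex_bound_lt[of "- r (c s)" 0 "- \<eta>" "1 - u" u] r_pos[OF c_le[of s]] \<eta> u
        by (simp add: m_def)
      then show "w \<in> ball 0 R - {0}"
        by (simp add: w norm_mult)
    qed
  qed simp_all
  then have "contour_integral (circlepath 0 \<eta>) (\<lambda>g. K g ^ Suc k) = contour_integral \<gamma> (\<lambda>g. K g ^ Suc k)"
    by (intro Cauchy_theorem_homotopic_loops[symmetric] \<gamma>_valid)
       (auto intro!: holomorphic_intros K simp del: power_Suc)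
  also have "\<dots> = integral {0..1} (\<lambda>s. K (\<gamma> s) ^ Suc k * Complex (z' s) (y' s))"
    unfolding contour_integral_integral
    by (intro integral_cong) (simp add: vector_derivative_at[OF d\<gamma>])
  also have "\<dots> = integral {0..1} (\<lambda>s. of_real (X (c s) ^ Suc k) * Complex (z' s) (y' s))"
    unfolding \<gamma>_def c_def KX by simp
  finally have ci: "contour_integral (circlepath 0 \<eta>) (\<lambda>g. K g ^ Suc k) = \<dots>" .
  have int: "(\<lambda>s. of_real (X (c s) ^ Suc k) * Complex (z' s) (y' s)) integrable_on {0..1}"
    unfolding Complex_eq by (intro integrable_continuous_real continuous_intros cont)
  \<comment> \<open>\<open>K\<close> is real along the curve, so only the derivative of
    \<open>y\<close>, the imaginary part of \<open>\<gamma>\<close>, survives.\<close>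
  have "Im (contour_integral (circlepath 0 \<eta>) (\<lambda>g. K g ^ Suc k)) = integral {0..1} (\<lambda>s. X (c s) ^ Suc k * y' s)"
    unfolding ci using integral_linear[OF int bounded_linear_Im] by (simp add: o_def del: power_Suc)
  define I where "I = integral {X (-1)..X 1} (\<lambda>x. x ^ k * p x)"
  have F: "continuous_on {X (-1)..X 1} (\<lambda>x. x ^ k * p x)"
    by (intro continuous_intros continuous_on_subset[OF p(1)]) simp
  \<comment> \<open>A substitution rule that needs no monotonicity; on each half circle one of the
    two oriented integrals is over an empty or one-point interval.\<close>
  have J1: "((\<lambda>s. (X' (c s) * c' s) *\<^sub>R (X (c s) ^ k * p (X (c s)))) has_integral
      (integral {X (c a)..X (c b)} (\<lambda>x. x ^ k * p x) - integral {X (c b)..X (c a)} (\<lambda>x. x ^ k * p x))) {a..b}"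
    if "a \<le> b" for a b
  proof (rule has_integral_substitution_general[of "{}"])
    show "(\<lambda>s. X (c s)) ` {a..b} \<subseteq> {X (-1)..X 1}"
      using X_range[OF c_le] by blast
    show "((\<lambda>s. X (c s)) has_real_derivative X' (c s) * c' s) (at s within {a..b})" for s
      using dXc by (rule has_field_derivative_at_within)
  qed (use that F cont in auto)
  define G where "G s = X (c s) ^ k * X' (c s) * r (c s) * (sin (2 * pi * s))\<^sup>2" for s
  have sq: "sqrt (1 - (c s)\<^sup>2) = \<bar>sin (2 * pi * s)\<bar>" for s
    by (simp add: c_def flip: sin_squared_eq)
  have p_c: "p (X (c s)) = r (c s) * \<bar>sin (2 * pi * s)\<bar> / pi" for s
    using p(2)[OF c_le] sq by simp
  have deg: "integral {X 1..X (-1)} (\<lambda>x. x ^ k * p x) = 0"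
    using X_mono by (cases "X (-1) = X 1") auto
  have c_vals: "c 0 = 1" "c (1/2) = -1" "c 1 = 1"
    by (simp_all add: c_def)
  \<comment> \<open>The upper half circle sweeps the interval from right to left with
    \<open>sin \<ge> 0\<close>, the lower half from left to right with \<open>sin \<le> 0\<close>.
    Direction and the sign in \<open>\<bar>sin\<bar>\<close> compensate, so each half contributes
    \<open>I / 2\<close> to the integral of \<open>G\<close>.\<close>
  have "((\<lambda>s. - 2 * G s) has_integral - I) {0..1/2}"
  proof (rule has_integral_eq[rotated])
    show "((\<lambda>s. (X' (c s) * c' s) *\<^sub>R (X (c s) ^ k * p (X (c s)))) has_integral - I) {0..1/2}"
      using J1[of 0 "1/2"] by (simp add: c_vals deg I_def)
    fix s :: real assume "s \<in> {0..1/2}"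
    then have "sin (2 * pi * s) \<ge> 0"
      by (intro sin_ge_zero) (auto simp: field_simps)
    then show "(X' (c s) * c' s) *\<^sub>R (X (c s) ^ k * p (X (c s))) = - 2 * G s"
      by (simp add: p_c c'_def G_def power2_eq_square)
  qed
  moreover have "((\<lambda>s. 2 * G s) has_integral I) {1/2..1}"
  proof (rule has_integral_eq[rotated])
    show "((\<lambda>s. (X' (c s) * c' s) *\<^sub>R (X (c s) ^ k * p (X (c s)))) has_integral I) {1/2..1}"
      using J1[of "1/2" 1] by (simp add: c_vals deg I_def)
    fix s :: real assume "s \<in> {1/2..1}"
    then have "sin (2 * pi * s) \<le> 0"
      using sin_ge_zero[of "2 * pi * s - pi"] by (auto simp: field_simps sin_diff)
    then show "(X' (c s) * c' s) *\<^sub>R (X (c s) ^ k * p (X (c s))) = 2 * G s"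
      by (simp add: p_c c'_def G_def power2_eq_square abs_of_nonpos)
  qed
  ultimately have "(G has_integral I / 2) {0..1/2}" "(G has_integral I / 2) {1/2..1}"
    using has_integral_mult_right[of "\<lambda>s. - 2 * G s" "- I" "{0..1/2}" "-1/2"]
      has_integral_mult_right[of "\<lambda>s. 2 * G s" I "{1/2..1}" "1/2"] by simp_all
  then have GI: "(G has_integral I) {0..1}"
    using has_integral_combine[of 0 "1/2" 1 G "I/2" "I/2"] by simp
  \<comment> \<open>Integration by parts; the boundary terms vanish because \<open>y\<close> is zero
    at the parameters \<open>0\<close> and \<open>1\<close>.\<close>
  have "((\<lambda>s. X (c s) ^ Suc k * y' s + (of_nat (Suc k) * X (c s) ^ k * (X' (c s) * c' s)) * y s) has_integral
      (X (c 1) ^ Suc k * y 1 - X (c 0) ^ Suc k * y 0)) {0..1}"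
  proof (rule fundamental_theorem_of_calculus)
    fix s :: real
    have "((\<lambda>s. X (c s) ^ Suc k * y s) has_real_derivative
       X (c s) ^ Suc k * y' s + (of_nat (Suc k) * X (c s) ^ k * (X' (c s) * c' s)) * y s) (at s)"
      using DERIV_mult[OF DERIV_power_Suc[OF dXc[of s], of k] dy[of s]] by (simp add: mult_ac add_ac)
    then show "((\<lambda>s. X (c s) ^ Suc k * y s) has_vector_derivative
       X (c s) ^ Suc k * y' s + (of_nat (Suc k) * X (c s) ^ k * (X' (c s) * c' s)) * y s) (at s within {0..1})"
      by (simp add: has_real_derivative_iff_has_vector_derivative has_vector_derivative_at_within)
  qed simp
  moreover have "(of_nat (Suc k) * X (c s) ^ k * (X' (c s) * c' s)) * y s = - (2 * pi * Suc k) * G s" for s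
    by (simp add: c'_def G_def y_def power2_eq_square)
  ultimately have "((\<lambda>s. X (c s) ^ Suc k * y' s + (- (2 * pi * Suc k)) * G s) has_integral 0) {0..1}"
    by (simp only:) (simp add: y_def)
  from has_integral_add[OF this has_integral_mult_right[OF GI, of "2 * pi * Suc k"]]
  have "((\<lambda>s. X (c s) ^ Suc k * y' s) has_integral 2 * pi * Suc k * I) {0..1}"
    by simp
  then have "integral {0..1} (\<lambda>s. X (c s) ^ Suc k * y' s) = 2 * pi * Suc k * I"
    by (rule integral_unique)
  with \<open>Im _ = _\<close> show ?thesis
    by (simp only: I_def)
qed

section \<open>From moments to a density\<close>

lemma moment_0: "real_distribution \<mu> \<Longrightarrow> moment \<mu> 0 = 1"
  by (simp add: moment_def real_distribution_def prob_space.prob_space)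

text \<open>Lagrange inversion for \<open>z M(z)\<close>, whose inverse is
  \<open>z / (1 + n z R(z))\<close>. The moment relation holds over the complex numbers and descends
  to real coefficients by injectivity of \<open>fps_complex\<close>.\<close>

lemma free_convolution_power_moments:
  assumes conv: "is_free_convolution_power \<mu> n \<nu>" and \<mu>: "real_distribution \<mu>"
  defines "\<rho> \<equiv> r_transform (Abs_fps (moment \<mu>))"
  shows "real (Suc k) * moment \<nu> k = ((1 + of_nat n * fps_X * \<rho>) ^ Suc k) $ k"
proof -
  define m M where "m = Abs_fps (moment \<mu>)" and "M = Abs_fps (moment \<nu>)"
  have m0: "m $ 0 = 1"
    using moment_0[OF \<mu>] by (simp add: m_def)
  define q where "q = of_nat n - (of_nat n - 1) * inverse m"
  from conv obtain \<phi> :: "free_algebra \<Rightarrow> complex" and X where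
    ncps: "nc_prob_space free_algebra_scale \<phi>" and
    free: "nc_prob_space.free_family free_algebra_scale \<phi> X {..<n}" and
    X: "\<forall>i<n. has_distribution \<phi> (X i) \<mu>" and S: "has_distribution \<phi> (\<Sum>i<n. X i) \<nu>"
    unfolding is_free_convolution_power_def by blast
  interpret nc_prob_space free_algebra_scale \<phi>
    by (rule ncps)
  have q: "fps_complex q = of_nat n - (of_nat n - 1) * inverse (fps_complex m)"
    using m0 by (simp add: q_def fps_complex_diff fps_complex_mult fps_complex_inverse)
  have q0: "q $ 0 = 1"
    using m0 by (simp add: q_def fps_mult_nth)
  have "Abs_fps (\<lambda>k. \<phi> ((\<Sum>i<n. X i) ^ k)) = fps_complex M"
    using S by (simp add: has_distribution_def M_def fps_complex_def)
  moreover have "Abs_fps (\<lambda>k. \<phi> ((\<Sum>i<n. X i) ^ k)) oo (fps_X * inverse (fps_complex q)) = fps_complex q * fps_complex m"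
    unfolding q
  proof (rule free_sum_moments[OF free])
    show "\<phi> (X i ^ k) = fps_complex m $ k" if "i < n" for i k
      using X that by (simp add: has_distribution_def m_def)
  qed (simp add: m0)
  ultimately have "fps_complex (M oo (fps_X * inverse q)) = fps_complex (q * m)"
    using q0 by (simp add: fps_complex_compose fps_complex_mult fps_complex_inverse)
  then have "M oo (fps_X * inverse q) = q * m"
    by (simp add: fps_complex_eq_iff)
  from r_transform_inverse[OF m0 this[unfolded q_def]]
  have "(fps_X * M) oo (fps_X * inverse (1 + of_nat n * fps_X * \<rho>)) = fps_X"
    by (simp add: \<rho>_def m_def)
  from lagrange_inversion[OF _ this, of k] show ?thesis
    by (simp add: M_def del: power_Suc of_nat_Suc)
qed

lemma (in real_distribution) bounded_moments:
  assumes "AE x in M. \<bar>x\<bar> \<le> L"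
  shows "integrable M (\<lambda>x. x ^ k)" "expectation (\<lambda>x. \<bar>x\<bar> ^ k) \<le> L ^ k"
proof -
  have ae: "AE x in M. \<bar>x\<bar> ^ k \<le> L ^ k"
    using assms by eventually_elim (simp add: power_mono)
  then show i: "integrable M (\<lambda>x. x ^ k)"
    by (intro integrable_const_bound[of _ "L ^ k"]) (auto simp: power_abs)
  have "expectation (\<lambda>x. \<bar>x\<bar> ^ k) \<le> expectation (\<lambda>x. L ^ k)"
    using ae integrable_abs[OF i] by (intro integral_mono_AE) (auto simp: power_abs)
  then show "expectation (\<lambda>x. \<bar>x\<bar> ^ k) \<le> L ^ k"
    using prob_space by simp
qed

text \<open>On bounded support the Taylor remainder is at most
  \<open>2 (\<bar>t\<bar> L)^n / n!\<close>, so the moments determine the characteristic function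
  everywhere.\<close>

lemma (in real_distribution) char_moment_series:
  assumes "AE x in M. \<bar>x\<bar> \<le> L"
  shows "(\<lambda>n. \<Sum>k\<le>n. (\<i> * t) ^ k / fact k * moment M k) \<longlonglongrightarrow> char M t"
proof -
  have "(\<lambda>n. inverse (fact n) * (\<bar>t\<bar> * L) ^ n) \<longlonglongrightarrow> 0"
    using summable_LIMSEQ_zero[OF summable_exp[of "\<bar>t\<bar> * L"]] by simp
  then have lim: "(\<lambda>n. 2 * (inverse (fact n) * (\<bar>t\<bar> * L) ^ n)) \<longlonglongrightarrow> 0"
    by (rule tendsto_mult_right_zero)
  have "norm (char M t - (\<Sum>k\<le>n. (\<i> * t) ^ k / fact k * moment M k)) \<le> 2 * (inverse (fact n) * (\<bar>t\<bar> * L) ^ n)" for n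
  proof -
    have "norm (char M t - (\<Sum>k\<le>n. (\<i> * t) ^ k / fact k * moment M k)) \<le>
        (2 * \<bar>t\<bar> ^ n / fact n) * expectation (\<lambda>x. \<bar>x\<bar> ^ n)"
      unfolding moment_def by (intro char_approx1 bounded_moments[OF assms])
    also have "\<dots> \<le> (2 * \<bar>t\<bar> ^ n / fact n) * L ^ n"
      by (intro mult_left_mono bounded_moments[OF assms]) simp
    finally show ?thesis
      by (simp add: power_mult_distrib field_simps)
  qed
  then have "(\<lambda>n. char M t - (\<Sum>k\<le>n. (\<i> * t) ^ k / fact k * moment M k)) \<longlonglongrightarrow> 0"
    by (intro Lim_null_comparison[OF _ lim] always_eventually) blast
  then have "(\<lambda>n. char M t - (char M t - (\<Sum>k\<le>n. (\<i> * t) ^ k / fact k * moment M k))) \<longlonglongrightarrow> char M t - 0"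
    by (intro tendsto_diff tendsto_const)
  then show ?thesis
    by simp
qed

lemma moments_determine_distribution:
  assumes "real_distribution M" "real_distribution N"
    and "AE x in M. \<bar>x\<bar> \<le> L" "AE x in N. \<bar>x\<bar> \<le> L"
    and "\<And>k. moment M k = moment N k"
  shows "M = N"
proof (rule Levy_uniqueness[OF assms(1,2)], rule ext)
  fix t
  show "char M t = char N t"
    using real_distribution.char_moment_series[OF assms(1,3), of t]
      real_distribution.char_moment_series[OF assms(2,4), of t] assms(5)
    by (simp add: LIMSEQ_unique)
qed

lemma compactly_supported_AE:
  assumes "real_distribution M" "compactly_supported M"
  shows "\<exists>L. AE x in M. \<bar>x\<bar> \<le> L"
proof -
  interpret real_distribution M by fact
  obtain K where K: "compact K" "emeasure M (- K) = 0"
    using assms(2) by (auto simp: compactly_supported_def)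
  then obtain L where L: "\<And>x. x \<in> K \<Longrightarrow> \<bar>x\<bar> \<le> L"
    using compact_imp_bounded bounded_iff by (metis real_norm_def)
  have "AE x in M. x \<notin> - K"
    using K compact_imp_closed[OF K(1)] by (intro AE_not_in null_setsI) auto
  then show ?thesis
    using L by (intro exI[of _ L]) (auto elim: eventually_mono)
qed

text \<open>That \<open>p\<close> integrates to one is not assumed; it is the moment identity for
  \<open>k = 0\<close>. Two laws on a common bounded interval with equal moments then
  coincide.\<close>

lemma distribution_eq_density:
  assumes N: "real_distribution N" "AE x in N. \<bar>x\<bar> \<le> L"
    and p: "continuous_on UNIV p" "\<And>x. 0 \<le> p x" "\<And>x. x \<notin> {a..b} \<Longrightarrow> p x = 0"
    and moments: "\<And>k. moment N k = integral {a..b} (\<lambda>x. x ^ k * p x)"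
  shows "N = density lborel (\<lambda>x. ennreal (p x))"
proof -
  have p_meas [measurable]: "p \<in> borel_measurable borel"
    by (rule borel_measurable_continuous_onI[OF p(1)])
  let ?D = "density lborel (\<lambda>x. ennreal (p x))"
  have supp: "indicator {a..b} x *\<^sub>R (x ^ k * p x) = x ^ k * p x" for k x
    using p(3)[of x] by (cases "x \<in> {a..b}") auto
  have si: "set_integrable lborel {a..b} (\<lambda>x. x ^ k * p x)" for k
    by (intro borel_integrable_atLeastAtMost' continuous_intros continuous_on_subset[OF p(1)]) simp
  have int: "integrable lborel (\<lambda>x. x ^ k * p x)" for k
    using si[of k] unfolding set_integrable_def supp .
  have val: "(LINT x|lborel. x ^ k * p x) = moment N k" for k
    using set_borel_integral_eq_integral(2)[OF si[of k]] unfolding set_lebesgue_integral_def supp moments .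
  have "emeasure ?D (space ?D) = (\<integral>\<^sup>+ x. ennreal (p x) \<partial>lborel)"
    by (simp add: emeasure_density)
  also have "\<dots> = ennreal (LINT x|lborel. p x)"
    using int[of 0] p(2) by (intro nn_integral_eq_integral) auto
  also have "\<dots> = 1"
    using val[of 0] moment_0[OF N(1)] by simp
  finally have D: "real_distribution ?D"
    unfolding real_distribution_def real_distribution_axioms_def by (auto intro: prob_spaceI)
  define L' where "L' = Max {\<bar>L\<bar>, \<bar>a\<bar>, \<bar>b\<bar>}"
  show ?thesis
  proof (rule moments_determine_distribution[OF N(1) D])
    show "AE x in N. \<bar>x\<bar> \<le> L'"
      using N(2) by eventually_elim (auto simp: L'_def)
    have "\<bar>x\<bar> \<le> L'" if "p x \<noteq> 0" for x
    proof -
      have "x \<in> {a..b}"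
        using p(3)[of x] that by blast
      then show ?thesis
        by (auto simp: L'_def)
    qed
    then show "AE x in ?D. \<bar>x\<bar> \<le> L'"
      by (subst AE_density) (auto simp: ennreal_eq_0_iff intro!: AE_I2)
    have "moment ?D k = (LINT x|lborel. p x *\<^sub>R x ^ k)" for k
      unfolding moment_def using p(2) by (intro integral_density) auto
    then show "moment N k = moment ?D k" for k
      by (simp add: val[symmetric] mult.commute)
  qed
qed

text \<open>\<open>X\<close> is a strictly increasing homeomorphism of \<open>[-1, 1]\<close> onto
  its image, so the density may be prescribed in the coordinate \<open>c\<close> and transported.
  The factor \<open>sqrt (1 - c^2)\<close> vanishes at both ends and makes the extension by zero
  continuous.\<close>

lemma parametrized_density:
  fixes r X X' :: "real \<Rightarrow> real"
  assumes r: "continuous_on {-1..1} r" "\<And>c. \<bar>c\<bar> \<le> 1 \<Longrightarrow> 0 < r c \<and> r c \<le> R"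
    and X: "\<And>c. \<bar>c\<bar> \<le> 1 \<Longrightarrow> (X has_real_derivative X' c) (at c)" "\<And>c. \<bar>c\<bar> \<le> 1 \<Longrightarrow> 0 < X' c"
  shows "X (-1) < X 1" "X ` {-1..1} = {X (-1)..X 1}"
    "\<exists>p. continuous_on UNIV p \<and> (\<forall>x. 0 \<le> p x \<and> p x \<le> R / pi) \<and> (\<forall>x. x \<notin> {X (-1)..X 1} \<longrightarrow> p x = 0) \<and>
       (\<forall>c. \<bar>c\<bar> \<le> 1 \<longrightarrow> p (X c) = r c * sqrt (1 - c\<^sup>2) / pi)"
proof -
  have mono: "X c < X d" if "-1 \<le> c" "c < d" "d \<le> 1" for c d
  proof (rule DERIV_pos_imp_increasing[OF that(2)])
    fix x assume "c \<le> x" "x \<le> d"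
    with that have "\<bar>x\<bar> \<le> 1" by auto
    with X show "\<exists>y. (X has_real_derivative y) (at x) \<and> 0 < y"
      by blast
  qed
  then show lt: "X (-1) < X 1"
    by simp
  have cont_X: "continuous_on {-1..1} X"
    using X(1) by (auto intro!: DERIV_atLeastAtMost_imp_continuous_on simp: abs_le_iff)
  show image: "X ` {-1..1} = {X (-1)..X 1}"
  proof
    have "X (-1) \<le> X c \<and> X c \<le> X 1" if "c \<in> {-1..1}" for c
      using mono[of "-1" c] mono[of c 1] that by (cases "c = -1"; cases "c = 1") auto
    then show "X ` {-1..1} \<subseteq> {X (-1)..X 1}"
      by auto
    show "{X (-1)..X 1} \<subseteq> X ` {-1..1}"
      using IVT'[of X "-1" _ 1] cont_X by fastforce
  qed
  have inj: "inj_on X {-1..1}"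
    by (rule linorder_inj_onI) (use mono in force)+
  define Y where "Y = the_inv_into {-1..1} X"
  have YX: "Y (X c) = c" if "c \<in> {-1..1}" for c
    unfolding Y_def using that by (rule the_inv_into_f_f[OF inj])
  have Y: "continuous_on {X (-1)..X 1} Y"
    unfolding image[symmetric] by (rule continuous_on_inv[OF cont_X]) (use YX in auto)
  have Y_range: "Y x \<in> {-1..1}" if "x \<in> {X (-1)..X 1}" for x
    using that YX unfolding image[symmetric] by auto
  \<comment> \<open>Clamping to the interval makes the inverse total and continuous; outside, it
    takes the endpoint values \<open>c = 1\<close> or \<open>c = -1\<close>, where the square root
    is zero.\<close>
  define clip where "clip x = max (X (-1)) (min (X 1) x)" for x
  have clip: "clip x \<in> {X (-1)..X 1}" for x
    using lt by (auto simp: clip_def)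
  have cont_clip: "continuous_on UNIV clip"
    unfolding clip_def by (intro continuous_intros)
  have cont_Y: "continuous_on UNIV (\<lambda>x. Y (clip x))"
    by (rule continuous_on_compose2[OF Y cont_clip]) (use clip in blast)
  define p where "p x = r (Y (clip x)) * sqrt (1 - (Y (clip x))\<^sup>2) / pi" for x
  have Yc: "\<bar>Y (clip x)\<bar> \<le> 1" for x
    using Y_range[OF clip[of x]] by auto
  show "\<exists>p. continuous_on UNIV p \<and> (\<forall>x. 0 \<le> p x \<and> p x \<le> R / pi) \<and> (\<forall>x. x \<notin> {X (-1)..X 1} \<longrightarrow> p x = 0) \<and>
       (\<forall>c. \<bar>c\<bar> \<le> 1 \<longrightarrow> p (X c) = r c * sqrt (1 - c\<^sup>2) / pi)"
  proof (intro exI[of _ p] conjI allI impI)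
    have "continuous_on UNIV (\<lambda>x. r (Y (clip x)))"
      by (rule continuous_on_compose2[OF r(1) cont_Y]) (use Y_range[OF clip] in blast)
    then show "continuous_on UNIV p"
      unfolding p_def by (intro continuous_intros cont_Y) auto
    have sq: "(Y (clip x))\<^sup>2 \<le> 1" for x
      using Yc[of x] by (simp add: abs_square_le_1)
    show "0 \<le> p x" for x
      using r(2)[OF Yc[of x]] sq[of x] by (simp add: p_def)
    have "r (Y (clip x)) * sqrt (1 - (Y (clip x))\<^sup>2) \<le> R * 1" for x
      using r(2)[OF Yc[of x]] sq[of x] by (intro mult_mono) auto
    then show "p x \<le> R / pi" for x
      by (simp add: p_def divide_right_mono)
    show "p x = 0" if "x \<notin> {X (-1)..X 1}" for x
    proof -
      have "clip x = X 1 \<or> clip x = X (-1)"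
        using that lt by (auto simp: clip_def)
      then show ?thesis
        using YX[of 1] YX[of "-1"] by (auto simp: p_def)
    qed
    fix c :: real assume "\<bar>c\<bar> \<le> 1"
    then have c: "c \<in> {-1..1}" by auto
    then have "X c \<in> {X (-1)..X 1}"
      using image by blast
    then have "clip (X c) = X c"
      by (simp add: clip_def)
    then show "p (X c) = r c * sqrt (1 - c\<^sup>2) / pi"
      using YX[OF c] by (simp add: p_def)
  qed
qed

section \<open>The density of the normalized free sum\<close>

context free_clt_coeffs
begin

text \<open>\<open>K(g) = f(g) / g\<close> with \<open>f\<close> holomorphic, so the residue of
  \<open>K ^ Suc k\<close> is the Taylor coefficient of \<open>f ^ Suc k\<close> at
  \<open>k\<close>. Because \<open>1 / t = n t\<close>, \<open>f(g)\<close> is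
  \<open>1 + n z R(z)\<close> at \<open>z = t g\<close>, whence the factor
  \<open>t ^ k\<close>.\<close>

lemma level_circle_integral:
  assumes t: "0 < t" "t \<le> t0" and n: "real n * t\<^sup>2 = 1"
  shows "contour_integral (circlepath 0 1) (\<lambda>g. level t g ^ Suc k) =
    2 * pi * \<i> * of_real (t ^ k * ((1 + of_nat n * fps_X * Abs_fps \<rho>) ^ Suc k) $ k)"
proof -
  define \<rho>c where "\<rho>c = fps_complex (Abs_fps \<rho>)"
  define H where "H = 1 + of_nat n * fps_X * \<rho>c"
  define T where "T = fps_const (of_real t) * (fps_X :: complex fps)"
  define f where "f g = 1 + g * (eval_fps \<rho>c (of_real t * g) / of_real t)" for g
  have T0: "T $ 0 = 0"
    by (simp add: T_def)
  have \<rho>c: "eval_fps \<rho>c has_fps_expansion \<rho>c"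
  proof (rule eval_fps_has_fps_expansion)
    have "0 < ereal (1 / (2 * B))"
      using B_pos by simp
    also note fps_conv_radius_\<rho>
    finally show "0 < fps_conv_radius \<rho>c"
      by (simp add: \<rho>c_def)
  qed
  have "(\<lambda>g. of_real t * g) has_fps_expansion T"
    unfolding T_def by (intro fps_expansion_intros)
  from has_fps_expansion_compose[OF \<rho>c this T0]
  have ev: "(\<lambda>g. eval_fps \<rho>c (of_real t * g)) has_fps_expansion (\<rho>c oo T)"
    by (simp add: o_def)
  have "(\<lambda>g. 1 + g * (eval_fps \<rho>c (of_real t * g) * of_real (1 / t))) has_fps_expansion
      1 + fps_X * ((\<rho>c oo T) * fps_const (of_real (1 / t)))"
    by (intro fps_expansion_intros ev)
  also have "1 + fps_X * ((\<rho>c oo T) * fps_const (of_real (1 / t))) = H oo T"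
  proof -
    have "of_real (1 / t) = complex_of_real (real n * t)"
    proof -
      have "1 / t = real n * t"
        using n t by (simp add: power2_eq_square field_simps)
      then show ?thesis by simp
    qed
    then have "fps_const (of_real (1 / t)) = of_nat n * fps_const (complex_of_real t)"
      by (simp flip: fps_of_nat)
    moreover have "of_nat n oo T = of_nat n" "1 oo T = 1"
      using fps_const_compose[of 1 T] by (simp_all flip: fps_of_nat)
    ultimately show ?thesis
      using T0 by (simp add: H_def fps_compose_add_distrib fps_compose_mult_distrib) (simp add: T_def mult_ac)
  qed
  finally have f: "f has_fps_expansion (H oo T)"
    by (simp add: f_def[abs_def])
  then have "(\<lambda>g. f g ^ Suc k) has_fps_expansion (H oo T) ^ Suc k"
    by (intro fps_expansion_intros)
  moreover have "(H oo T) ^ Suc k = H ^ Suc k oo T"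
    by (rule fps_compose_power[OF T0])
  ultimately have fk: "(\<lambda>g. f g ^ Suc k) has_fps_expansion (H ^ Suc k oo T)"
    by simp
  have coeff: "(H ^ Suc k oo T) $ k = of_real (t ^ k * ((1 + of_nat n * fps_X * Abs_fps \<rho>) ^ Suc k) $ k)"
  proof -
    have "H = fps_complex (1 + of_nat n * fps_X * Abs_fps \<rho>)"
      by (rule fps_ext) (simp add: H_def \<rho>c_def flip: fps_complex_of_nat fps_complex_X fps_complex_mult)
    then have "H ^ Suc k = fps_complex ((1 + of_nat n * fps_X * Abs_fps \<rho>) ^ Suc k)"
      by (simp only: fps_complex_power)
    then show ?thesis
      by (simp add: T_def fps_compose_linear del: power_Suc)
  qed
  have f_holo: "(\<lambda>g. f g ^ Suc k) holomorphic_on ball 0 2"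
    unfolding f_def \<rho>c_def using t by (intro holomorphic_intros eval_\<rho>_holomorphic[OF t]) auto
  have "((\<lambda>g. f g ^ Suc k / (g - 0) ^ Suc k) has_contour_integral
      (2 * pi * \<i> / fact k * (deriv ^^ k) (\<lambda>g. f g ^ Suc k) 0)) (circlepath 0 1)"
  proof (rule Cauchy_has_contour_integral_higher_derivative_circlepath)
    show "continuous_on (cball 0 1) (\<lambda>g. f g ^ Suc k)"
      using f_holo by (intro holomorphic_on_imp_continuous_on) (auto elim!: holomorphic_on_subset)
    show "(\<lambda>g. f g ^ Suc k) holomorphic_on ball 0 1"
      using f_holo by (rule holomorphic_on_subset) auto
  qed simp
  then have 1: "contour_integral (circlepath 0 1) (\<lambda>g. f g ^ Suc k / (g - 0) ^ Suc k) =
      2 * pi * \<i> * (H ^ Suc k oo T) $ k"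
    using fps_nth_fps_expansion[OF fk, of k] by (simp add: contour_integral_unique del: power_Suc)
  have "contour_integral (circlepath 0 1) (\<lambda>g. level t g ^ Suc k) =
      contour_integral (circlepath 0 1) (\<lambda>g. f g ^ Suc k / (g - 0) ^ Suc k)"
  proof (rule contour_integral_eq)
    fix g :: complex assume "g \<in> path_image (circlepath 0 1)"
    then have "g \<noteq> 0" by auto
    then have "level t g = f g / g"
      by (simp add: level_def f_def \<rho>c_def add_divide_distrib)
    then show "level t g ^ Suc k = f g ^ Suc k / (g - 0) ^ Suc k"
      by (simp add: power_divide)
  qed
  with 1 coeff show ?thesis
    by simp
qed

text \<open>The moments follow by equating the imaginary parts of the integral of
  \<open>K ^ Suc k\<close> over the unit circle and over the curve. The bound \<open>2\<close> comes
  from \<open>r \<le> 5/4\<close>, which gives \<open>p \<le> 5 / (4 * pi)\<close>.\<close>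

lemma free_clt_density:
  assumes t: "0 < t" "t \<le> t0" and n: "real n * t\<^sup>2 = 1"
  defines "X \<equiv> real_abscissa t" and "r \<equiv> real_radius t"
  shows "X (-1) < X 1" "X ` {-1..1} = {X (-1)..X 1}"
    "\<exists>p. continuous_on UNIV p \<and> (\<forall>x. 0 \<le> p x \<and> p x \<le> 2) \<and> (\<forall>x. x \<notin> {X (-1)..X 1} \<longrightarrow> p x = 0) \<and>
       (\<forall>c. \<bar>c\<bar> \<le> 1 \<longrightarrow> p (X c) = r c * sqrt (1 - c\<^sup>2) / pi) \<and>
       (\<forall>k. real (Suc k) * integral {X (-1)..X 1} (\<lambda>x. x ^ k * p x) =
          t ^ k * ((1 + of_nat n * fps_X * Abs_fps \<rho>) ^ Suc k) $ k)"
proof -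
  have less: "\<bar>c\<bar> < 3/2" if "\<bar>c\<bar> \<le> 1" for c :: real
    using that by linarith
  have r_bounds: "0 < r c \<and> r c \<le> 5/4" if "\<bar>c\<bar> \<le> 1" for c
  proof -
    have "\<bar>1 - r c\<bar> \<le> 1/4"
      using real_radius_cball[OF t less[OF that]] unfolding r_def by (simp add: dist_norm)
    then show ?thesis by linarith
  qed
  have dr: "(r has_real_derivative Re (deriv (radius t) (of_real c))) (at c)" if "\<bar>c\<bar> \<le> 1" for c
    unfolding r_def by (rule radius_DERIV[OF t less[OF that]])
  have dX: "(X has_real_derivative abscissa' t c) (at c)" if "\<bar>c\<bar> \<le> 1" for c
    unfolding X_def by (rule abscissa_DERIV[OF t less[OF that]])
  have X'_pos: "0 < abscissa' t c" if "\<bar>c\<bar> \<le> 1" for c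
    using abscissa'_ge_1[OF t that] by linarith
  have cont_r: "continuous_on {-1..1} r"
    using dr by (auto intro!: DERIV_atLeastAtMost_imp_continuous_on simp: abs_le_iff)
  note dens = parametrized_density[OF cont_r r_bounds dX X'_pos]
  show lt: "X (-1) < X 1"
    by (rule dens(1))
  show image: "X ` {-1..1} = {X (-1)..X 1}"
    by (rule dens(2))
  obtain p where p: "continuous_on UNIV p" "\<And>x. 0 \<le> p x" "\<And>x. p x \<le> 5/4 / pi" "\<And>x. x \<notin> {X (-1)..X 1} \<Longrightarrow> p x = 0"
    "\<And>c. \<bar>c\<bar> \<le> 1 \<Longrightarrow> p (X c) = r c * sqrt (1 - c\<^sup>2) / pi"
    using dens(3) by blast
  have "5/4 / pi \<le> 2"
    using pi_gt3 by (simp add: field_simps)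
  with p(3) have p_le: "p x \<le> 2" for x
    by (meson order_trans)
  have moments: "real (Suc k) * integral {X (-1)..X 1} (\<lambda>x. x ^ k * p x) =
          t ^ k * ((1 + of_nat n * fps_X * Abs_fps \<rho>) ^ Suc k) $ k" for k
  proof -
    have "Im (contour_integral (circlepath 0 1) (\<lambda>g. level t g ^ Suc k)) =
        2 * pi * Suc k * integral {X (-1)..X 1} (\<lambda>x. x ^ k * p x)"
    proof (rule curve_moment[OF dr _ dX])
      show "continuous_on {-1..1} (\<lambda>c. Re (deriv (radius t) (of_real c)))" "continuous_on {-1..1} (abscissa' t)"
        by (rule continuous_derivs[OF t])+
      show "X c \<in> {X (-1)..X 1}" if "\<bar>c\<bar> \<le> 1" for c
        using image that by (metis abs_le_iff atLeastAtMost_iff imageI minus_le_iff)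
      show "0 < r c \<and> r c < 2" if "\<bar>c\<bar> \<le> 1" for c
        using r_bounds[OF that] by linarith
      show "level t (of_real (r (cos \<theta>)) * cis \<theta>) = of_real (X (cos \<theta>))" for \<theta>
        unfolding r_def X_def by (rule level_curve[OF t])
    qed (use lt p level_holomorphic[OF t] in auto)
    then have "2 * pi * (real (Suc k) * integral {X (-1)..X 1} (\<lambda>x. x ^ k * p x)) =
      2 * pi * (t ^ k * ((1 + of_nat n * fps_X * Abs_fps \<rho>) ^ Suc k) $ k)"
      unfolding level_circle_integral[OF t n] by (simp del: power_Suc of_nat_Suc)
    then show ?thesis
      by (simp del: power_Suc of_nat_Suc)
  qed
  show "\<exists>p. continuous_on UNIV p \<and> (\<forall>x. 0 \<le> p x \<and> p x \<le> 2) \<and> (\<forall>x. x \<notin> {X (-1)..X 1} \<longrightarrow> p x = 0) \<and>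
       (\<forall>c. \<bar>c\<bar> \<le> 1 \<longrightarrow> p (X c) = r c * sqrt (1 - c\<^sup>2) / pi) \<and>
       (\<forall>k. real (Suc k) * integral {X (-1)..X 1} (\<lambda>x. x ^ k * p x) =
          t ^ k * ((1 + of_nat n * fps_X * Abs_fps \<rho>) ^ Suc k) $ k)"
    using p(1,2,4,5) p_le moments by (intro exI[of _ p]) (simp del: power_Suc of_nat_Suc)
qed

end

section \<open>Expansions to third order\<close>

text \<open>
  Expansions in \<open>t\<close> modulo \<open>O(t\<^sup>3)\<close>, uniform in \<open>c\<close>. They multiply like truncated polynomials, so that the
  asymptotic identities below reduce to polynomial identities in \<open>c\<close>.
\<close>

definition jet :: "(real \<Rightarrow> real \<Rightarrow> real) \<Rightarrow> (real \<Rightarrow> real) \<Rightarrow> (real \<Rightarrow> real) \<Rightarrow> (real \<Rightarrow> real) \<Rightarrow> bool" where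
  "jet f f0 f1 f2 \<longleftrightarrow> continuous_on {-1..1} f0 \<and> continuous_on {-1..1} f1 \<and> continuous_on {-1..1} f2 \<and>
     (\<exists>C. \<forall>\<^sub>F t in at_right 0. \<forall>c\<in>{-1..1}. \<bar>f t c - (f0 c + f1 c * t + f2 c * t\<^sup>2)\<bar> \<le> C * t ^ 3)"

lemma jetI:
  assumes "continuous_on {-1..1} f0" "continuous_on {-1..1} f1" "continuous_on {-1..1} f2"
    "\<forall>\<^sub>F t in at_right 0. \<forall>c\<in>{-1..1}. \<bar>f t c - (f0 c + f1 c * t + f2 c * t\<^sup>2)\<bar> \<le> C * t ^ 3"
  shows "jet f f0 f1 f2"
  using assms unfolding jet_def by blast

lemma jetE:
  assumes "jet f f0 f1 f2"
  obtains C where "C \<ge> 0" "\<forall>\<^sub>F t in at_right 0. \<forall>c\<in>{-1..1}. \<bar>f t c - (f0 c + f1 c * t + f2 c * t\<^sup>2)\<bar> \<le> C * t ^ 3"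
proof -
  from assms obtain C where C: "\<forall>\<^sub>F t in at_right 0. \<forall>c\<in>{-1..1}. \<bar>f t c - (f0 c + f1 c * t + f2 c * t\<^sup>2)\<bar> \<le> C * t ^ 3"
    by (auto simp: jet_def)
  have "\<forall>\<^sub>F t in at_right 0. \<forall>c\<in>{-1..1}. \<bar>f t c - (f0 c + f1 c * t + f2 c * t\<^sup>2)\<bar> \<le> \<bar>C\<bar> * t ^ 3"
    using C eventually_at_right_less[of 0]
  proof eventually_elim
    case (elim t)
    have "C * t ^ 3 \<le> \<bar>C\<bar> * t ^ 3"
      using elim(2) by (intro mult_right_mono) auto
    with elim(1) show ?case
      by (meson order_trans)
  qed
  then show ?thesis
    by (intro that[of "\<bar>C\<bar>"]) auto
qed

lemma jet_bounded:
  assumes "jet f f0 f1 f2"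
  obtains B where "B \<ge> 0" "\<And>c. c \<in> {-1..1} \<Longrightarrow> \<bar>f0 c\<bar> \<le> B \<and> \<bar>f1 c\<bar> \<le> B \<and> \<bar>f2 c\<bar> \<le> B"
proof -
  have "compact ((\<lambda>c. \<bar>f0 c\<bar> + \<bar>f1 c\<bar> + \<bar>f2 c\<bar>) ` {-1..1})"
    using assms by (intro compact_continuous_image continuous_intros) (auto simp: jet_def)
  from compact_imp_bounded[OF this] obtain B where "\<forall>c\<in>{-1..1}. \<bar>f0 c\<bar> + \<bar>f1 c\<bar> + \<bar>f2 c\<bar> \<le> B"
    unfolding bounded_iff by auto
  then have B: "\<And>c. c \<in> {-1..1} \<Longrightarrow> \<bar>f0 c\<bar> + \<bar>f1 c\<bar> + \<bar>f2 c\<bar> \<le> B"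
    by blast
  have "\<bar>f0 c\<bar> \<le> B \<and> \<bar>f1 c\<bar> \<le> B \<and> \<bar>f2 c\<bar> \<le> B" if "c \<in> {-1..1}" for c
    using B[OF that] by linarith
  moreover have "B \<ge> 0"
    using B[of 0] abs_ge_zero[of "f0 0"] abs_ge_zero[of "f1 0"] abs_ge_zero[of "f2 0"] by simp
  ultimately show ?thesis
    using that by blast
qed

text \<open>Lets the product and sum rules generate raw coefficients, which are then matched with
  the intended ones as polynomial identities.\<close>

lemma jet_eq:
  assumes "jet f f0 f1 f2" "\<And>c. f0 c = g0 c" "\<And>c. f1 c = g1 c" "\<And>c. f2 c = g2 c"
  shows "jet f g0 g1 g2"
proof -
  have "f0 = g0" "f1 = g1" "f2 = g2"
    using assms(2-4) by auto
  with assms(1) show ?thesis by simp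
qed

lemma jet_const: "continuous_on {-1..1} h \<Longrightarrow> jet (\<lambda>t c. h c) h (\<lambda>c. 0) (\<lambda>c. 0)"
  by (intro jetI[where C = 0] always_eventually) auto

lemma jet_t: "jet (\<lambda>t c. t) (\<lambda>c. 0) (\<lambda>c. 1) (\<lambda>c. 0)"
  by (intro jetI[where C = 0] always_eventually) auto

lemma jet_add:
  assumes "jet f f0 f1 f2" "jet g g0 g1 g2"
  shows "jet (\<lambda>t c. f t c + g t c) (\<lambda>c. f0 c + g0 c) (\<lambda>c. f1 c + g1 c) (\<lambda>c. f2 c + g2 c)"
proof -
  obtain C where C: "\<forall>\<^sub>F t in at_right 0. \<forall>c\<in>{-1..1}. \<bar>f t c - (f0 c + f1 c * t + f2 c * t\<^sup>2)\<bar> \<le> C * t ^ 3"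
    using jetE[OF assms(1)] by blast
  obtain D where D: "\<forall>\<^sub>F t in at_right 0. \<forall>c\<in>{-1..1}. \<bar>g t c - (g0 c + g1 c * t + g2 c * t\<^sup>2)\<bar> \<le> D * t ^ 3"
    using jetE[OF assms(2)] by blast
  show ?thesis
  proof (rule jetI[where C = "C + D"])
    show "\<forall>\<^sub>F t in at_right 0. \<forall>c\<in>{-1..1}.
        \<bar>f t c + g t c - (f0 c + g0 c + (f1 c + g1 c) * t + (f2 c + g2 c) * t\<^sup>2)\<bar> \<le> (C + D) * t ^ 3"
      using C D
    proof eventually_elim
      case (elim t)
      show ?case
      proof
        fix c :: real assume c: "c \<in> {-1..1}"
        have "f t c + g t c - (f0 c + g0 c + (f1 c + g1 c) * t + (f2 c + g2 c) * t\<^sup>2) =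
          (f t c - (f0 c + f1 c * t + f2 c * t\<^sup>2)) + (g t c - (g0 c + g1 c * t + g2 c * t\<^sup>2))"
          by (simp add: algebra_simps)
        then show "\<bar>f t c + g t c - (f0 c + g0 c + (f1 c + g1 c) * t + (f2 c + g2 c) * t\<^sup>2)\<bar> \<le> (C + D) * t ^ 3"
          using bspec[OF elim(1) c] bspec[OF elim(2) c] unfolding distrib_right[of C D] by linarith
      qed
    qed
  qed (use assms in \<open>auto simp: jet_def intro!: continuous_intros\<close>)
qed

lemma jet_mult:
  assumes "jet f f0 f1 f2" "jet g g0 g1 g2"
  shows "jet (\<lambda>t c. f t c * g t c) (\<lambda>c. f0 c * g0 c) (\<lambda>c. f0 c * g1 c + f1 c * g0 c)
    (\<lambda>c. f0 c * g2 c + f1 c * g1 c + f2 c * g0 c)"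
proof -
  obtain C where C: "C \<ge> 0" "\<forall>\<^sub>F t in at_right 0. \<forall>c\<in>{-1..1}. \<bar>f t c - (f0 c + f1 c * t + f2 c * t\<^sup>2)\<bar> \<le> C * t ^ 3"
    using jetE[OF assms(1)] by blast
  obtain D where D: "D \<ge> 0" "\<forall>\<^sub>F t in at_right 0. \<forall>c\<in>{-1..1}. \<bar>g t c - (g0 c + g1 c * t + g2 c * t\<^sup>2)\<bar> \<le> D * t ^ 3"
    using jetE[OF assms(2)] by blast
  obtain M where M: "M \<ge> 0" "\<And>c. c \<in> {-1..1} \<Longrightarrow> \<bar>f0 c\<bar> \<le> M \<and> \<bar>f1 c\<bar> \<le> M \<and> \<bar>f2 c\<bar> \<le> M"
    using jet_bounded[OF assms(1)] by blast
  obtain N where N: "N \<ge> 0" "\<And>c. c \<in> {-1..1} \<Longrightarrow> \<bar>g0 c\<bar> \<le> N \<and> \<bar>g1 c\<bar> \<le> N \<and> \<bar>g2 c\<bar> \<le> N"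
    using jet_bounded[OF assms(2)] by blast
  have small: "\<forall>\<^sub>F t in at_right 0. t \<in> {0<..<1::real}"
    by (rule eventually_at_right_real) simp
  let ?J = "\<lambda>t c. f0 c * g0 c + (f0 c * g1 c + f1 c * g0 c) * t + (f0 c * g2 c + f1 c * g1 c + f2 c * g0 c) * t\<^sup>2"
  show ?thesis
  proof (rule jetI[where C = "C * (3 * N + D) + 3 * M * D + 3 * (M * N)"])
    show "\<forall>\<^sub>F t in at_right 0. \<forall>c\<in>{-1..1}. \<bar>f t c * g t c - ?J t c\<bar> \<le> (C * (3 * N + D) + 3 * M * D + 3 * (M * N)) * t ^ 3"
      using C(2) D(2) small
    proof eventually_elim
      case (elim t)
      then have t: "0 < t" "t < 1" "t\<^sup>2 \<le> 1" "t ^ 3 \<le> 1"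
        by (auto simp: power_le_one)
      show ?case
      proof
        fix c :: real assume c: "c \<in> {-1..1}"
        define F G \<alpha> \<beta> where "F = f0 c + f1 c * t + f2 c * t\<^sup>2" and "G = g0 c + g1 c * t + g2 c * t\<^sup>2"
          and "\<alpha> = f t c - F" and "\<beta> = g t c - G"
        have \<alpha>: "\<bar>\<alpha>\<bar> \<le> C * t ^ 3" and \<beta>: "\<bar>\<beta>\<bar> \<le> D * t ^ 3"
          using elim(1,2) c by (auto simp: \<alpha>_def \<beta>_def F_def G_def)
        have poly: "\<bar>x0 + x1 * t + x2 * t\<^sup>2\<bar> \<le> 3 * K" if "\<bar>x0\<bar> \<le> K \<and> \<bar>x1\<bar> \<le> K \<and> \<bar>x2\<bar> \<le> K" for x0 x1 x2 K
        proof -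
          have "\<bar>x1 * t\<bar> \<le> K * 1" "\<bar>x2 * t\<^sup>2\<bar> \<le> K * 1"
            unfolding abs_mult using that t by (intro mult_mono; auto)+
          with that show ?thesis by linarith
        qed
        have F: "\<bar>F\<bar> \<le> 3 * M" and G: "\<bar>G\<bar> \<le> 3 * N"
          unfolding F_def G_def by (rule poly[OF M(2)[OF c]], rule poly[OF N(2)[OF c]])
        have "D * t ^ 3 \<le> D * 1"
          using t D(1) by (intro mult_left_mono) auto
        then have g: "\<bar>g t c\<bar> \<le> 3 * N + D"
          using G \<beta> by (simp add: \<beta>_def)
        have prod: "\<bar>x * y\<bar> \<le> M * N" if "\<bar>x\<bar> \<le> M" "\<bar>y\<bar> \<le> N" for x y
          unfolding abs_mult using that M(1) by (intro mult_mono) auto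
        have rest: "\<bar>f1 c * g2 c + f2 c * g1 c + f2 c * g2 c * t\<bar> \<le> 3 * (M * N)"
        proof -
          have "\<bar>f2 c * g2 c * t\<bar> \<le> M * N * 1"
            unfolding abs_mult[of "f2 c * g2 c"] using prod[of "f2 c" "g2 c"] M(2)[OF c] N(2)[OF c] t M(1) N(1)
            by (intro mult_mono) auto
          moreover have "\<bar>f1 c * g2 c\<bar> \<le> M * N" "\<bar>f2 c * g1 c\<bar> \<le> M * N"
            using prod M(2)[OF c] N(2)[OF c] by blast+
          ultimately show ?thesis by linarith
        qed
        \<comment> \<open>Besides the two remainders, the product of the truncations leaves terms of
          degree \<open>3\<close> and \<open>4\<close> in \<open>t\<close>, bounded through
          \<open>t < 1\<close>.\<close>
        have "f t c * g t c - ?J t c = \<alpha> * g t c + F * \<beta> + (f1 c * g2 c + f2 c * g1 c + f2 c * g2 c * t) * t ^ 3"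
          unfolding \<alpha>_def \<beta>_def F_def G_def by (simp add: algebra_simps power2_eq_square power3_eq_cube)
        also have "\<bar>\<dots>\<bar> \<le> \<bar>\<alpha> * g t c\<bar> + \<bar>F * \<beta>\<bar> + \<bar>(f1 c * g2 c + f2 c * g1 c + f2 c * g2 c * t) * t ^ 3\<bar>"
          by linarith
        also have "\<dots> \<le> (C * t ^ 3) * (3 * N + D) + (3 * M) * (D * t ^ 3) + 3 * (M * N) * t ^ 3"
          unfolding abs_mult[of \<alpha>] abs_mult[of F] abs_mult[of _ "t ^ 3"]
          using \<alpha> \<beta> F g rest t C(1) D(1) M(1) N(1) by (intro add_mono mult_mono) auto
        also have "\<dots> = (C * (3 * N + D) + 3 * M * D + 3 * (M * N)) * t ^ 3"
          by (simp add: algebra_simps)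
        finally show "\<bar>f t c * g t c - ?J t c\<bar> \<le> (C * (3 * N + D) + 3 * M * D + 3 * (M * N)) * t ^ 3" .
      qed
    qed
  qed (use assms in \<open>auto simp: jet_def intro!: continuous_intros\<close>)
qed

lemma jet_diff:
  assumes "jet f f0 f1 f2" "jet g g0 g1 g2"
  shows "jet (\<lambda>t c. f t c - g t c) (\<lambda>c. f0 c - g0 c) (\<lambda>c. f1 c - g1 c) (\<lambda>c. f2 c - g2 c)"
  using jet_add[OF assms(1) jet_mult[OF jet_const[of "\<lambda>c. -1"] assms(2)]] by simp

lemma jet_perturb:
  assumes "jet f f0 f1 f2" "\<forall>\<^sub>F t in at_right 0. \<forall>c\<in>{-1..1}. \<bar>g t c - f t c\<bar> \<le> C * t ^ 3"
  shows "jet g f0 f1 f2"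
proof -
  obtain D where D: "\<forall>\<^sub>F t in at_right 0. \<forall>c\<in>{-1..1}. \<bar>f t c - (f0 c + f1 c * t + f2 c * t\<^sup>2)\<bar> \<le> D * t ^ 3"
    using jetE[OF assms(1)] by blast
  show ?thesis
  proof (rule jetI[where C = "C + D"])
    show "\<forall>\<^sub>F t in at_right 0. \<forall>c\<in>{-1..1}. \<bar>g t c - (f0 c + f1 c * t + f2 c * t\<^sup>2)\<bar> \<le> (C + D) * t ^ 3"
      using assms(2) D
    proof eventually_elim
      case (elim t)
      show ?case
      proof
        fix c :: real assume c: "c \<in> {-1..1}"
        show "\<bar>g t c - (f0 c + f1 c * t + f2 c * t\<^sup>2)\<bar> \<le> (C + D) * t ^ 3"
          using bspec[OF elim(1) c] bspec[OF elim(2) c] unfolding distrib_right[of C D] by linarith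
      qed
    qed
  qed (use assms in \<open>auto simp: jet_def\<close>)
qed

lemma jet_self:
  assumes "continuous_on {-1..1} f0" "continuous_on {-1..1} f1" "continuous_on {-1..1} f2"
  shows "jet (\<lambda>t c. f0 c + f1 c * t + f2 c * t\<^sup>2) f0 f1 f2"
  by (intro jetI[where C = 0] always_eventually assms) auto

lemma jet_small:
  assumes "jet f f0 (\<lambda>c. f1 c) f2" "\<epsilon> > 0"
  shows "\<forall>\<^sub>F t in at_right 0. \<forall>c\<in>{-1..1}. \<bar>f t c - f0 c\<bar> \<le> \<epsilon>"
proof -
  obtain C where C: "C \<ge> 0" "\<forall>\<^sub>F t in at_right 0. \<forall>c\<in>{-1..1}. \<bar>f t c - (f0 c + f1 c * t + f2 c * t\<^sup>2)\<bar> \<le> C * t ^ 3"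
    using jetE[OF assms(1)] by blast
  obtain M where M: "M \<ge> 0" "\<And>c. c \<in> {-1..1} \<Longrightarrow> \<bar>f0 c\<bar> \<le> M \<and> \<bar>f1 c\<bar> \<le> M \<and> \<bar>f2 c\<bar> \<le> M"
    using jet_bounded[OF assms(1)] by blast
  have "((\<lambda>t. M * t + M * t\<^sup>2 + C * t ^ 3) \<longlongrightarrow> M * 0 + M * 0\<^sup>2 + C * 0 ^ 3) (at_right 0)"
    by (intro tendsto_intros)
  then have "\<forall>\<^sub>F t in at_right 0. M * t + M * t\<^sup>2 + C * t ^ 3 < \<epsilon>"
    using assms(2) by (simp add: order_tendsto_iff)
  then show ?thesis
    using C(2) eventually_at_right_less[of 0]
  proof eventually_elim
    case (elim t)
    show ?case
    proof
      fix c :: real assume c: "c \<in> {-1..1}"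
      have "\<bar>f1 c * t\<bar> \<le> M * t" "\<bar>f2 c * t\<^sup>2\<bar> \<le> M * t\<^sup>2"
        using M(2)[OF c] elim(3) by (auto simp: abs_mult intro!: mult_right_mono)
      then show "\<bar>f t c - f0 c\<bar> \<le> \<epsilon>"
        using elim(1) bspec[OF elim(2) c] by linarith
    qed
  qed
qed

lemma eventually_at_right_0_le: "a > 0 \<Longrightarrow> \<forall>\<^sub>F t in at_right 0. 0 < t \<and> t \<le> (a::real)"
  using eventually_at_right_real[of 0 a] by (auto elim: eventually_mono)

section \<open>Expansions of the radius and of the abscissa\<close>

context free_clt_coeffs
begin

text \<open>Solves \<open>r^2 (1 + 2 \<rho>_2 c t r + \<rho>_3 (4 c^2 - 1) t^2 r^2) = 1\<close>
  order by order in \<open>t\<close>.\<close>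

abbreviation "r1 c \<equiv> - \<rho> 2 * c"
abbreviation "r2 c \<equiv> 5/2 * (\<rho> 2)\<^sup>2 * c\<^sup>2 - \<rho> 3 * (4 * c\<^sup>2 - 1) / 2"

lemma chebyshev_U_2: "chebyshev_U 2 c = 4 * c\<^sup>2 - 1" for c :: real
  by (simp add: numeral_2_eq_2 power2_eq_square)

lemma chebyshev_U_3: "chebyshev_U 3 c = 8 * c ^ 3 - 4 * c" for c :: real
  by (simp add: numeral_3_eq_3 power3_eq_cube algebra_simps)

text \<open>No derivative in \<open>t\<close> is taken: the explicit quadratic \<open>s\<close> has
  residual \<open>O(t^3)\<close> in the equation, and \<open>eqn_error\<close> turns the residual
  into a distance.\<close>

lemma radius_jet: "jet real_radius (\<lambda>c. 1) r1 r2"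
proof -
  define s where "s t c = 1 + r1 c * t + r2 c * t\<^sup>2" for t c
  have s: "jet s (\<lambda>c. 1) r1 r2"
    unfolding s_def[abs_def] by (intro jet_self continuous_intros) auto
  have s_small: "\<forall>\<^sub>F t in at_right 0. \<forall>c\<in>{-1..1}. \<bar>s t c - 1\<bar> \<le> 1/4"
    by (rule jet_small[OF s]) simp
  let ?Q = "\<lambda>t c. 1 + (2 * \<rho> 2 * c) * (t * s t c) + (\<rho> 3 * (4 * c\<^sup>2 - 1)) * ((t * s t c) * (t * s t c))"
  have "jet (\<lambda>t c. (s t c * s t c) * ?Q t c) (\<lambda>c. 1) (\<lambda>c. 0) (\<lambda>c. 0)"
    by (rule jet_eq, (rule jet_mult jet_add s jet_t jet_const continuous_intros)+)
       (simp_all add: algebra_simps power2_eq_square)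
  then obtain C where C: "\<forall>\<^sub>F t in at_right 0. \<forall>c\<in>{-1..1}. \<bar>(s t c * s t c) * ?Q t c - 1\<bar> \<le> C * t ^ 3"
    by (auto elim!: jetE)
  show ?thesis
  proof (rule jet_perturb[OF s])
    show "\<forall>\<^sub>F t in at_right 0. \<forall>c\<in>{-1..1}. \<bar>real_radius t c - s t c\<bar> \<le> (C + 2 * (A * B) * (4 * B * (5/4)) ^ 3 * (5/4)\<^sup>2) * t ^ 3"
      using C eventually_at_right_0_le[OF t0_pos] s_small
    proof eventually_elim
      case (elim t)
      then have t: "0 < t" "t \<le> t0" by auto
      show ?case
      proof
        fix c :: real assume c: "c \<in> {-1..1}"
        then have c': "norm c \<le> 3/2" "\<bar>c\<bar> < 3/2" by auto
        have sc: "s t c \<in> cball 1 (1/4)"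
          using bspec[OF elim(3) c] by (simp add: dist_norm abs_minus_commute)
        have s_le: "\<bar>s t c\<bar> \<le> 5/4"
          using cball_norm(1)[OF sc] by simp
        have sum: "(\<Sum>k<3. \<rho> (Suc k) * (t * s t c) ^ k * chebyshev_U k c) = ?Q t c"
        proof -
          have "{..<3} = {0, 1, 2::nat}" by auto
          then have "(\<Sum>k<3. \<rho> (Suc k) * (t * s t c) ^ k * chebyshev_U k c) =
              \<rho> 1 + \<rho> 2 * (t * s t c) * (2 * c) + \<rho> 3 * (t * s t c) ^ 2 * chebyshev_U 2 c"
            by (simp add: numeral_2_eq_2 numeral_3_eq_3)
          then show ?thesis
            unfolding chebyshev_U_2 \<rho>_1 by (simp add: power2_eq_square)
        qed
        have "\<bar>chebyshev_series (\<lambda>k. \<rho> (Suc k)) (t * s t c) c - ?Q t c\<bar> \<le> 2 * (A * B) * (4 * B * \<bar>t * s t c\<bar>) ^ 3"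
          using quot.truncation[OF c'(1) t_r_le[OF t sc], of 3] by (simp only: of_real_eq_id id_apply sum real_norm_def)
        also have "\<dots> \<le> 2 * (A * B) * (4 * B * (t * (5/4))) ^ 3"
          using s_le t B_pos num.A_nonneg by (intro mult_left_mono power_mono) (auto simp: abs_mult)
        finally have Q: "\<bar>chebyshev_series (\<lambda>k. \<rho> (Suc k)) (t * s t c) c - ?Q t c\<bar> \<le> 2 * (A * B) * (4 * B * (5/4)) ^ 3 * t ^ 3"
          by (simp add: power_mult_distrib mult_ac)
        have "eqn t (s t c) c - (s t c * s t c) * ?Q t c = (chebyshev_series (\<lambda>k. \<rho> (Suc k)) (t * s t c) c - ?Q t c) * (s t c)\<^sup>2"
          unfolding eqn_def left_diff_distrib by (simp only: power2_eq_square of_real_eq_id id_apply mult.commute)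
        then have "\<bar>eqn t (s t c) c - (s t c * s t c) * ?Q t c\<bar> = \<bar>chebyshev_series (\<lambda>k. \<rho> (Suc k)) (t * s t c) c - ?Q t c\<bar> * \<bar>s t c\<bar>\<^sup>2"
          by (simp only: abs_mult power_abs)
        also have "\<dots> \<le> (2 * (A * B) * (4 * B * (5/4)) ^ 3 * t ^ 3) * (5/4)\<^sup>2"
          using Q s_le by (intro mult_mono power_mono) (auto intro: order_trans[OF abs_ge_zero Q])
        finally have "\<bar>eqn t (s t c) c - (s t c * s t c) * ?Q t c\<bar> \<le> 2 * (A * B) * (4 * B * (5/4)) ^ 3 * (5/4)\<^sup>2 * t ^ 3"
          by (simp only: mult_ac)
        then have "\<bar>eqn t (s t c) c - 1\<bar> \<le> (C + 2 * (A * B) * (4 * B * (5/4)) ^ 3 * (5/4)\<^sup>2) * t ^ 3"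
          using bspec[OF elim(1) c] unfolding distrib_right[of C] by linarith
        moreover have "dist (real_radius t c) (s t c) \<le> norm (eqn t (s t c) c - 1)"
          by (rule eqn_error[OF t c'(1) real_radius_cball[OF t c'(2)] eqn_real_radius[OF t c'(2)] sc])
        ultimately show "\<bar>real_radius t c - s t c\<bar> \<le> (C + 2 * (A * B) * (4 * B * (5/4)) ^ 3 * (5/4)\<^sup>2) * t ^ 3"
          by (simp add: dist_norm)
      qed
    qed
  qed
qed

abbreviation "X1 c \<equiv> \<rho> 2 * (2 * c\<^sup>2 - 1)"
abbreviation "X2 c \<equiv> (\<rho> 2)\<^sup>2 * (2 * c - 3 * c ^ 3) + \<rho> 3 * (4 * c ^ 3 - 3 * c)"

text \<open>The series is cut at order \<open>4\<close>, since the division by \<open>t\<close> in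
  \<open>abscissa\<close> costs one order.\<close>

lemma abscissa_jet: "jet real_abscissa (\<lambda>c. 2 * c) X1 X2"
proof -
  note r = radius_jet
  let ?r = real_radius
  have "jet (\<lambda>t c. ?r t c * (2 * c) + t * (?r t c * ?r t c) * (\<rho> 2 * (4 * c\<^sup>2 - 1)) +
      (t * t) * (?r t c * ?r t c * ?r t c) * (\<rho> 3 * (8 * c ^ 3 - 4 * c))) (\<lambda>c. 2 * c) X1 X2"
    by (rule jet_eq, (rule jet_mult jet_add r jet_t jet_const continuous_intros)+)
       (simp_all add: field_simps power2_eq_square power3_eq_cube)
  then show ?thesis
  proof (rule jet_perturb)
    show "\<forall>\<^sub>F t in at_right 0. \<forall>c\<in>{-1..1}. \<bar>real_abscissa t c - (?r t c * (2 * c) + t * (?r t c * ?r t c) * (\<rho> 2 * (4 * c\<^sup>2 - 1)) +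
      (t * t) * (?r t c * ?r t c * ?r t c) * (\<rho> 3 * (8 * c ^ 3 - 4 * c)))\<bar> \<le> (2 * A * (4 * B * (5/4)) ^ 4) * t ^ 3"
      using eventually_at_right_0_le[OF t0_pos]
    proof eventually_elim
      case (elim t)
      then have t: "0 < t" "t \<le> t0" by auto
      show ?case
      proof
        fix c :: real assume c: "c \<in> {-1..1}"
        then have c': "norm c \<le> 3/2" "\<bar>c\<bar> < 3/2" by auto
        let ?P = "?r t c * (2 * c) + t * (?r t c * ?r t c) * (\<rho> 2 * (4 * c\<^sup>2 - 1)) +
            (t * t) * (?r t c * ?r t c * ?r t c) * (\<rho> 3 * (8 * c ^ 3 - 4 * c))"
        have r_le: "\<bar>?r t c\<bar> \<le> 5/4"
          using cball_norm(1)[OF real_radius_cball[OF t c'(2)]] by simp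
        have sum: "(\<Sum>k<4. \<rho> k * (t * ?r t c) ^ k * chebyshev_U k c) = t * ?P"
        proof -
          have "{..<4} = {0, 1, 2, 3::nat}" by auto
          then have "(\<Sum>k<4. \<rho> k * (t * ?r t c) ^ k * chebyshev_U k c) =
            \<rho> 0 + \<rho> 1 * (t * ?r t c) * (2 * c) + \<rho> 2 * (t * ?r t c) ^ 2 * chebyshev_U 2 c + \<rho> 3 * (t * ?r t c) ^ 3 * chebyshev_U 3 c"
            by simp
          then show ?thesis
            unfolding chebyshev_U_2 chebyshev_U_3 \<rho>_0 \<rho>_1
            by (simp add: power2_eq_square power3_eq_cube algebra_simps)
        qed
        have "\<bar>chebyshev_series \<rho> (t * ?r t c) c - t * ?P\<bar> \<le> 2 * A * (4 * B * \<bar>t * ?r t c\<bar>) ^ 4"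
          using num.truncation[OF c'(1) t_r_le[OF t real_radius_cball[OF t c'(2)]], of 4] by (simp add: sum)
        also have "\<dots> \<le> 2 * A * (4 * B * (t * (5/4))) ^ 4"
          using r_le t B_pos num.A_nonneg by (intro mult_left_mono power_mono) (auto simp: abs_mult)
        also have "\<dots> = t * (2 * A * (4 * B * (5/4)) ^ 4 * t ^ 3)"
          by (simp only: power_mult_distrib power4_eq_xxxx power3_eq_cube mult_ac)
        finally have "\<bar>t * real_abscissa t c - t * ?P\<bar> \<le> t * (2 * A * (4 * B * (5/4)) ^ 4 * t ^ 3)"
          using t by (simp add: real_abscissa_def abscissa_def)
        then have "t * \<bar>real_abscissa t c - ?P\<bar> \<le> t * (2 * A * (4 * B * (5/4)) ^ 4 * t ^ 3)"
          using t by (simp only: right_diff_distrib[symmetric] abs_mult abs_of_pos)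
        then show "\<bar>real_abscissa t c - ?P\<bar> \<le> (2 * A * (4 * B * (5/4)) ^ 4) * t ^ 3"
          using t by simp
      qed
    qed
  qed
qed

end

text \<open>The comparison passes through \<open>A * sqrt (u * T)\<close>. Replacing
  \<open>sqrt (u * T)\<close> by \<open>sqrt v\<close> costs \<open>\<delta> / sqrt v\<close>, as
  the square root is steep near an edge; replacing \<open>A * sqrt T\<close> by \<open>r\<close>
  costs only a multiple of \<open>\<delta>'\<close>, since \<open>r\<close> stays away from
  zero.\<close>

lemma sqrt_perturbation:
  fixes r A T u v \<delta> \<delta>' :: real
  assumes v: "0 < v" "v \<le> 1" and u: "0 \<le> u" "u \<le> 1" and T: "T \<ge> 0" and A: "0 \<le> A" "A \<le> 2" and r: "r \<ge> 1/2"
    and 1: "\<bar>v - u * T\<bar> \<le> \<delta>" and 2: "\<bar>A\<^sup>2 * T - r\<^sup>2\<bar> \<le> \<delta>'"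
  shows "\<bar>r * sqrt u - A * sqrt v\<bar> \<le> (2 * \<delta> + 2 * \<delta>') / sqrt v"
proof -
  have sv: "0 < sqrt v" "sqrt v \<le> 1"
    using v by auto
  have \<delta>: "0 \<le> \<delta>" "0 \<le> \<delta>'"
    using 1 2 by linarith+
  have "\<bar>sqrt (u * T) - sqrt v\<bar> * sqrt v \<le> \<bar>sqrt (u * T) - sqrt v\<bar> * (sqrt (u * T) + sqrt v)"
    using u T by (intro mult_left_mono) auto
  also have "\<dots> = \<bar>(sqrt (u * T) - sqrt v) * (sqrt (u * T) + sqrt v)\<bar>"
    using u T v by (simp add: abs_mult)
  also have "(sqrt (u * T) - sqrt v) * (sqrt (u * T) + sqrt v) = u * T - v"
  proof -
    have "(sqrt (u * T))\<^sup>2 = u * T" "(sqrt v)\<^sup>2 = v"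
      using u T v by simp_all
    then show ?thesis
      unfolding power2_eq_square by (simp add: algebra_simps)
  qed
  finally have "\<bar>sqrt (u * T) - sqrt v\<bar> \<le> \<delta> / sqrt v"
    using 1 sv by (simp add: field_simps abs_minus_commute)
  then have a: "A * \<bar>sqrt (u * T) - sqrt v\<bar> \<le> 2 * (\<delta> / sqrt v)"
    using A \<delta> sv by (intro mult_mono) auto
  have "\<bar>A * sqrt T - r\<bar> * (1/2) \<le> \<bar>A * sqrt T - r\<bar> * (A * sqrt T + r)"
  proof (rule mult_left_mono)
    have "0 \<le> A * sqrt T"
      using A T by simp
    then show "1/2 \<le> A * sqrt T + r"
      using r by linarith
  qed simp
  also have "\<dots> = \<bar>(A * sqrt T - r) * (A * sqrt T + r)\<bar>"
    using A T r by (simp add: abs_mult)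
  also have "(A * sqrt T - r) * (A * sqrt T + r) = A\<^sup>2 * T - r\<^sup>2"
  proof -
    have "(sqrt T)\<^sup>2 = T"
      using T by simp
    then show ?thesis
      unfolding power2_eq_square by (simp add: algebra_simps)
  qed
  finally have "\<bar>A * sqrt T - r\<bar> \<le> 2 * \<delta>'"
    using 2 by simp
  then have "\<bar>A * sqrt T - r\<bar> * sqrt u \<le> 2 * \<delta>' * 1"
    using u \<delta> by (intro mult_mono) auto
  also have "\<dots> \<le> 2 * \<delta>' / sqrt v"
    using sv \<delta> by (simp add: field_simps mult_left_le)
  finally have b: "\<bar>A * sqrt T - r\<bar> * sqrt u \<le> 2 * \<delta>' / sqrt v" .
  have "r * sqrt u - A * sqrt v = A * (sqrt (u * T) - sqrt v) - (A * sqrt T - r) * sqrt u"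
    by (simp add: real_sqrt_mult algebra_simps)
  also have "\<bar>\<dots>\<bar> \<le> A * \<bar>sqrt (u * T) - sqrt v\<bar> + \<bar>A * sqrt T - r\<bar> * sqrt u"
    using A u abs_triangle_ineq4[of "A * (sqrt (u * T) - sqrt v)" "(A * sqrt T - r) * sqrt u"]
    by (simp add: abs_mult)
  also have "\<dots> \<le> 2 * (\<delta> / sqrt v) + 2 * \<delta>' / sqrt v"
    by (rule add_mono[OF a b])
  finally show ?thesis
    by (simp add: add_divide_distrib)
qed

context free_clt_coeffs
begin

abbreviation "\<beta> \<equiv> \<rho> 3 + 1 - (\<rho> 2)\<^sup>2"

text \<open>For \<open>t = 1 / sqrt n\<close> one has \<open>b_n = \<beta> t^2\<close> and
  \<open>d_n = (\<beta> + 1) t^2\<close>, so this is \<open>e_n\<close>; likewise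
  \<open>correction\<close> is the polynomial factor of the theorem.\<close>

definition edge :: "real \<Rightarrow> real" where
  "edge t = (1 - \<beta> * t\<^sup>2) / sqrt (1 - (\<beta> + 1) * t\<^sup>2)"

definition correction :: "real \<Rightarrow> real \<Rightarrow> real" where
  "correction t x = 1 + (\<beta> + 1) * t\<^sup>2 / 2 - (\<rho> 2 * t)\<^sup>2 - t\<^sup>2 - \<rho> 2 * t * x -
     (\<beta> * t\<^sup>2 - (\<rho> 2 * t)\<^sup>2 - t\<^sup>2) * x\<^sup>2"

text \<open>The quotient is expanded without a division rule: numerator minus candidate times
  \<open>sqrt (1 - (\<beta> + 1) * t\<^sup>2)\<close> is \<open>O(t^3)\<close>, and the root is at
  least \<open>1/2\<close>.\<close>

lemma edge_jet: "jet (\<lambda>t c. edge t) (\<lambda>c. 1) (\<lambda>c. 0) (\<lambda>c. ((\<rho> 2)\<^sup>2 - \<rho> 3) / 2)"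
proof -
  define \<gamma> where "\<gamma> = \<beta> + 1"
  define s where "s t = sqrt (1 - \<gamma> * t\<^sup>2)" for t
  have lims: "((\<lambda>t. \<bar>\<gamma>\<bar> * t\<^sup>2) \<longlongrightarrow> \<bar>\<gamma>\<bar> * 0\<^sup>2) (at_right 0)"
    by (intro tendsto_intros)
  then have small: "\<forall>\<^sub>F t in at_right 0. \<bar>\<gamma>\<bar> * t\<^sup>2 < 1/2"
    by (intro order_tendstoD(2)[of _ 0]) auto
  have bounds: "\<forall>\<^sub>F t in at_right 0. 0 < t \<and> t \<le> 1 \<and> \<bar>\<gamma> * t\<^sup>2\<bar> \<le> 1/2 \<and> 1/2 \<le> s t \<and> (s t)\<^sup>2 = 1 - \<gamma> * t\<^sup>2"
    using small eventually_at_right_0_le[OF zero_less_one]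
  proof eventually_elim
    case (elim t)
    then have g: "\<bar>\<gamma> * t\<^sup>2\<bar> \<le> 1/2"
      by (simp add: abs_mult)
    then have "(1/2)\<^sup>2 \<le> 1 - \<gamma> * t\<^sup>2"
      unfolding abs_le_iff by (simp add: power2_eq_square)
    then have "1/2 \<le> s t" "0 \<le> 1 - \<gamma> * t\<^sup>2"
      unfolding s_def by (rule real_le_rsqrt, rule order_trans[rotated]) simp
    then have "1/2 \<le> s t" "(s t)\<^sup>2 = 1 - \<gamma> * t\<^sup>2"
      unfolding s_def by simp_all
    with g elim show ?case by blast
  qed
  have sj: "jet (\<lambda>t c. s t) (\<lambda>c. 1) (\<lambda>c. 0) (\<lambda>c. - \<gamma> / 2)"
  proof (rule jetI[where C = "\<gamma>\<^sup>2 / 4"])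
    show "\<forall>\<^sub>F t in at_right 0. \<forall>c\<in>{-1..1::real}. \<bar>s t - (1 + 0 * t + - \<gamma> / 2 * t\<^sup>2)\<bar> \<le> \<gamma>\<^sup>2 / 4 * t ^ 3"
      using bounds
    proof eventually_elim
      case (elim t)
      define w where "w = 1 - \<gamma> * t\<^sup>2 / 2"
      have w: "1/2 \<le> w"
        using elim unfolding w_def abs_le_iff by linarith
      have "\<bar>s t - w\<bar> * 1 \<le> \<bar>s t - w\<bar> * (s t + w)"
        using elim w by (intro mult_left_mono) auto
      also have "\<dots> = \<bar>(s t - w) * (s t + w)\<bar>"
        using elim w by (simp add: abs_mult)
      also have "(s t - w) * (s t + w) = (s t)\<^sup>2 - w\<^sup>2"
        by (simp add: power2_eq_square algebra_simps)
      also have "\<dots> = - (\<gamma>\<^sup>2 / 4 * t ^ 4)"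
        using elim by (simp add: w_def power2_eq_square power4_eq_xxxx algebra_simps)
      also have "\<bar>- (\<gamma>\<^sup>2 / 4 * t ^ 4)\<bar> \<le> \<gamma>\<^sup>2 / 4 * t ^ 3"
        using elim power_decreasing[of 3 4 t] by (simp add: abs_mult mult_left_mono)
      finally show ?case
        by (simp add: w_def algebra_simps)
    qed
  qed auto
  let ?e = "\<lambda>t. 1 + ((\<rho> 2)\<^sup>2 - \<rho> 3) / 2 * (t * t)"
  have "jet (\<lambda>t c. 1 - \<beta> * (t * t) - ?e t * s t) (\<lambda>c. 0) (\<lambda>c. 0) (\<lambda>c. 0)"
    by (rule jet_eq, (rule jet_mult jet_add jet_diff sj jet_t jet_const continuous_on_const)+)
       (simp_all add: \<gamma>_def field_simps)
  then obtain C where C: "\<forall>\<^sub>F t in at_right 0. \<forall>c\<in>{-1..1::real}. \<bar>1 - \<beta> * (t * t) - ?e t * s t\<bar> \<le> C * t ^ 3"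
    by (auto elim!: jetE)
  show ?thesis
  proof (rule jetI[where C = "2 * C"])
    show "\<forall>\<^sub>F t in at_right 0. \<forall>c\<in>{-1..1::real}. \<bar>edge t - (1 + 0 * t + ((\<rho> 2)\<^sup>2 - \<rho> 3) / 2 * t\<^sup>2)\<bar> \<le> 2 * C * t ^ 3"
      using C bounds
    proof eventually_elim
      case (elim t)
      have C: "\<bar>1 - \<beta> * (t * t) - ?e t * s t\<bar> \<le> C * t ^ 3"
        using bspec[OF elim(1), of 0] by simp
      have "edge t = (1 - \<beta> * (t * t)) / s t"
        by (simp only: edge_def s_def \<gamma>_def power2_eq_square)
      moreover have "s t \<noteq> 0"
        using elim(2) by auto
      ultimately have "edge t - ?e t = (1 - \<beta> * (t * t) - ?e t * s t) / s t"
        by (simp only: diff_divide_distrib) simp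
      then have "\<bar>edge t - ?e t\<bar> = \<bar>1 - \<beta> * (t * t) - ?e t * s t\<bar> / s t"
        using elim(2) by (simp only: abs_divide) simp
      also have "\<dots> \<le> (C * t ^ 3) / (1/2)"
        using C elim(2) by (intro frac_le) auto
      finally show ?case
        by (simp add: power2_eq_square mult_ac)
    qed
  qed auto
qed

lemma local_asymptotics:
  defines "x \<equiv> \<lambda>t c. real_abscissa t c - \<rho> 2 * t"
  shows "\<exists>C\<ge>0. \<forall>\<^sub>F t in at_right 0. 1/2 \<le> edge t \<and>
     \<bar>x t 1 - 2 / edge t\<bar> \<le> C * t ^ 3 \<and> \<bar>x t (-1) + 2 / edge t\<bar> \<le> C * t ^ 3 \<and>
     (\<forall>c\<in>{-1..1}. (edge t * x t c)\<^sup>2 < 4 \<longrightarrow>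
       \<bar>real_radius t c * sqrt (1 - c\<^sup>2) - correction t (x t c) * (sqrt (4 - (edge t * x t c)\<^sup>2) / 2)\<bar>
         \<le> C * t ^ 3 / sqrt (4 - (edge t * x t c)\<^sup>2))"
proof -
  note jet_intros = jet_mult jet_add jet_diff jet_t jet_const
  have xj: "jet x (\<lambda>c. 2 * c) (\<lambda>c. - 2 * \<rho> 2 * (1 - c\<^sup>2)) X2"
    unfolding x_def
    by (rule jet_eq, (rule jet_intros abscissa_jet continuous_intros)+) (simp_all add: algebra_simps)
  \<comment> \<open>The position normalized to the semicircle. The coefficients of \<open>t\<close>
    and \<open>t^2\<close> in its expansion are divisible by \<open>1 - c^2\<close>, which is the
    effect of the shift by \<open>\<rho> 2 * t\<close> and the scaling by
    \<open>edge t\<close>.\<close>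
  define y where "y t c = edge t * x t c * (1/2)" for t c
  have yj: "jet y (\<lambda>c. c) (\<lambda>c. - \<rho> 2 * (1 - c\<^sup>2))
      (\<lambda>c. (\<rho> 2)\<^sup>2 * (3/2) * (c - c ^ 3) - 2 * \<rho> 3 * (c - c ^ 3))"
    unfolding y_def
    by (rule jet_eq, (rule jet_intros xj edge_jet continuous_intros)+)
       (simp_all add: field_simps power2_eq_square power3_eq_cube)
  \<comment> \<open>The quotient of \<open>1 - y^2\<close> by \<open>1 - c^2\<close>, truncated
    after \<open>t^2\<close>.\<close>
  define T where "T t c = 1 + 2 * \<rho> 2 * c * t + (4 * \<rho> 3 * c\<^sup>2 - (\<rho> 2)\<^sup>2 - 2 * (\<rho> 2)\<^sup>2 * c\<^sup>2) * t\<^sup>2" for t c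
  have Tj: "jet T (\<lambda>c. 1) (\<lambda>c. 2 * \<rho> 2 * c) (\<lambda>c. 4 * \<rho> 3 * c\<^sup>2 - (\<rho> 2)\<^sup>2 - 2 * (\<rho> 2)\<^sup>2 * c\<^sup>2)"
    unfolding T_def by (intro jet_self continuous_intros)
  define A' where "A' t c = 1 + ((\<beta> + 1) / 2 - (\<rho> 2)\<^sup>2 - 1) * (t * t) - \<rho> 2 * (t * x t c) -
      (\<beta> - (\<rho> 2)\<^sup>2 - 1) * ((t * t) * (x t c * x t c))" for t c
  have A'_eq: "correction t (x t c) = A' t c" for t c
    by (simp add: correction_def A'_def power2_eq_square field_simps)
  have A'j: "jet A' (\<lambda>c. 1) (\<lambda>c. - 2 * \<rho> 2 * c)
      (\<lambda>c. (\<rho> 2)\<^sup>2 * (1/2 + 6 * c\<^sup>2) + \<rho> 3 * (1/2 - 4 * c\<^sup>2))"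
    unfolding A'_def
    by (rule jet_eq, (rule jet_intros xj continuous_intros)+)
       (simp_all add: field_simps power2_eq_square power3_eq_cube)
  have "jet (\<lambda>t c. (1 - y t c * y t c) - (1 - c\<^sup>2) * T t c) (\<lambda>c. 0) (\<lambda>c. 0) (\<lambda>c. 0)"
    by (rule jet_eq, (rule jet_intros yj Tj continuous_intros)+)
       (simp_all add: field_simps power2_eq_square power3_eq_cube)
  then obtain C1 where C1: "C1 \<ge> 0" "\<forall>\<^sub>F t in at_right 0. \<forall>c\<in>{-1..1}. \<bar>(1 - y t c * y t c) - (1 - c\<^sup>2) * T t c\<bar> \<le> C1 * t ^ 3"
    by (auto elim!: jetE)
  \<comment> \<open>The identity behind the theorem: squared correction times \<open>T\<close>
    agrees with the squared radius up to \<open>O(t^3)\<close>.\<close>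
  have "jet (\<lambda>t c. A' t c * A' t c * T t c - real_radius t c * real_radius t c) (\<lambda>c. 0) (\<lambda>c. 0) (\<lambda>c. 0)"
    by (rule jet_eq, (rule jet_intros A'j Tj radius_jet continuous_intros)+)
       (simp_all add: field_simps power2_eq_square power3_eq_cube)
  then obtain C2 where C2: "C2 \<ge> 0" "\<forall>\<^sub>F t in at_right 0. \<forall>c\<in>{-1..1}.
      \<bar>A' t c * A' t c * T t c - real_radius t c * real_radius t c\<bar> \<le> C2 * t ^ 3"
    by (auto elim!: jetE)
  obtain C3 where C3: "C3 \<ge> 0" "\<forall>\<^sub>F t in at_right 0. \<forall>c\<in>{-1..1}. \<bar>y t c - (c + (- \<rho> 2 * (1 - c\<^sup>2)) * t +
      ((\<rho> 2)\<^sup>2 * (3/2) * (c - c ^ 3) - 2 * \<rho> 3 * (c - c ^ 3)) * t\<^sup>2)\<bar> \<le> C3 * t ^ 3"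
    using jetE[OF yj] by blast
  have T_small: "\<forall>\<^sub>F t in at_right 0. \<forall>c\<in>{-1..1}. \<bar>T t c - 1\<bar> \<le> 1/2"
    by (rule jet_small[OF Tj]) simp
  have A_small: "\<forall>\<^sub>F t in at_right 0. \<forall>c\<in>{-1..1}. \<bar>A' t c - 1\<bar> \<le> 1/2"
    by (rule jet_small[OF A'j]) simp
  have r_small: "\<forall>\<^sub>F t in at_right 0. \<forall>c\<in>{-1..1}. \<bar>real_radius t c - 1\<bar> \<le> 1/2"
    by (rule jet_small[OF radius_jet]) simp
  have e_small: "\<forall>\<^sub>F t in at_right 0. \<forall>c\<in>{-1..1::real}. \<bar>edge t - 1\<bar> \<le> 1/2"
    by (rule jet_small[OF edge_jet]) simp
  show ?thesis
  \<comment> \<open>The factor \<open>4\<close> is \<open>2\<close> from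
    \<open>sqrt_perturbation\<close> times \<open>2\<close> from
    \<open>sqrt (4 - (e x)^2) = 2 * sqrt v\<close>; at the endpoints it is
    \<open>2 / edge t \<le> 4\<close>.\<close>
  proof (intro exI[of _ "4 * C1 + 4 * C2 + 4 * C3"] conjI)
    show "0 \<le> 4 * C1 + 4 * C2 + 4 * C3"
      using C1(1) C2(1) C3(1) by simp
    show "\<forall>\<^sub>F t in at_right 0. 1/2 \<le> edge t \<and>
     \<bar>x t 1 - 2 / edge t\<bar> \<le> (4 * C1 + 4 * C2 + 4 * C3) * t ^ 3 \<and> \<bar>x t (-1) + 2 / edge t\<bar> \<le> (4 * C1 + 4 * C2 + 4 * C3) * t ^ 3 \<and>
     (\<forall>c\<in>{-1..1}. (edge t * x t c)\<^sup>2 < 4 \<longrightarrow>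
       \<bar>real_radius t c * sqrt (1 - c\<^sup>2) - correction t (x t c) * (sqrt (4 - (edge t * x t c)\<^sup>2) / 2)\<bar>
         \<le> (4 * C1 + 4 * C2 + 4 * C3) * t ^ 3 / sqrt (4 - (edge t * x t c)\<^sup>2))"
      using C1(2) C2(2) C3(2) T_small A_small r_small e_small eventually_at_right_less[of 0]
    proof eventually_elim
      case (elim t)
      have e: "1/2 \<le> edge t"
        using abs_le_D2[OF bspec[OF elim(7), of 0]] by simp
      have t3: "t ^ 3 \<ge> 0" "C1 * t ^ 3 \<ge> 0" "C2 * t ^ 3 \<ge> 0" "C3 * t ^ 3 \<ge> 0"
        using elim(8) C1(1) C2(1) C3(1) by auto
      have x_eq: "x t c = 2 * y t c / edge t" for c
        using e by (simp add: y_def)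
      have endpoint: "\<bar>2 * z / edge t\<bar> \<le> (4 * C1 + 4 * C2 + 4 * C3) * t ^ 3" if "\<bar>z\<bar> \<le> C3 * t ^ 3" for z
      proof -
        have "\<bar>2 * z / edge t\<bar> = 2 * \<bar>z\<bar> / edge t"
          using e by (simp add: abs_mult)
        also have "\<dots> \<le> 2 * \<bar>z\<bar> / (1/2)"
          using e by (intro divide_left_mono) auto
        also have "\<dots> \<le> 4 * (C3 * t ^ 3)"
          using that by simp
        also have "\<dots> \<le> (4 * C1 + 4 * C2 + 4 * C3) * t ^ 3"
          using t3 by (simp add: algebra_simps)
        finally show ?thesis .
      qed
      \<comment> \<open>At \<open>c = 1\<close> and \<open>c = -1\<close> both correction
        coefficients of \<open>y\<close> vanish, so only the \<open>O(t^3)\<close> remainder is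
        left.\<close>
      have "\<bar>y t 1 - 1\<bar> \<le> C3 * t ^ 3" "\<bar>y t (-1) + 1\<bar> \<le> C3 * t ^ 3"
        using bspec[OF elim(3), of 1] bspec[OF elim(3), of "-1"] by simp_all
      from this[THEN endpoint]
      have ends: "\<bar>x t 1 - 2 / edge t\<bar> \<le> (4 * C1 + 4 * C2 + 4 * C3) * t ^ 3"
         "\<bar>x t (-1) + 2 / edge t\<bar> \<le> (4 * C1 + 4 * C2 + 4 * C3) * t ^ 3"
        unfolding x_eq by (simp_all add: right_diff_distrib distrib_left diff_divide_distrib add_divide_distrib)
      have main: "\<bar>real_radius t c * sqrt (1 - c\<^sup>2) - correction t (x t c) * (sqrt (4 - (edge t * x t c)\<^sup>2) / 2)\<bar>
         \<le> (4 * C1 + 4 * C2 + 4 * C3) * t ^ 3 / sqrt (4 - (edge t * x t c)\<^sup>2)"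
        if c: "c \<in> {-1..1}" and lt: "(edge t * x t c)\<^sup>2 < 4" for c
      proof -
        define v where "v = 1 - y t c * y t c"
        have v4: "4 - (edge t * x t c)\<^sup>2 = 4 * v"
          by (simp add: v_def y_def power2_eq_square)
        have v: "0 < v" "v \<le> 1"
          using lt v4 by (simp_all add: v_def)
        have sqrt4: "sqrt (4 - (edge t * x t c)\<^sup>2) = 2 * sqrt v"
          unfolding v4 by (simp add: real_sqrt_mult)
        have c2: "c\<^sup>2 \<le> 1"
          using c by (simp add: abs_square_le_1 abs_le_iff)
        have "\<bar>real_radius t c * sqrt (1 - c\<^sup>2) - A' t c * sqrt v\<bar> \<le> (2 * (C1 * t ^ 3) + 2 * (C2 * t ^ 3)) / sqrt v"
        proof (rule sqrt_perturbation[OF v])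
          show "\<bar>v - (1 - c\<^sup>2) * T t c\<bar> \<le> C1 * t ^ 3"
            using bspec[OF elim(1) c] by (simp only: v_def)
          show "\<bar>(A' t c)\<^sup>2 * T t c - (real_radius t c)\<^sup>2\<bar> \<le> C2 * t ^ 3"
            using bspec[OF elim(2) c] by (simp only: power2_eq_square)
          show "0 \<le> T t c" "0 \<le> A' t c" "A' t c \<le> 2" "1/2 \<le> real_radius t c"
            using bspec[OF elim(4) c] bspec[OF elim(5) c] bspec[OF elim(6) c] by linarith+
        qed (use c2 in auto)
        also have "\<dots> \<le> (2 * (C1 * t ^ 3) + 2 * (C2 * t ^ 3) + 2 * (C3 * t ^ 3)) / sqrt v"
          using t3 v by (intro divide_right_mono) auto
        also have "\<dots> = (4 * C1 + 4 * C2 + 4 * C3) * t ^ 3 / (2 * sqrt v)"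
        proof -
          have "(4 * C1 + 4 * C2 + 4 * C3) * t ^ 3 = 2 * (2 * (C1 * t ^ 3) + 2 * (C2 * t ^ 3) + 2 * (C3 * t ^ 3))"
            by (simp add: algebra_simps)
          then show ?thesis
            by (simp only: mult_divide_mult_cancel_left_if) simp
        qed
        finally show ?thesis
          unfolding A'_eq sqrt4 by simp
      qed
      show ?case
        using e ends main by blast
    qed
  qed
qed

end

section \<open>The expansion of the density\<close>

lemma scaled_distribution:
  assumes "is_free_convolution_power \<mu> n \<nu>"
  shows "real_distribution (distr \<nu> borel (\<lambda>u. u * t))" (is "real_distribution ?N")
    "moment (distr \<nu> borel (\<lambda>u. u * t)) k = t ^ k * moment \<nu> k"
    "\<exists>L. AE x in distr \<nu> borel (\<lambda>u. u * t). \<bar>x\<bar> \<le> L"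
proof -
  from assms have \<nu>: "real_distribution \<nu>" "compactly_supported \<nu>"
    by (auto simp: is_free_convolution_power_def has_distribution_def)
  interpret real_distribution \<nu> by (rule \<nu>(1))
  have meas: "(\<lambda>u. u * t) \<in> borel_measurable \<nu>"
    by simp
  show "real_distribution ?N"
    by (rule real_distribution_distr) simp
  have "moment ?N k = (LINT u|\<nu>. (u * t) ^ k)"
    unfolding moment_def using meas by (intro integral_distr) auto
  then show "moment ?N k = t ^ k * moment \<nu> k"
    by (simp add: moment_def power_mult_distrib mult.commute)
  obtain L where L: "AE x in \<nu>. \<bar>x\<bar> \<le> L"
    using compactly_supported_AE[OF \<nu>] by blast
  have "AE u in \<nu>. \<bar>u * t\<bar> \<le> L * \<bar>t\<bar>"
    using L by eventually_elim (simp add: abs_mult mult_right_mono)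
  then show "\<exists>L. AE x in ?N. \<bar>x\<bar> \<le> L"
    using meas by (intro exI[of _ "L * \<bar>t\<bar>"]) (simp add: AE_distr_iff)
qed

context free_clt_coeffs
begin

lemma free_clt_expansion:
  fixes \<mu> :: "real measure"
  assumes \<mu>: "real_distribution \<mu>" and \<rho>_eq: "Abs_fps \<rho> = r_transform (Abs_fps (moment \<mu>))"
    and \<rho>_23: "\<rho> 2 = moment \<mu> 3" "\<rho> 3 = moment \<mu> 4 - 2"
  shows "\<exists>c1 > 0. \<exists>c2 > 0. \<exists>c > (0::real). \<forall>n::nat. real n \<ge> c1 \<longrightarrow>
    (\<forall>\<nu>. is_free_convolution_power \<mu> n \<nu> \<longrightarrow>
      (let a = a_coeff \<mu> n; b = b_coeff \<mu> n; d = d_coeff \<mu> n; e = e_coeff \<mu> n;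
           h = c2 / real n powr (3/2); J = {- 2 / e + h .. 2 / e - h}
       in \<exists>p :: real \<Rightarrow> real.
            (\<forall>x. 0 \<le> p x) \<and>
            distributed \<nu> lborel (\<lambda>u. u / sqrt n) (\<lambda>x. ennreal (p x)) \<and>
            continuous_on UNIV p \<and>
            (\<forall>x. p x \<le> 2) \<and>
            (\<forall>x\<in>J. \<exists>\<theta>::real. \<bar>\<theta>\<bar> \<le> 1 \<and>
               p (x + a) = (1 + d / 2 - a\<^sup>2 - 1 / n - a * x - (b - a\<^sup>2 - 1 / n) * x\<^sup>2)
                              * wigner_density (e * x)
                            + c * \<theta> / (real n powr (3/2) * sqrt (4 - (e * x)\<^sup>2))) \<and>
            (LINT x:- J|lborel. p (x + a)) \<le> c / real n powr (3/2)))"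
proof -
  let ?X = real_abscissa
  define x where "x t c = ?X t c - \<rho> 2 * t" for t c
  obtain C where C: "C \<ge> 0" and ev: "\<forall>\<^sub>F t in at_right 0. 1/2 \<le> edge t \<and>
     \<bar>x t 1 - 2 / edge t\<bar> \<le> C * t ^ 3 \<and> \<bar>x t (-1) + 2 / edge t\<bar> \<le> C * t ^ 3 \<and>
     (\<forall>c\<in>{-1..1}. (edge t * x t c)\<^sup>2 < 4 \<longrightarrow>
       \<bar>real_radius t c * sqrt (1 - c\<^sup>2) - correction t (x t c) * (sqrt (4 - (edge t * x t c)\<^sup>2) / 2)\<bar>
         \<le> C * t ^ 3 / sqrt (4 - (edge t * x t c)\<^sup>2))"
    using local_asymptotics unfolding x_def by blast
  obtain \<tau> where \<tau>: "\<tau> > 0" and asym: "\<And>t. 0 < t \<Longrightarrow> t < \<tau> \<Longrightarrow> 1/2 \<le> edge t \<and>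
     \<bar>x t 1 - 2 / edge t\<bar> \<le> C * t ^ 3 \<and> \<bar>x t (-1) + 2 / edge t\<bar> \<le> C * t ^ 3 \<and>
     (\<forall>c\<in>{-1..1}. (edge t * x t c)\<^sup>2 < 4 \<longrightarrow>
       \<bar>real_radius t c * sqrt (1 - c\<^sup>2) - correction t (x t c) * (sqrt (4 - (edge t * x t c)\<^sup>2) / 2)\<bar>
         \<le> C * t ^ 3 / sqrt (4 - (edge t * x t c)\<^sup>2))"
    using ev unfolding eventually_at_right_field by blast
  \<comment> \<open>Halving \<open>\<tau>\<close> turns \<open>t \<le> t1\<close> into the strict
    \<open>t < \<tau>\<close>; with \<open>t = 1 / sqrt n\<close> the threshold for \<open>n\<close>
    is \<open>1 / t1^2\<close>.\<close>
  define t1 where "t1 = min t0 (\<tau> / 2)"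
  have t1: "t1 > 0"
    using t0_pos \<tau> by (simp add: t1_def)
  \<comment> \<open>\<open>C\<close> may be zero while \<open>c2\<close> must be positive. The
    \<open>8\<close> in \<open>K\<close> is the tail bound: two windows of width
    \<open>2 * h\<close>, on which the density is at most \<open>2\<close>.\<close>
  define c2 where "c2 = C + 1"
  define K where "K = 8 * c2"
  have c2: "c2 > 0" and K: "K > 0" "C \<le> K"
    using C by (simp_all add: c2_def K_def)
  show ?thesis
  proof (rule exI[of _ "1 / t1\<^sup>2"], intro conjI, use t1 in simp,
      rule exI[of _ c2], intro conjI c2, rule exI[of _ K], intro conjI K(1), intro allI impI)
    fix n :: nat and \<nu>
    assume n: "1 / t1\<^sup>2 \<le> real n" and conv: "is_free_convolution_power \<mu> n \<nu>"
    define t where "t = 1 / sqrt n"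
    have n_pos: "real n > 0"
      using n t1 by (metis less_le_trans zero_less_divide_1_iff zero_less_power)
    then have t_pos: "t > 0"
      by (simp add: t_def)
    have nt: "real n * t\<^sup>2 = 1"
      using n_pos by (simp add: t_def power_divide)
    have t2: "t\<^sup>2 = 1 / n"
      using nt n_pos by (simp add: field_simps)
    have "t \<le> t1"
    proof -
      have "1 \<le> real n * t1\<^sup>2"
        using n by (rule pos_divide_le_eq[OF zero_less_power[OF t1], THEN iffD1])
      then have "1 \<le> t1\<^sup>2 * real n"
        by (subst mult.commute)
      then have "1 / real n \<le> t1\<^sup>2"
        by (rule pos_divide_le_eq[OF n_pos, THEN iffD2])
      then have "t\<^sup>2 \<le> t1\<^sup>2"
        unfolding t2 .
      then show ?thesis
        by (rule power2_le_imp_le) (rule less_imp_le[OF t1])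
    qed
    then have t: "0 < t" "t \<le> t0" "t < \<tau>"
      using t_pos \<tau> by (auto simp: t1_def)
    have powr: "real n powr (3/2) = 1 / t ^ 3"
    proof -
      have "real n powr (3/2) = (real n powr (1/2)) powr 3"
        by (simp add: powr_powr)
      also have "\<dots> = sqrt n ^ 3"
        using n_pos by (simp add: powr_half_sqrt)
      finally show ?thesis
        by (simp add: t_def power_divide)
    qed
    have a: "a_coeff \<mu> n = \<rho> 2 * t"
      by (simp add: a_coeff_def \<rho>_23 t_def)
    have b: "b_coeff \<mu> n = \<beta> * t\<^sup>2"
    proof -
      have "moment \<mu> 4 - (moment \<mu> 3)\<^sup>2 - 1 = \<beta>"
        by (simp add: \<rho>_23)
      then show ?thesis
        by (simp add: b_coeff_def t2)
    qed
    have d: "d_coeff \<mu> n = (\<beta> + 1) * t\<^sup>2"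
    proof -
      have "moment \<mu> 4 - (moment \<mu> 3)\<^sup>2 = \<beta> + 1"
        by (simp add: \<rho>_23)
      then show ?thesis
        by (simp add: d_coeff_def t2)
    qed
    have e: "e_coeff \<mu> n = edge t"
      by (simp only: e_coeff_def edge_def b d)
    define \<epsilon> h where "\<epsilon> = edge t" and "h = c2 * t ^ 3"
    define J where "J = {- 2 / \<epsilon> + h .. 2 / \<epsilon> - h}"
    have h_pos: "h > 0"
      using c2 t by (simp add: h_def)
    have Ch: "C * t ^ 3 \<le> h"
      using t_pos by (simp add: h_def c2_def distrib_right)
    note at_t = asym[OF t(1,3)]
    have \<epsilon>: "1/2 \<le> \<epsilon>"
      unfolding \<epsilon>_def by (rule conjunct1[OF at_t])
    have right: "\<bar>?X t 1 - \<rho> 2 * t - 2 / \<epsilon>\<bar> \<le> h"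
      using order_trans[OF conjunct1[OF conjunct2[OF at_t]] Ch] by (simp only: \<epsilon>_def x_def)
    have left: "\<bar>?X t (-1) - \<rho> 2 * t + 2 / \<epsilon>\<bar> \<le> h"
      using order_trans[OF conjunct1[OF conjunct2[OF conjunct2[OF at_t]]] Ch] by (simp only: \<epsilon>_def x_def)
    have bulk: "\<bar>real_radius t c * sqrt (1 - c\<^sup>2) - correction t (x t c) * (sqrt (4 - (\<epsilon> * x t c)\<^sup>2) / 2)\<bar>
         \<le> C * t ^ 3 / sqrt (4 - (\<epsilon> * x t c)\<^sup>2)" if "c \<in> {-1..1}" "(\<epsilon> * x t c)\<^sup>2 < 4" for c
      using bspec[OF conjunct2[OF conjunct2[OF conjunct2[OF at_t]]] that(1)] that(2) by (simp only: \<epsilon>_def)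
    from free_clt_density(3)[OF t(1,2) nt] obtain p where P: "continuous_on UNIV p \<and>
       (\<forall>x. 0 \<le> p x \<and> p x \<le> 2) \<and> (\<forall>x. x \<notin> {?X t (-1)..?X t 1} \<longrightarrow> p x = 0) \<and>
       (\<forall>c. \<bar>c\<bar> \<le> 1 \<longrightarrow> p (?X t c) = real_radius t c * sqrt (1 - c\<^sup>2) / pi) \<and>
       (\<forall>k. real (Suc k) * integral {?X t (-1)..?X t 1} (\<lambda>x. x ^ k * p x) =
          t ^ k * ((1 + of_nat n * fps_X * Abs_fps \<rho>) ^ Suc k) $ k)" ..
    note P1 = conjunct2[OF P] and P2 = conjunct2[OF conjunct2[OF P]] and P3 = conjunct2[OF conjunct2[OF conjunct2[OF P]]]
    have p: "continuous_on UNIV p" "\<And>x. 0 \<le> p x" "\<And>x. p x \<le> 2"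
      using conjunct1[OF P] conjunct1[OF P1] by simp_all
    have p_0: "p x = 0" if "x \<notin> {?X t (-1)..?X t 1}" for x
      using conjunct1[OF P2] that by blast
    have p_X: "p (?X t c) = real_radius t c * sqrt (1 - c\<^sup>2) / pi" if "\<bar>c\<bar> \<le> 1" for c
      using spec[OF conjunct1[OF P3]] that by (rule mp)
    have moments: "real (Suc k) * integral {?X t (-1)..?X t 1} (\<lambda>x. x ^ k * p x) =
          t ^ k * ((1 + of_nat n * fps_X * Abs_fps \<rho>) ^ Suc k) $ k" for k
      by (rule spec[OF conjunct2[OF P3]])
    have image: "?X t ` {-1..1} = {?X t (-1)..?X t 1}"
      by (rule free_clt_density(2)[OF t(1,2) nt])
    obtain L where L: "AE x in distr \<nu> borel (\<lambda>u. u * t). \<bar>x\<bar> \<le> L"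
      using scaled_distribution(3)[OF conv] by blast
    have dens: "distr \<nu> borel (\<lambda>u. u * t) = density lborel (\<lambda>x. ennreal (p x))"
    proof (rule distribution_eq_density[OF scaled_distribution(1)[OF conv] L p(1,2) p_0])
      fix k
      have "real (Suc k) * integral {?X t (-1)..?X t 1} (\<lambda>x. x ^ k * p x) = t ^ k * (real (Suc k) * moment \<nu> k)"
        by (simp only: moments free_convolution_power_moments[OF conv \<mu>] \<rho>_eq)
      also have "\<dots> = real (Suc k) * (t ^ k * moment \<nu> k)"
        by (rule mult.left_commute)
      finally have "integral {?X t (-1)..?X t 1} (\<lambda>x. x ^ k * p x) = t ^ k * moment \<nu> k"
        by (simp only: mult_cancel_left of_nat_eq_0_iff) simp
      then show "moment (distr \<nu> borel (\<lambda>u. u * t)) k = integral {?X t (-1)..?X t 1} (\<lambda>x. x ^ k * p x)"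
        by (simp only: scaled_distribution(2)[OF conv])
    qed
    interpret \<nu>: real_distribution \<nu>
      using conv by (auto simp: is_free_convolution_power_def has_distribution_def)
    have p_meas: "p \<in> borel_measurable borel"
      by (rule borel_measurable_continuous_onI[OF p(1)])
    have "distr \<nu> lborel (\<lambda>u. u / sqrt n) = distr \<nu> borel (\<lambda>u. u * t)"
      by (rule distr_cong) (simp_all add: t_def)
    then have distributed: "distributed \<nu> lborel (\<lambda>u. u / sqrt n) (\<lambda>x. ennreal (p x))"
      using p_meas unfolding distributed_def dens by simp
    have expansion: "\<exists>\<theta>::real. \<bar>\<theta>\<bar> \<le> 1 \<and> p (y + \<rho> 2 * t) =
        correction t y * wigner_density (\<epsilon> * y) + K * \<theta> / (1 / t ^ 3 * sqrt (4 - (\<epsilon> * y)\<^sup>2))" if y: "y \<in> J" for y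
    proof -
      \<comment> \<open>The ends of the support lie within \<open>h\<close> of the points
        \<open>2 / \<epsilon>\<close> and \<open>- 2 / \<epsilon>\<close> after the shift, so the
        shrunken interval \<open>J\<close> is covered by the curve.\<close>
      have "y + \<rho> 2 * t \<in> {?X t (-1)..?X t 1}"
        using y left right unfolding J_def abs_le_iff by auto
      then obtain c where c: "c \<in> {-1..1}" "?X t c = y + \<rho> 2 * t"
        unfolding image[symmetric] by auto
      have xc: "x t c = y"
        by (simp add: x_def c(2))
      have "\<bar>y\<bar> < 2 / \<epsilon>"
        using y h_pos by (auto simp: J_def)
      then have "\<bar>\<epsilon> * y\<bar> < 2"
        using \<epsilon> by (simp add: abs_mult field_simps)
      then have "\<bar>\<epsilon> * y\<bar>\<^sup>2 < 2\<^sup>2"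
        by (intro power_strict_mono) auto
      then have lt: "(\<epsilon> * y)\<^sup>2 < 4"
        by simp
      define S where "S = sqrt (4 - (\<epsilon> * y)\<^sup>2)"
      have S: "S > 0"
        using lt by (simp add: S_def)
      define D where "D = real_radius t c * sqrt (1 - c\<^sup>2) - correction t y * (S / 2)"
      have D: "\<bar>D\<bar> \<le> C * t ^ 3 / S"
        using bulk[OF c(1)] lt unfolding xc D_def S_def by blast
      \<comment> \<open>Obtained by solving the claimed formula for \<theta>; the bound on
        \<open>D\<close> then gives absolute value at most \<open>C / K \<le> 1\<close>.\<close>
      define \<theta> where "\<theta> = D / pi * S / (K * t ^ 3)"
      have "\<bar>D / pi\<bar> * S \<le> \<bar>D\<bar> * S"
      proof (rule mult_right_mono)
        have "\<bar>D\<bar> / pi \<le> \<bar>D\<bar> / 1"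
          using pi_gt3 by (intro divide_left_mono) auto
        then show "\<bar>D / pi\<bar> \<le> \<bar>D\<bar>"
          by simp
      qed (use S in simp)
      also have "\<dots> \<le> C * t ^ 3"
        using D S by (simp add: field_simps)
      also have "\<dots> \<le> K * t ^ 3"
        using K t by (intro mult_right_mono) auto
      finally have "\<bar>\<theta>\<bar> \<le> 1"
        using S K t by (simp add: \<theta>_def abs_mult field_simps)
      moreover have "p (y + \<rho> 2 * t) = correction t y * wigner_density (\<epsilon> * y) + K * \<theta> / (1 / t ^ 3 * S)"
      proof -
        have "p (y + \<rho> 2 * t) = real_radius t c * sqrt (1 - c\<^sup>2) / pi"
          using p_X[of c] c by (simp add: abs_le_iff)
        also have "\<dots> = correction t y * (S / (2 * pi)) + D / pi"
          by (simp add: D_def field_simps)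
        also have "S / (2 * pi) = wigner_density (\<epsilon> * y)"
          using lt by (simp add: wigner_density_def S_def)
        also have "D / pi = K * \<theta> / (1 / t ^ 3 * S)"
          using S K t by (simp add: \<theta>_def)
        finally show ?thesis .
      qed
      ultimately show ?thesis
        unfolding S_def by blast
    qed
    have tail: "(LINT y:- J|lborel. p (y + \<rho> 2 * t)) \<le> K / (1 / t ^ 3)"
    proof -
      \<comment> \<open>Outside \<open>J\<close> the shifted density can be nonzero only in these
        windows around the edges, because the support ends within \<open>h\<close> of them.\<close>
      let ?W1 = "{- 2 / \<epsilon> - h..- 2 / \<epsilon> + h}" and ?W2 = "{2 / \<epsilon> - h..2 / \<epsilon> + h}"
      let ?g = "\<lambda>y. 2 * (indicat_real ?W1 y + indicat_real ?W2 y)"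
      have "(LINT y:- J|lborel. p (y + \<rho> 2 * t)) \<le> (LINT y|lborel. ?g y)"
        unfolding set_lebesgue_integral_def
      proof (rule integral_mono')
        show "integrable lborel ?g"
          by (intro integrable_mult_right Bochner_Integration.integrable_add integrable_real_indicator) (auto simp: emeasure_lborel_Icc_eq)
        fix y :: real
        show g0: "0 \<le> ?g y"
          by simp
        show "indicat_real (- J) y *\<^sub>R p (y + \<rho> 2 * t) \<le> ?g y"
        proof (cases "y \<in> - J \<and> y + \<rho> 2 * t \<in> {?X t (-1)..?X t 1}")
          case True
          then have "- 2 / \<epsilon> - h \<le> y" "y \<le> 2 / \<epsilon> + h" "y < - 2 / \<epsilon> + h \<or> 2 / \<epsilon> - h < y"
            using left right unfolding J_def abs_le_iff by auto
          then have "y \<in> ?W1 \<or> y \<in> ?W2"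
            by auto
          then show ?thesis
            using p(3)[of "y + \<rho> 2 * t"] True by (auto simp: indicator_def)
        next
          case False
          then have "indicat_real (- J) y *\<^sub>R p (y + \<rho> 2 * t) = 0"
            using p_0[of "y + \<rho> 2 * t"] by (auto simp: indicator_def)
          then show ?thesis
            by (rule ord_eq_le_trans) (rule g0)
        qed
      qed
      also have "\<dots> = 2 * (measure lborel ?W1 + measure lborel ?W2)"
        by (subst integral_mult_right_zero, subst Bochner_Integration.integral_add)
          (auto simp: emeasure_lborel_Icc_eq)
      also have "\<dots> = K / (1 / t ^ 3)"
        using h_pos by (simp add: K_def h_def)
      finally show ?thesis .
    qed
    have corr: "1 + (\<beta> + 1) * t\<^sup>2 / 2 - (\<rho> 2 * t)\<^sup>2 - 1 / real n - \<rho> 2 * t * y -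
        (\<beta> * t\<^sup>2 - (\<rho> 2 * t)\<^sup>2 - 1 / real n) * y\<^sup>2 = correction t y" for y
      by (simp only: correction_def t2)
    have h: "c2 / (1 / t ^ 3) = h"
      by (simp add: h_def)
    show "let a = a_coeff \<mu> n; b = b_coeff \<mu> n; d = d_coeff \<mu> n; e = e_coeff \<mu> n;
           h = c2 / real n powr (3/2); J = {- 2 / e + h .. 2 / e - h}
       in \<exists>p :: real \<Rightarrow> real.
            (\<forall>x. 0 \<le> p x) \<and>
            distributed \<nu> lborel (\<lambda>u. u / sqrt n) (\<lambda>x. ennreal (p x)) \<and>
            continuous_on UNIV p \<and>
            (\<forall>x. p x \<le> 2) \<and>
            (\<forall>x\<in>J. \<exists>\<theta>::real. \<bar>\<theta>\<bar> \<le> 1 \<and>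
               p (x + a) = (1 + d / 2 - a\<^sup>2 - 1 / n - a * x - (b - a\<^sup>2 - 1 / n) * x\<^sup>2)
                              * wigner_density (e * x)
                            + K * \<theta> / (real n powr (3/2) * sqrt (4 - (e * x)\<^sup>2))) \<and>
            (LINT x:- J|lborel. p (x + a)) \<le> K / real n powr (3/2)"
      unfolding Let_def a b d e powr corr h \<epsilon>_def[symmetric] J_def[symmetric]
    proof (intro exI[of _ p] conjI allI ballI)
      show "0 \<le> p x" "p x \<le> 2" for x
        by (rule p)+
    qed (rule distributed p(1) expansion tail | assumption)+
  qed
qed

end

theorem theorem2p10:
  fixes \<mu> :: "real measure"
  assumes "real_distribution \<mu>"
    and "compactly_supported \<mu>"
    and "moment \<mu> 1 = 0"
    and "moment \<mu> 2 = 1"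
  shows "\<exists>c1 > 0. \<exists>c2 > 0. \<exists>c > (0::real). \<forall>n::nat. real n \<ge> c1 \<longrightarrow>
    (\<forall>\<nu>. is_free_convolution_power \<mu> n \<nu> \<longrightarrow>
      (let a = a_coeff \<mu> n; b = b_coeff \<mu> n; d = d_coeff \<mu> n; e = e_coeff \<mu> n;
           h = c2 / real n powr (3/2); J = {- 2 / e + h .. 2 / e - h}
       in \<exists>p :: real \<Rightarrow> real.
            (\<forall>x. 0 \<le> p x) \<and>
            distributed \<nu> lborel (\<lambda>u. u / sqrt n) (\<lambda>x. ennreal (p x)) \<and>
            continuous_on UNIV p \<and>
            (\<forall>x. p x \<le> 2) \<and>
            (\<forall>x\<in>J. \<exists>\<theta>::real. \<bar>\<theta>\<bar> \<le> 1 \<and>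
               p (x + a) = (1 + d / 2 - a\<^sup>2 - 1 / n - a * x - (b - a\<^sup>2 - 1 / n) * x\<^sup>2)
                              * wigner_density (e * x)
                            + c * \<theta> / (real n powr (3/2) * sqrt (4 - (e * x)\<^sup>2))) \<and>
            (LINT x:- J|lborel. p (x + a)) \<le> c / real n powr (3/2)))"
proof -
  interpret \<mu>: real_distribution \<mu> by (rule assms(1))
  define m where "m = Abs_fps (moment \<mu>)"
  have m: "m $ 0 = 1" "m $ 1 = 0" "m $ 2 = 1"
    using assms moment_0[OF assms(1)] by (simp_all add: m_def)
  obtain L where L: "AE x in \<mu>. \<bar>x\<bar> \<le> L"
    using compactly_supported_AE[OF assms(1,2)] by blast
  \<comment> \<open>The maximum with \<open>1\<close> makes the base of the geometric moment bound
    positive.\<close>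
  have L': "AE x in \<mu>. \<bar>x\<bar> \<le> max 1 L"
    using L by eventually_elim auto
  have "\<bar>m $ k\<bar> \<le> 1 * max 1 L ^ k" for k
  proof -
    have "\<bar>moment \<mu> k\<bar> \<le> (LINT x|\<mu>. \<bar>x ^ k\<bar>)"
      unfolding moment_def by (rule integral_abs_bound)
    also have "\<dots> \<le> max 1 L ^ k"
      using \<mu>.bounded_moments(2)[OF L', of k] by (simp add: power_abs)
    finally show ?thesis
      by (simp add: m_def)
  qed
  then obtain A B where AB: "0 < B" "\<And>k. \<bar>r_transform m $ k\<bar> \<le> A * B ^ k"
    using r_transform_geometric_bound[of m 1 "max 1 L"] m(1) by (auto simp: less_max_iff_disj)
  note nth = r_transform_nth[OF m]
  interpret free_clt_coeffs "\<lambda>k. r_transform m $ k" A B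
    by unfold_locales (use AB nth in simp_all)
  show ?thesis
  proof (rule free_clt_expansion[OF assms(1)])
    show "Abs_fps (\<lambda>k. r_transform m $ k) = r_transform (Abs_fps (moment \<mu>))"
      by (simp add: m_def fps_nth_inverse)
    show "r_transform m $ 2 = moment \<mu> 3" "r_transform m $ 3 = moment \<mu> 4 - 2"
      using nth(3,4) by (simp_all only: m_def fps_nth_Abs_fps)
  qed
qed

end
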